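(* Let $K(\mathcal{X})/K(x)$ be a linearized function field given by $L(y)=h(x)$, with $q$, $s$, $m$, $r$, $P_1,\dots,P_r$, $\lambda_1,\dots,\lambda_r$ and $Q_1,\dots,Q_r$ as in the context. Let $2\leq n\leq q^s$ (with $n\leq r$) and let $\mathbf{Q}=(Q_1,Q_2,\dots,Q_n)$ be an $n$-tuple of distinct totally ramified places of degree one in $K(\mathcal{X})/K(x)$. For $1\leq i\leq q^m-1$ and $1\leq l\leq r$ let $$t_l(i)=(i\lambda_l)\bmod q^m\qquad\text{and}\qquad \beta(i)=\sum_{k=1}^{r}\left\lceil\frac{i\lambda_k}{q^m}\right\rceil\deg(P_k)-1.$$ Let $\Upsilon$ denote either $\Gamma$ or $\Lambda$. Then $$\widehat{\Upsilon}(\mathbf{Q})=\left\{(q^mj_1+t_1(i),\dots,q^mj_n+t_n(i)) : 1\leq i\leq q^m-1,\ j_1,\dots,j_n\in\mathbb{Z},\ j_1+\cdots+j_n=\beta(i)+1-n+\rho\right\}$$ $$\cup\ \left\{(q^mj_1,q^mj_2,\dots,q^mj_n) : j_1,j_2,\dots,j_n\in\mathbb{Z},\ j_1+j_2+\cdots+j_n=\rho\right\},$$ where $$\rho=\begin{cases}0,&\text{if }\Upsilon=\Gamma,\\ n-2,&\text{if }\Upsilon=\Lambda.\end{cases}$$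
   Context: Setting. Let $s,m$ be positive integers with $m\leq s$, let $q$ be a power of a prime $p$, and let $K=\mathbb{F}_{q^s}$. Let $L(y)=\sum_{k=0}^m a_k y^{q^k}\in K[y]$ be a linearized polynomial with $a_m\neq 0$, $a_0\neq 0$, all of whose roots lie in $K$. Let $h(x)\in K(x)$ be a rational function whose principal divisor in the rational function field $K(x)$ is $$(h(x))_{K(x)}=\gamma_1T_1+\cdots+\gamma_uT_u-\lambda_1P_1-\cdots-\lambda_rP_r,$$ where $T_1,\dots,T_u$ are the (distinct) places of $K(x)$ that are zeros of $h(x)$, $P_1,\dots,P_r$ are the (distinct) places of $K(x)$ that are poles of $h(x)$, and $\gamma_1,\dots,\gamma_u,\lambda_1,\dots,\lambda_r$ are positive integers with $p\nmid\lambda_k$ for all $1\leq k\leq r$. Let $\mathcal{X}$ be the curve over $K$ with affine equation $L(y)=h(x)$ and $K(\mathcal{X})=K(x,y)$ its function field (a linearized function field); one has $[K(\mathcal{X}):K(x)]=q^m$. The places $P_1,\dots,P_r$ are exactly the places of $K(x)$ totally ramified in $K(\mathcal{X})/K(x)$; for $1\leq i\leq r$, $Q_i$ denotes the unique place of $K(\mathcal{X})$ lying over $P_i$. Notation: $b\bmod a$ is the smallest nonnegative integer congruent to $b$ modulo $a$. Generalized Weierstrass semigroup. For an $n$-tuple $\mathbf{Q}=(Q_1,\dots,Q_n)$ of distinct rational (degree one) places, let $R_{\mathbf{Q}}$ be the ring of functions in $K(\mathcal{X})$ that are regular outside $\{Q_1,\dots,Q_n\}$, let $\nu_{Q_i}$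 be the discrete valuation at $Q_i$, and set $$\widehat{H}(\mathbf{Q})=\{(-\nu_{Q_1}(z),\dots,-\nu_{Q_n}(z))\in\mathbb{Z}^n : z\in R_{\mathbf{Q}}\setminus\{0\}\}.$$ Maximal elements. Let $I=\{1,\dots,n\}$. For a nonempty $J\subsetneq I$ and $\boldsymbol{\alpha}\in\mathbb{Z}^n$ put $$\nabla_J(\boldsymbol{\alpha})=\{\boldsymbol{\beta}\in\widehat{H}(\mathbf{Q}) : \beta_j=\alpha_j\text{ for }j\in J\text{ and }\beta_i<\alpha_i\text{ for }i\notin J\},\qquad \nabla(\boldsymbol{\alpha})=\bigcup_{i=1}^n\nabla_{\{i\}}(\boldsymbol{\alpha}).$$ An element $\boldsymbol{\alpha}\in\widehat{H}(\mathbf{Q})$ is maximal if $\nabla(\boldsymbol{\alpha})=\emptyset$. It is absolute maximal if it is maximal and $\nabla_J(\boldsymbol{\alpha})=\emptyset$ for every $J\subsetneq I$ with $|J|\geq 2$. It is relative maximal if it is maximal and $\nabla_J(\boldsymbol{\alpha})\neq\emptyset$ for every $J\subsetneq I$ with $|J|\geq 2$. The sets of absolute and relative maximal elements of $\widehat{H}(\mathbf{Q})$ are denoted $\widehat{\Gamma}(\mathbf{Q})$ and $\widehat{\Lambda}(\mathbf{Q})$, respectively. *)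

theory Defs
  imports
    "HOL-Library.FuncSet"
    "HOL-Algebra.Algebraic_Closure_Type"
    "Subresultants.More_Homomorphisms"
begin

section \<open>Fields over a constant field\<close>

text \<open>
  A field \<^term>\<open>F\<close> over a field \<^term>\<open>K\<close> is given by two types of class field and a field
  homomorphism \<open>\<kappa>\<close> from the first to the second.
\<close>

definition subfield_set :: "'f::field set \<Rightarrow> bool" where
  "subfield_set S \<longleftrightarrow> 0 \<in> S \<and> 1 \<in> S \<and>
     (\<forall>a\<in>S. \<forall>b\<in>S. a + b \<in> S \<and> a - b \<in> S \<and> a * b \<in> S) \<and> (\<forall>a\<in>S. inverse a \<in> S)"

definition generated_subfield :: "'f::field set \<Rightarrow> 'f set" where
  "generated_subfield A = \<Inter>{S. subfield_set S \<and> A \<subseteq> S}"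

text \<open>The rational function field \<open>K(x)\<close> is \<^typ>\<open>'a poly fract\<close>, with these constants.\<close>

definition const_fract :: "'a::field \<Rightarrow> 'a poly fract" where
  "const_fract c = to_fract [:c:]"

section \<open>Places\<close>

definition valuation_ring :: "('k::field \<Rightarrow> 'f::field) \<Rightarrow> 'f set \<Rightarrow> bool" where
  "valuation_ring \<kappa> R \<longleftrightarrow>
     (\<forall>a\<in>R. \<forall>b\<in>R. a + b \<in> R \<and> a - b \<in> R \<and> a * b \<in> R) \<and>
     range \<kappa> \<subset> R \<and> R \<subset> UNIV \<and> (\<forall>z. z \<in> R \<or> inverse z \<in> R)"

text \<open>
  A place is the maximal ideal, i.e. the set of non-units, of a valuation ring.  Since
  \<^prop>\<open>inverse 0 = (0 :: 'f::field)\<close>, the element 0 has to be treated separately here and below.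
\<close>

definition place :: "('k::field \<Rightarrow> 'f::field) \<Rightarrow> 'f set \<Rightarrow> bool" where
  "place \<kappa> P \<longleftrightarrow> (\<exists>R. valuation_ring \<kappa> R \<and> P = {z \<in> R. z = 0 \<or> inverse z \<notin> R})"

text \<open>The valuation ring is recovered from the place.\<close>

definition place_ring :: "'f::field set \<Rightarrow> 'f set" where
  "place_ring P = {z. z = 0 \<or> inverse z \<notin> P}"

text \<open>
  The normalised discrete valuation at \<open>P\<close>: \<open>z = t\<^sup>k w\<close> with \<open>t\<close> a prime element and \<open>w\<close> a unit.
  It is meaningful for nonzero arguments only.
\<close>

definition place_val :: "'f::field set \<Rightarrow> 'f \<Rightarrow> int" where
  "place_val P z = (THE k. \<exists>t w. P = (\<lambda>g. t * g) ` place_ring P \<and>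
      w \<noteq> 0 \<and> w \<in> place_ring P \<and> inverse w \<in> place_ring P \<and> z = t powi k * w)"

text \<open>
  The degree of \<open>P\<close> is the dimension over \<open>K\<close> of the residue field \<open>place_ring P / P\<close>; \<open>B\<close> ranges
  over sets of representatives of a basis.
\<close>

definition place_degree :: "('k::field \<Rightarrow> 'f::field) \<Rightarrow> 'f set \<Rightarrow> nat" where
  "place_degree \<kappa> P = (THE d. \<exists>B \<subseteq> place_ring P. finite B \<and> card B = d \<and>
      (\<forall>c. (\<Sum>b\<in>B. \<kappa> (c b) * b) \<in> P \<longrightarrow> (\<forall>b\<in>B. c b = 0)) \<and>
      (\<forall>z\<in>place_ring P. \<exists>c. z - (\<Sum>b\<in>B. \<kappa> (c b) * b) \<in> P))"

definition lies_over :: "('e::field \<Rightarrow> 'f::field) \<Rightarrow> 'f set \<Rightarrow> 'e set \<Rightarrow> bool" where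
  "lies_over \<iota> Q P \<longleftrightarrow> \<iota> ` P \<subseteq> Q"

text \<open>Divisors are written as integer-valued functions on places, extended by 0 to all sets.\<close>

definition principal_divisor :: "('k::field \<Rightarrow> 'f::field) \<Rightarrow> 'f \<Rightarrow> 'f set \<Rightarrow> int" where
  "principal_divisor \<kappa> z = (\<lambda>P. if place \<kappa> P then place_val P z else 0)"

section \<open>Generalized Weierstrass semigroups and maximal elements\<close>

text \<open>
  Elements of \<open>\<int>\<^sup>n\<close> are functions on \<^term>\<open>{1..n}\<close>, made canonical by being undefined elsewhere.
\<close>

definition regular_outside :: "('k::field \<Rightarrow> 'f::field) \<Rightarrow> 'f set set \<Rightarrow> 'f set" where
  "regular_outside \<kappa> A = {z. \<forall>P. place \<kappa> P \<and> P \<notin> A \<longrightarrow> z \<in> place_ring P}"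

definition weierstrass_semigroup ::
  "('k::field \<Rightarrow> 'f::field) \<Rightarrow> nat \<Rightarrow> (nat \<Rightarrow> 'f set) \<Rightarrow> (nat \<Rightarrow> int) set" where
  "weierstrass_semigroup \<kappa> n Q =
     {(\<lambda>k\<in>{1..n}. - place_val (Q k) z) | z. z \<in> regular_outside \<kappa> (Q ` {1..n}) - {0}}"

definition nabla ::
  "nat \<Rightarrow> (nat \<Rightarrow> int) set \<Rightarrow> nat set \<Rightarrow> (nat \<Rightarrow> int) \<Rightarrow> (nat \<Rightarrow> int) set" where
  "nabla n H J \<alpha> = {\<beta> \<in> H. (\<forall>j\<in>J. \<beta> j = \<alpha> j) \<and> (\<forall>i\<in>{1..n} - J. \<beta> i < \<alpha> i)}"

definition maximal_elements :: "nat \<Rightarrow> (nat \<Rightarrow> int) set \<Rightarrow> (nat \<Rightarrow> int) set" where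
  "maximal_elements n H = {\<alpha> \<in> H. (\<Union>i\<in>{1..n}. nabla n H {i} \<alpha>) = {}}"

definition absolute_maximal_elements :: "nat \<Rightarrow> (nat \<Rightarrow> int) set \<Rightarrow> (nat \<Rightarrow> int) set" where
  "absolute_maximal_elements n H = {\<alpha> \<in> maximal_elements n H.
     \<forall>J. J \<subset> {1..n} \<and> card J \<ge> 2 \<longrightarrow> nabla n H J \<alpha> = {}}"

definition relative_maximal_elements :: "nat \<Rightarrow> (nat \<Rightarrow> int) set \<Rightarrow> (nat \<Rightarrow> int) set" where
  "relative_maximal_elements n H = {\<alpha> \<in> maximal_elements n H.
     \<forall>J. J \<subset> {1..n} \<and> card J \<ge> 2 \<longrightarrow> nabla n H J \<alpha> \<noteq> {}}"

end

theory Submission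
  imports Defs
begin

text \<open>
  Put \<open>N = q\<^sup>m\<close> and \<open>F = K(x, y)\<close>.  The semigroup of \<open>F\<close> is described by a count of degrees on the
  projective line, carried out separately for each power \<open>y\<^sup>i\<close> with \<open>i < N\<close>.

  Ramification.  At a pole \<open>P\<^sub>k\<close> of \<open>h\<close> the relation \<open>L(y) = h\<close> shows that \<open>y\<^sup>N\<close> has, up to a unit, the
  value of \<open>h\<close>, which is \<open>-\<lambda>\<^sub>k\<close> and prime to \<open>N\<close>.  Hence \<open>P\<^sub>k\<close> is totally ramified, and the terms of
  \<open>z = \<Sum>\<^sub>i z\<^sub>i y\<^sup>i\<close> have values \<open>N v\<^sub>k(z\<^sub>i) - i \<lambda>\<^sub>k\<close> at \<open>Q\<^sub>k\<close> that are pairwise incongruent modulo \<open>N\<close>; the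
  value of \<open>z\<close> is the least of them (\<open>totally_ramified_disc_val\<close>, \<open>val_above_pole\<close>).  It follows that
  \<open>1, y, \<dots>, y\<^sup>N\<^sup>-\<^sup>1\<close> is a basis of \<open>F\<close> over \<open>K(x)\<close>.

  Regularity.  The function \<open>z\<close> is regular outside \<open>Q\<^sub>1, \<dots>, Q\<^sub>n\<close> iff all its terms \<open>z\<^sub>i y\<^sup>i\<close> are
  (\<open>regular_iff\<close>).  Above a place that is no pole of \<open>h\<close> this means that the basis is integral there.
  As \<open>K\<close> contains the \<open>N\<close> roots \<open>\<omega>\<close> of \<open>L\<close>, the maps \<open>y \<mapsto> y + \<omega>\<close> are automorphisms of \<open>F\<close>, and the
  coefficients \<open>z\<^sub>i\<close> are recovered from the conjugates of \<open>z\<close> by interpolation at points whose differences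
  are constants (\<open>coeffs_integral\<close>).  That there is a place of \<open>F\<close> above a given place of \<open>K(x)\<close> follows
  from Zorn's lemma (\<open>exists_valring_avoiding\<close>).

  Degrees.  On the projective line the principal divisors are exactly the divisors of degree zero
  (\<open>principal_of_degree_zero\<close>, \<open>exists_fract_with_divisor\<close>).  So the regular functions \<open>z\<^sub>i y\<^sup>i\<close> have as their
  vectors of pole orders at \<open>Q\<^sub>1, \<dots>, Q\<^sub>n\<close> exactly the vectors \<open>N j + t(i)\<close> with \<open>j\<^sub>1 + \<dots> + j\<^sub>n \<ge> b(i)\<close>, where
  \<open>b(0) = 0\<close>, \<open>t(0) = 0\<close> and \<open>b(i) = \<beta>(i) + 1 - n\<close> otherwise.  If the inequality is strict, the surplus is taken up by
  zeros at a further rational place, which exists since there are \<open>q\<^sup>s + 1 > n\<close> of them.  Therefore the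
  semigroup consists of the componentwise maxima of such vectors (\<open>semigroup_iff\<close>).

  Maximality.  The classes \<open>i\<close> are disjoint in every coordinate, so one coordinate of a vector determines
  its class.  An absolute or relative maximal element turns out to lie in a single class, and
  \<open>\<nabla>\<^sub>J\<close> of such an element is nonempty iff the \<open>n - |J|\<close> coordinates outside \<open>J\<close> can be lowered by \<open>N\<close>,
  that is, iff \<open>j\<^sub>1 + \<dots> + j\<^sub>n \<ge> b(i) + n - |J|\<close>.  Absolute maximality asks that this fail for all proper
  nonempty \<open>J\<close>, so the sum is \<open>b(i)\<close>; relative maximality asks that it fail for \<open>|J| = 1\<close> and hold for
  \<open>|J| \<ge> 2\<close>, so the sum is \<open>b(i) + n - 2\<close> (\<open>absolute_maximal_iff\<close>, \<open>relative_maximal_iff\<close>).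
\<close>

section \<open>Valuation rings and discrete valuations\<close>

definition nonunits :: "'f::field set \<Rightarrow> 'f set" where
  "nonunits R = {z \<in> R. z = 0 \<or> inverse z \<notin> R}"

definition ring_unit :: "'f::field set \<Rightarrow> 'f \<Rightarrow> bool" where
  "ring_unit R u \<longleftrightarrow> u \<noteq> 0 \<and> u \<in> R \<and> inverse u \<in> R"

text \<open>The trivial valuation ring \<open>UNIV\<close> is included, so that a ring can be shown to be a valuation
  ring before it is known to be proper.\<close>

locale valring =
  fixes R :: "'f::field set"
  assumes add: "a \<in> R \<Longrightarrow> b \<in> R \<Longrightarrow> a + b \<in> R"
    and diff: "a \<in> R \<Longrightarrow> b \<in> R \<Longrightarrow> a - b \<in> R"
    and mult: "a \<in> R \<Longrightarrow> b \<in> R \<Longrightarrow> a * b \<in> R"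
    and one: "1 \<in> R"
    and total: "z \<in> R \<or> inverse z \<in> R"
begin

lemma zero: "0 \<in> R" using diff[OF one one] by simp
lemma uminus: "a \<in> R \<Longrightarrow> - a \<in> R" using diff[OF zero, of a] by simp
lemma power: "a \<in> R \<Longrightarrow> a ^ k \<in> R" by (induction k) (auto intro: one mult)
lemma sum: "(\<And>i. i \<in> S \<Longrightarrow> f i \<in> R) \<Longrightarrow> sum f S \<in> R"
  by (induction S rule: infinite_finite_induct) (auto intro: zero add)

lemma nonunits_mult:
  assumes "a \<in> nonunits R" "r \<in> R" shows "a * r \<in> nonunits R"
proof -
  have "a * r \<in> R" using assms mult by (auto simp: nonunits_def)
  moreover have False if "a * r \<noteq> 0" "inverse (a * r) \<in> R"
  proof -
    have "inverse a = r * inverse (a * r)" using that(1) by auto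
    then have "inverse a \<in> R" using mult[OF assms(2) that(2)] by metis
    with assms(1) that(1) show False by (auto simp: nonunits_def)
  qed
  ultimately show ?thesis by (auto simp: nonunits_def)
qed

text \<open>Of two nonzero nonunits one divides the other in the ring, so their sum is again a multiple
  of a nonunit.\<close>

lemma nonunits_add:
  assumes "a \<in> nonunits R" "b \<in> nonunits R" shows "a + b \<in> nonunits R"
proof (cases "a = 0 \<or> b = 0")
  case True then show ?thesis using assms by auto
next
  case False
  show ?thesis
  proof (cases "a / b \<in> R")
    case True
    have "a + b = b * (a / b + 1)" using False by (simp add: field_simps)
    then show ?thesis using nonunits_mult[OF assms(2) add[OF True one]] by simp
  next
    case c: False
    then have "b / a \<in> R" using total[of "a / b"] by simp
    moreover have "a + b = a * (1 + b / a)" using False by (simp add: field_simps)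
    ultimately show ?thesis using nonunits_mult[OF assms(1) add[OF one, of "b / a"]] by simp
  qed
qed

lemma zero_nonunit: "0 \<in> nonunits R" by (simp add: nonunits_def zero)
lemma nonunits_subset: "a \<in> nonunits R \<Longrightarrow> a \<in> R" by (simp add: nonunits_def)

lemma nonunits_sum: "(\<And>i. i \<in> S \<Longrightarrow> f i \<in> nonunits R) \<Longrightarrow> sum f S \<in> nonunits R"
  by (induction S rule: infinite_finite_induct) (auto intro: zero_nonunit nonunits_add)

lemma ring_unit_iff: "ring_unit R u \<longleftrightarrow> u \<in> R \<and> u \<notin> nonunits R"
  by (auto simp: ring_unit_def nonunits_def)

lemma unit_one: "ring_unit R 1" by (simp add: ring_unit_def one)
lemma unit_mult: "ring_unit R a \<Longrightarrow> ring_unit R b \<Longrightarrow> ring_unit R (a * b)"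
  by (auto simp: ring_unit_def intro: mult)
lemma unit_inverse: "ring_unit R a \<Longrightarrow> ring_unit R (inverse a)"
  by (auto simp: ring_unit_def)
lemma unit_divide: "ring_unit R a \<Longrightarrow> ring_unit R b \<Longrightarrow> ring_unit R (a / b)"
  using unit_mult[OF _ unit_inverse] by (simp add: divide_inverse)
lemma unit_power: "ring_unit R a \<Longrightarrow> ring_unit R (a ^ k)"
  by (induction k) (auto intro: unit_one unit_mult)
lemma unit_powi: "ring_unit R a \<Longrightarrow> ring_unit R (a powi k)"
  by (cases "k \<ge> 0") (auto simp: power_int_def power_inverse intro!: unit_power unit_inverse)

lemma unit_add_nonunit:
  assumes "ring_unit R u" "a \<in> nonunits R" shows "ring_unit R (u + a)"
proof -
  have "- a \<in> nonunits R" using nonunits_mult[OF assms(2) uminus[OF one]] by simp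
  then have "u + a \<notin> nonunits R" using nonunits_add[of "u + a" "- a"] assms(1)
    by (auto simp: ring_unit_iff)
  then show ?thesis using assms add by (auto simp: ring_unit_iff nonunits_subset)
qed

lemma nonunit_power: "a \<in> nonunits R \<Longrightarrow> k > 0 \<Longrightarrow> a ^ k \<in> nonunits R"
  by (cases k) (auto intro: nonunits_mult power nonunits_subset)

lemma inverse_nonunit: "z \<notin> R \<Longrightarrow> inverse z \<in> nonunits R"
  using total[of z] by (auto simp: nonunits_def)

text \<open>An instance of the fact that valuation rings are integrally closed: if \<open>u\<close> were outside the
  ring, then \<open>1/u\<close> and with it \<open>1/u\<^sup>k\<close> would be a nonunit, and so would be
  \<open>u\<^sup>k * (1/u\<^sup>k) = 1\<close>.\<close>

lemma root_mem:
  assumes "u ^ k \<in> R" "k > 0" shows "u \<in> R"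
proof (rule ccontr)
  assume "u \<notin> R"
  then have i: "inverse u ^ k \<in> nonunits R" and "u \<noteq> 0"
    using inverse_nonunit nonunit_power[OF _ assms(2)] zero by auto
  then show False using nonunits_mult[OF i assms(1)] unit_one
    by (simp add: ring_unit_iff flip: power_mult_distrib)
qed

lemma root_unit:
  assumes "ring_unit R (u ^ k)" "k > 0" shows "ring_unit R u"
  using assms root_mem[of u k] root_mem[of "inverse u" k]
  by (auto simp: ring_unit_def power_inverse)

lemma powi_mem:
  assumes "t \<in> R" "k \<ge> 0" shows "t powi k \<in> R"
  using assms by (simp add: power_int_def power)

lemma powi_nonunit:
  assumes "t \<in> nonunits R" "k > 0" shows "t powi k \<in> nonunits R"
  using assms by (simp add: power_int_def nonunit_power)

lemma exponent_unique:
  assumes t: "t \<in> nonunits R" "t \<noteq> 0" and k: "ring_unit R (z / t powi k)" and l: "ring_unit R (z / t powi l)"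
  shows "k = l"
proof -
  have *: "\<not> a < b" if "ring_unit R (z / t powi a)" "ring_unit R (z / t powi b)" for a b
  proof
    assume "a < b"
    have "(z / t powi a) / (z / t powi b) = t powi (b - a)"
      using t(2) that by (auto simp: power_int_diff ring_unit_def)
    then have "ring_unit R (t powi (b - a))" using unit_divide[OF that] by simp
    with powi_nonunit[OF t(1), of "b - a"] \<open>a < b\<close> show False by (auto simp: ring_unit_iff)
  qed
  from *[OF k l] *[OF l k] show ?thesis by simp
qed

text \<open>Divided by a strictly dominant term \<open>f i\<close>, the sum becomes 1 plus a nonunit.\<close>

lemma sum_dominant:
  assumes "finite S" "i \<in> S" "f i \<noteq> 0" "\<And>j. j \<in> S \<Longrightarrow> j \<noteq> i \<Longrightarrow> f j / f i \<in> nonunits R"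
  shows "ring_unit R (sum f S / f i)"
proof -
  have "sum f S / f i = 1 + (\<Sum>j\<in>S - {i}. f j / f i)"
    using assms by (simp add: sum.remove[OF assms(1,2)] add_divide_distrib sum_divide_distrib)
  moreover have "(\<Sum>j\<in>S - {i}. f j / f i) \<in> nonunits R" using assms by (intro nonunits_sum) auto
  ultimately show ?thesis using unit_add_nonunit[OF unit_one] by simp
qed

lemma poly_mem:
  assumes "\<And>i. coeff p i \<in> R" "w \<in> R" shows "poly p w \<in> R"
  unfolding poly_altdef using assms by (intro sum mult power) auto

text \<open>If \<open>w\<close> is outside the ring, then \<open>1/w\<close> is a nonunit, and \<open>p(w) / w\<^sup>d\<close> is the value of the
  reversed polynomial at \<open>1/w\<close>: the leading coefficient of \<open>p\<close> plus a nonunit.  This is how values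
  are computed at the infinite place of \<open>K(x)\<close> and at the poles of \<open>y\<close>.\<close>

lemma poly_over_lead_power_unit:
  assumes c: "\<And>i. coeff p i \<in> R" and l: "ring_unit R (lead_coeff p)" and w: "w \<notin> R"
  shows "ring_unit R (poly p w / w ^ degree p)"
proof -
  have w0: "w \<noteq> 0" using w zero by auto
  have eq: "poly p w / w ^ degree p = poly (reflect_poly p) (inverse w)"
    using w0 by (subst poly_reflect_poly_nz) (auto simp: field_simps)
  obtain a g where pag: "reflect_poly p = pCons a g" using pCons_cases by blast
  have "\<And>i. coeff (reflect_poly p) i \<in> R"
    using c zero by (simp add: coeff_reflect_poly)
  then have "coeff g i \<in> R" for i unfolding pag by (metis coeff_pCons_Suc)
  then have "poly g (inverse w) \<in> R" using total[of w] w by (intro poly_mem) auto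
  then have "inverse w * poly g (inverse w) \<in> nonunits R"
    using nonunits_mult[OF inverse_nonunit[OF w]] by simp
  moreover have "a = lead_coeff p" using pag by (metis coeff_0_reflect_poly coeff_pCons_0)
  ultimately have "ring_unit R (poly (reflect_poly p) (inverse w))"
    using l unit_add_nonunit by (simp add: pag)
  then show ?thesis by (simp add: eq)
qed

end

text \<open>Only the values at nonzero elements carry meaning, so \<open>v 0\<close> is left unspecified.\<close>

definition disc_val :: "'f::field set \<Rightarrow> ('f \<Rightarrow> int) \<Rightarrow> bool" where
  "disc_val R v \<longleftrightarrow> 0 \<in> R \<and> (\<forall>a b. a \<noteq> 0 \<longrightarrow> b \<noteq> 0 \<longrightarrow> v (a * b) = v a + v b) \<and>
     (\<forall>z. z \<noteq> 0 \<longrightarrow> (z \<in> R \<longleftrightarrow> v z \<ge> 0)) \<and> (\<exists>t. t \<noteq> 0 \<and> v t = 1)"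

context
  fixes R :: "'f::field set" and v
  assumes dv: "disc_val R v"
begin

lemma disc_val_mult: "a \<noteq> 0 \<Longrightarrow> b \<noteq> 0 \<Longrightarrow> v (a * b) = v a + v b"
  using dv by (simp add: disc_val_def)

lemma disc_val_mem: "z \<in> R \<longleftrightarrow> z = 0 \<or> v z \<ge> 0"
  using dv by (cases "z = 0") (auto simp: disc_val_def)

lemma disc_val_one: "v 1 = 0"
  using disc_val_mult[of 1 1] by simp

lemma disc_val_inverse: "a \<noteq> 0 \<Longrightarrow> v (inverse a) = - v a"
  using disc_val_mult[of a "inverse a"] disc_val_one by simp

lemma disc_val_divide: "a \<noteq> 0 \<Longrightarrow> b \<noteq> 0 \<Longrightarrow> v (a / b) = v a - v b"
  using disc_val_mult[of a "inverse b"] disc_val_inverse[of b] by (simp add: divide_inverse)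

lemma disc_val_power: "a \<noteq> 0 \<Longrightarrow> v (a ^ k) = int k * v a"
  by (induction k) (auto simp: disc_val_mult disc_val_one algebra_simps)

lemma disc_val_powi: "a \<noteq> 0 \<Longrightarrow> v (a powi k) = k * v a"
  by (auto simp: power_int_def disc_val_power disc_val_inverse)

lemma disc_val_unit: "ring_unit R u \<longleftrightarrow> u \<noteq> 0 \<and> v u = 0"
  by (auto simp: ring_unit_def disc_val_mem disc_val_inverse)

lemma disc_val_nonunit: "u \<in> nonunits R \<longleftrightarrow> u = 0 \<or> v u > 0"
  by (auto simp: nonunits_def disc_val_mem disc_val_inverse)

lemma disc_val_prod:
  "finite S \<Longrightarrow> (\<And>i. i \<in> S \<Longrightarrow> f i \<noteq> 0) \<Longrightarrow> v (prod f S) = (\<Sum>i\<in>S. v (f i))"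
  by (induction S rule: finite_induct) (auto simp: disc_val_one disc_val_mult)

end

text \<open>The exponent \<open>k\<close> is unique because the powers of the nonunit \<open>t\<close> with positive exponents are
  nonunits; it is the value of \<open>z\<close>.\<close>

lemma disc_val_of_uniformizer:
  assumes "valring R" and t: "t \<in> nonunits R" "t \<noteq> 0"
    and ex: "\<And>z. z \<noteq> 0 \<Longrightarrow> \<exists>k. ring_unit R (z / t powi k)"
  obtains v where "disc_val R v" "\<And>z k. z \<noteq> 0 \<Longrightarrow> ring_unit R (z / t powi k) \<Longrightarrow> v z = k"
proof -
  interpret valring R by fact
  define v where "v z = (SOME k. ring_unit R (z / t powi k))" for z
  have v: "ring_unit R (z / t powi v z)" if "z \<noteq> 0" for z
    unfolding v_def by (rule someI_ex[OF ex[OF that]])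
  have vI: "v z = k" if "z \<noteq> 0" "ring_unit R (z / t powi k)" for z k
    using exponent_unique[OF t v[OF that(1)] that(2)] .
  have "v (a * b) = v a + v b" if "a \<noteq> 0" "b \<noteq> 0" for a b
    using unit_mult[OF v[OF that(1)] v[OF that(2)]] that t(2) by (intro vI) (simp_all add: power_int_add)
  moreover have "v t = 1" using t unit_one by (intro vI) auto
  moreover have "z \<in> R \<longleftrightarrow> v z \<ge> 0" if "z \<noteq> 0" for z
  proof
    assume "v z \<ge> 0"
    then show "z \<in> R" using mult[OF _ powi_mem[of t "v z"], of "z / t powi v z"] v[OF that] t
      by (auto simp: ring_unit_def nonunits_subset)
  next
    assume z: "z \<in> R"
    show "v z \<ge> 0"
    proof (rule ccontr)
      assume "\<not> ?thesis"
      then have "t powi (- v z) * z \<in> nonunits R" using z nonunits_mult powi_nonunit[OF t(1)] by simp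
      then show False using v[OF that] by (auto simp: ring_unit_iff power_int_minus divide_inverse mult_ac)
    qed
  qed
  ultimately have "disc_val R v" using t(2) zero by (auto simp: disc_val_def)
  then show ?thesis using vI that by blast
qed

subsection \<open>Places and their rings\<close>

lemma valuation_ring_valring: "valuation_ring \<kappa> R \<Longrightarrow> \<kappa> 1 = 1 \<Longrightarrow> valring R"
  unfolding valuation_ring_def valring_def by (metis psubsetD rangeI)

lemma place_ring_nonunits:
  assumes "valring R" shows "place_ring (nonunits R) = R"
  using assms unfolding place_ring_def nonunits_def
  by (auto simp: valring_def intro: valring.zero[OF assms])

lemma place_eq: "place \<kappa> P \<longleftrightarrow> (\<exists>R. valuation_ring \<kappa> R \<and> P = nonunits R)"
  by (simp add: place_def nonunits_def)

context
  fixes \<kappa> :: "'k::field \<Rightarrow> 'f::field"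
  assumes \<kappa>1: "\<kappa> 1 = 1"
begin

lemma place_nonunits: "valuation_ring \<kappa> R \<Longrightarrow> place \<kappa> (nonunits R)"
  by (auto simp: place_eq)

lemma place_ringD:
  assumes "place \<kappa> P"
  shows "valuation_ring \<kappa> (place_ring P)" "valring (place_ring P)" "nonunits (place_ring P) = P"
proof -
  obtain R where R: "valuation_ring \<kappa> R" "P = nonunits R" using assms by (auto simp: place_eq)
  then have "place_ring P = R" using place_ring_nonunits valuation_ring_valring \<kappa>1 by blast
  then show "valuation_ring \<kappa> (place_ring P)" "valring (place_ring P)" "nonunits (place_ring P) = P"
    using R valuation_ring_valring \<kappa>1 by auto
qed

lemma place_const_unit:
  assumes "place \<kappa> P" "\<And>a. \<kappa> (inverse a) = inverse (\<kappa> a)" "\<kappa> c \<noteq> 0"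
  shows "ring_unit (place_ring P) (\<kappa> c)"
proof -
  have "range \<kappa> \<subseteq> place_ring P" using place_ringD(1)[OF assms(1)] by (auto simp: valuation_ring_def)
  then have "\<kappa> c \<in> place_ring P" "\<kappa> (inverse c) \<in> place_ring P" by auto
  then show ?thesis using assms by (auto simp: ring_unit_def)
qed

text \<open>A valuation as in \<^const>\<open>disc_val\<close> has the generators of the maximal ideal as its elements of
  value 1, so that the exponent in \<open>z = t\<^sup>k w\<close> is the value of \<open>z\<close> whichever generator \<open>t\<close> is taken.
  All values are computed through this lemma.\<close>

lemma place_val_disc_val:
  assumes P: "place \<kappa> P" and dv: "disc_val (place_ring P) v" and z: "z \<noteq> 0"
  shows "place_val P z = v z"
proof -
  let ?R = "place_ring P"
  interpret valring ?R using place_ringD(2)[OF P] .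
  have P': "x \<in> P \<longleftrightarrow> x = 0 \<or> v x > 0" for x
    using disc_val_nonunit[OF dv] place_ringD(3)[OF P] by auto
  have gen: "P = (\<lambda>g. t * g) ` ?R \<longleftrightarrow> t \<noteq> 0 \<and> v t = 1" for t
  proof
    assume t: "P = (\<lambda>g. t * g) ` ?R"
    obtain s where s: "s \<noteq> 0" "v s = 1" using dv by (auto simp: disc_val_def)
    then have "s \<in> P" using P' by simp
    then obtain g where g: "s = t * g" "g \<in> ?R" using t by auto
    have "t \<in> P" using t one by force
    moreover have "t \<noteq> 0" "g \<noteq> 0" using g s by auto
    ultimately show "t \<noteq> 0 \<and> v t = 1" using g s disc_val_mult[OF dv, of t g] P'[of t]
      by (auto simp: disc_val_mem[OF dv])
  next
    assume t: "t \<noteq> 0 \<and> v t = 1"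
    have "x \<in> (\<lambda>g. t * g) ` ?R" if "x \<in> P" for x
    proof -
      have "x / t \<in> ?R" using that t P'[of x] by (cases "x = 0") (auto simp: disc_val_mem[OF dv] disc_val_divide[OF dv])
      then show ?thesis using t by (intro image_eqI[of _ _ "x / t"]) auto
    qed
    moreover have "t * g \<in> P" if "g \<in> ?R" for g
      using that t unfolding P' disc_val_mem[OF dv] by (cases "g = 0") (auto simp: disc_val_mult[OF dv])
    ultimately show "P = (\<lambda>g. t * g) ` ?R" by auto
  qed
  show ?thesis unfolding place_val_def
  proof (rule the_equality)
    obtain t where t: "t \<noteq> 0" "v t = 1" using dv by (auto simp: disc_val_def)
    have "ring_unit ?R (z / t powi v z)"
      using t z by (simp add: disc_val_unit[OF dv] disc_val_divide[OF dv] disc_val_powi[OF dv])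
    then show "\<exists>t w. P = (\<lambda>g. t * g) ` ?R \<and> w \<noteq> 0 \<and> w \<in> ?R \<and> inverse w \<in> ?R \<and> z = t powi v z * w"
      using t unfolding gen ring_unit_def
      by (intro exI[of _ t] exI[of _ "z / t powi v z"]) auto
  next
    fix k assume "\<exists>t w. P = (\<lambda>g. t * g) ` ?R \<and> w \<noteq> 0 \<and> w \<in> ?R \<and> inverse w \<in> ?R \<and> z = t powi k * w"
    then obtain t w where tw: "t \<noteq> 0" "v t = 1" "ring_unit ?R w" "z = t powi k * w"
      unfolding gen ring_unit_def by auto
    then show "k = v z"
      by (simp add: disc_val_unit[OF dv] disc_val_mult[OF dv] disc_val_powi[OF dv])
  qed
qed

end

section \<open>The places of a rational function field\<close>

subsection \<open>Polynomials over a field\<close>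

text \<open>A nonzero combination of \<open>g\<close> and \<open>M\<close> of least degree divides both, because the remainders of
  division by it are again combinations.\<close>

lemma poly_bezout:
  fixes g M :: "'e::field poly"
  assumes "g \<noteq> 0 \<or> M \<noteq> 0"
  obtains D u v where "D \<noteq> 0" "D = u * g + v * M" "D dvd g" "D dvd M"
proof -
  define S where "S = {D. D \<noteq> 0 \<and> (\<exists>u v. D = u * g + v * M)}"
  have "g \<in> S \<or> M \<in> S"
    using assms unfolding S_def by (metis (mono_tags, lifting) add.left_neutral add.right_neutral mem_Collect_eq mult_1 mult_zero_left)
  then obtain D where D: "D \<in> S" "\<And>E. E \<in> S \<Longrightarrow> degree D \<le> degree E"
    using ex_has_least_nat[of "\<lambda>D. D \<in> S" _ degree] by blast
  then obtain u v where uv: "D = u * g + v * M" and D0: "D \<noteq> 0" by (auto simp: S_def)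
  have "D dvd f" if "f = a * g + b * M" for f a b
  proof -
    have "f mod D = f - (f div D) * D" by (simp add: minus_div_mult_eq_mod)
    also have "\<dots> = (a - (f div D) * u) * g + (b - (f div D) * v) * M"
      by (simp add: that uv algebra_simps)
    finally have "f mod D \<noteq> 0 \<Longrightarrow> f mod D \<in> S" unfolding S_def by blast
    then have "f mod D = 0"
      using D(2) degree_mod_less[OF D0, of f] by (metis not_le)
    then show ?thesis by auto
  qed
  from this[of g 1 0] this[of M 0 1] show ?thesis using that[OF D0 uv] by simp
qed

lemma irreducible_poly_bezout:
  fixes \<pi> g :: "'e::field poly"
  assumes "irreducible \<pi>" "\<not> \<pi> dvd g"
  obtains u v where "u * g + v * \<pi> = 1"
proof -
  have "\<pi> \<noteq> 0" using assms by auto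
  then obtain D u v where D: "D = u * g + v * \<pi>" "D dvd g" "D dvd \<pi>"
    using poly_bezout[of g \<pi>] by metis
  then have "is_unit D" using assms by (metis dvd_trans irreducibleD')
  then obtain E where "1 = D * E" by (rule dvdE)
  then have "(E * u) * g + (E * v) * \<pi> = 1" by (simp add: D algebra_simps)
  then show ?thesis by (rule that)
qed

lemma irreducible_poly_dvd_mult:
  fixes \<pi> :: "'e::field poly"
  assumes "irreducible \<pi>" shows "\<pi> dvd a * b \<longleftrightarrow> \<pi> dvd a \<or> \<pi> dvd b"
  using field_poly_irreducible_imp_prime[OF assms] by (rule prime_elem_dvd_mult_iff)

lemma irreducible_poly_degree: "irreducible (\<pi> :: 'e::field poly) \<Longrightarrow> degree \<pi> > 0"
  by (metis gr0I irreducible_def is_unit_iff_degree)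

lemma irreducible_poly_dvd_irreducible:
  fixes \<pi> \<rho> :: "'e::field poly"
  assumes "irreducible \<pi>" "irreducible \<rho>" "\<rho> dvd \<pi>" shows "\<pi> dvd \<rho>"
  using irreducibleD'[OF assms(1,3)] assms(2) by (auto simp: irreducible_def)

lemma poly_eq_power_mult:
  fixes \<pi> f :: "'e::field poly"
  assumes "degree \<pi> > 0" "f \<noteq> 0"
  shows "\<exists>k g. f = \<pi> ^ k * g \<and> \<not> \<pi> dvd g"
  using assms(2)
proof (induction "degree f" arbitrary: f rule: less_induct)
  case less
  show ?case
  proof (cases "\<pi> dvd f")
    case True
    then obtain g where g: "f = \<pi> * g" by (rule dvdE)
    then have "degree g < degree f" "g \<noteq> 0" using less.prems assms(1) by (auto simp: degree_mult_eq)
    with less.hyps obtain k g' where "g = \<pi> ^ k * g'" "\<not> \<pi> dvd g'" by blast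
    then show ?thesis using g by (intro exI[of _ "Suc k"] exI[of _ g']) simp
  next
    case False then show ?thesis by (intro exI[of _ 0] exI[of _ f]) simp
  qed
qed

lemma poly_factor_induct [consumes 1, case_names const irreducible mult]:
  fixes f :: "'e::field poly"
  assumes "f \<noteq> 0" "\<And>c. c \<noteq> 0 \<Longrightarrow> P [:c:]" "\<And>\<pi>. irreducible \<pi> \<Longrightarrow> P \<pi>"
    "\<And>a b. a \<noteq> 0 \<Longrightarrow> b \<noteq> 0 \<Longrightarrow> P a \<Longrightarrow> P b \<Longrightarrow> P (a * b)"
  shows "P f"
  using assms(1)
proof (induction "degree f" arbitrary: f rule: less_induct)
  case less
  consider "degree f = 0" | "irreducible f" | "degree f > 0" "\<not> irreducible f" by auto
  then show ?case
  proof cases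
    case 1 then show ?thesis using assms(2) less.prems by (metis degree_eq_zeroE pCons_0_0)
  next
    case 2 then show ?thesis using assms(3) by simp
  next
    case 3
    then have "\<not> is_unit f" using less.prems by (simp add: is_unit_iff_degree)
    with 3 less.prems obtain a b where ab: "f = a * b" "\<not> is_unit a" "\<not> is_unit b"
      by (auto simp: irreducible_def)
    then have "a \<noteq> 0" "b \<noteq> 0" using less.prems by auto
    moreover from this ab have "degree a > 0" "degree b > 0" by (auto simp: is_unit_iff_degree)
    ultimately show ?thesis using ab(1) less.hyps assms(4) by (auto simp: degree_mult_eq)
  qed
qed

subsection \<open>The valuation rings\<close>

lemma const_fract_hom:
  "const_fract 0 = 0" "const_fract 1 = 1" "const_fract (a + b) = const_fract a + const_fract b"
  "const_fract (a - b) = const_fract a - const_fract b"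
  "const_fract (a * b) = const_fract a * const_fract b" "const_fract (- a) = - const_fract a"
  "const_fract a = 0 \<longleftrightarrow> a = 0"
proof -
  show "const_fract 1 = 1" by (simp add: const_fract_def flip: one_pCons)
qed (simp_all add: const_fract_def flip: to_fract_add to_fract_diff to_fract_mult to_fract_uminus)

lemma const_fract_inverse: "const_fract (inverse a) = inverse (const_fract (a :: 'a::field))"
proof (cases "a = 0")
  case False
  then have "const_fract a * const_fract (inverse a) = 1" by (simp flip: const_fract_hom)
  then show ?thesis by (simp add: inverse_unique)
qed (simp add: const_fract_hom)

lemma fract_cases:
  obtains f g where "z = to_fract f / to_fract g" "g \<noteq> 0"
  by (metis Fract_cases Fract_conv_to_fract)

abbreviation X_fract :: "'a::field poly fract" where "X_fract \<equiv> to_fract [:0, 1:]"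

lemma to_fract_eq_poly: "to_fract f = poly (map_poly const_fract f) X_fract"
proof (induction f)
  case (pCons a f)
  have "to_fract (pCons a f) = const_fract a + X_fract * to_fract f"
    by (simp add: const_fract_def flip: to_fract_add to_fract_mult)
  then show ?case using pCons by (simp add: map_poly_pCons const_fract_hom)
qed simp

text \<open>The valuation rings of \<open>K(x)\<close> are the localizations of \<open>K[x]\<close> at its irreducible polynomials
  and the ring of fractions of degree at most 0.\<close>

definition finite_ring :: "'a::field poly \<Rightarrow> 'a poly fract set" where
  "finite_ring \<pi> = {to_fract f / to_fract g | f g. \<not> \<pi> dvd g}"

definition infinite_ring :: "'a::field poly fract set" where
  "infinite_ring = {to_fract f / to_fract g | f g. g \<noteq> 0 \<and> degree f \<le> degree g}"

text \<open>An element \<open>z\<close> of \<open>S\<close> outside \<open>R\<close> would have an inverse in the maximal ideal of \<open>R\<close>, hence in that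
  of \<open>S\<close>.\<close>

lemma valuation_ring_eqI:
  assumes R: "valring R" and S: "valring S"
    and sub: "R \<subseteq> S" "nonunits R \<subseteq> nonunits S" shows "S = R"
proof -
  interpret R: valring R by fact
  interpret S: valring S by fact
  have "z \<in> R" if "z \<in> S" for z
  proof (rule ccontr)
    assume z: "z \<notin> R"
    then have "inverse z \<in> nonunits S" "z \<noteq> 0" using R.inverse_nonunit sub(2) R.zero by auto
    then show False using S.nonunits_mult[OF _ that, of "inverse z"] S.unit_one by (simp add: S.ring_unit_iff)
  qed
  then show ?thesis using sub by auto
qed

context
  fixes \<pi> :: "'a::field poly"
  assumes \<pi>: "irreducible \<pi>"
begin

lemma finite_ring_valuation_ring: "valuation_ring const_fract (finite_ring \<pi>)"
proof -
  let ?R = "finite_ring \<pi>"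
  have \<pi>d: "\<pi> dvd a * b \<longleftrightarrow> \<pi> dvd a \<or> \<pi> dvd b" for a b
    by (rule irreducible_poly_dvd_mult[OF \<pi>])
  have \<pi>0: "\<pi> \<noteq> 0" and \<pi>1: "\<not> \<pi> dvd 1" using \<pi> by (auto simp: irreducible_def)
  have memI: "to_fract f / to_fract g \<in> ?R" if "\<not> \<pi> dvd g" for f g
    using that by (auto simp: finite_ring_def)
  have op: "a + b \<in> ?R \<and> a - b \<in> ?R \<and> a * b \<in> ?R" if "a \<in> ?R" "b \<in> ?R" for a b
  proof -
    obtain f g where a: "a = to_fract f / to_fract g" "\<not> \<pi> dvd g"
      using \<open>a \<in> ?R\<close> by (auto simp: finite_ring_def)
    obtain f' g' where b: "b = to_fract f' / to_fract g'" "\<not> \<pi> dvd g'"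
      using \<open>b \<in> ?R\<close> by (auto simp: finite_ring_def)
    have "g \<noteq> 0" "g' \<noteq> 0" using a b by auto
    then have "a + b = to_fract (f * g' + f' * g) / to_fract (g * g')"
        "a - b = to_fract (f * g' - f' * g) / to_fract (g * g')"
        "a * b = to_fract (f * f') / to_fract (g * g')"
      by (auto simp: a b field_simps)
    then show ?thesis using memI[of "g * g'"] \<pi>d a b by metis
  qed
  have c: "const_fract c \<in> ?R" for c
    using memI[of 1 "[:c:]"] \<pi>1 by (simp add: const_fract_def)
  have tot: "z \<in> ?R \<or> inverse z \<in> ?R" for z
  proof (cases "z = 0")
    case True then show ?thesis using c[of 0] by (simp add: const_fract_hom)
  next
    case False
    obtain f g where z: "z = to_fract f / to_fract g" "g \<noteq> 0" by (rule fract_cases)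
    with False have "f \<noteq> 0" by auto
    obtain k f' where f: "f = \<pi> ^ k * f'" "\<not> \<pi> dvd f'"
      using poly_eq_power_mult irreducible_poly_degree[OF \<pi>] \<open>f \<noteq> 0\<close> by blast
    obtain l g' where g: "g = \<pi> ^ l * g'" "\<not> \<pi> dvd g'"
      using poly_eq_power_mult irreducible_poly_degree[OF \<pi>] \<open>g \<noteq> 0\<close> by blast
    have nz: "to_fract \<pi> \<noteq> 0" using \<pi>0 by simp
    show ?thesis
    proof (cases "l \<le> k")
      case True
      then have "\<pi> ^ k = \<pi> ^ l * \<pi> ^ (k - l)" by (simp flip: power_add)
      then have "z = to_fract (\<pi> ^ (k - l) * f') / to_fract g'" using \<pi>0 by (simp add: z f g)
      then show ?thesis using memI g by metis
    next
      case False
      then have "\<pi> ^ l = \<pi> ^ k * \<pi> ^ (l - k)" by (simp flip: power_add)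
      then have "inverse z = to_fract (\<pi> ^ (l - k) * g') / to_fract f'" using \<pi>0 by (simp add: z f g)
      then show ?thesis using memI f by metis
    qed
  qed
  have nt: "inverse (to_fract \<pi>) \<notin> ?R"
  proof
    assume "inverse (to_fract \<pi>) \<in> ?R"
    then obtain f g where fg: "inverse (to_fract \<pi>) = to_fract f / to_fract g" "\<not> \<pi> dvd g"
      by (auto simp: finite_ring_def)
    have "g \<noteq> 0" using fg(2) by auto
    then have "to_fract g = to_fract (\<pi> * f)" using fg(1) \<pi>0 by (auto simp: field_simps)
    then show False using fg(2) by (simp del: to_fract_mult)
  qed
  have "range const_fract \<noteq> ?R"
  proof
    assume *: "range const_fract = ?R"
    have "to_fract \<pi> \<in> ?R" using memI[OF \<pi>1, of \<pi>] by simp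
    then obtain c where "to_fract \<pi> = const_fract c" using * by auto
    then have "\<pi> = [:c:]" by (simp add: const_fract_def)
    then show False using irreducible_poly_degree[OF \<pi>] by simp
  qed
  then show ?thesis unfolding valuation_ring_def using op c nt tot by auto
qed

lemma finite_ring_valring: "valring (finite_ring \<pi>)"
  using valuation_ring_valring[OF finite_ring_valuation_ring] by (simp add: const_fract_hom)

lemma finite_ring_to_fract: "to_fract f \<in> finite_ring \<pi>"
proof -
  have "\<not> \<pi> dvd 1" using \<pi> by (auto simp: irreducible_def)
  then show ?thesis unfolding finite_ring_def by (intro CollectI exI[of _ f] exI[of _ 1]) auto
qed

lemma finite_ring_nonunit: "to_fract f \<in> nonunits (finite_ring \<pi>) \<longleftrightarrow> \<pi> dvd f"
proof
  assume f: "to_fract f \<in> nonunits (finite_ring \<pi>)"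
  show "\<pi> dvd f"
  proof (rule ccontr)
    assume n: "\<not> \<pi> dvd f"
    then have "to_fract 1 / to_fract f \<in> finite_ring \<pi>" unfolding finite_ring_def by blast
    then show False using f n by (auto simp: nonunits_def divide_inverse)
  qed
next
  assume "\<pi> dvd f"
  then obtain g where g: "f = \<pi> * g" by (rule dvdE)
  have False if inv: "inverse (to_fract f) \<in> finite_ring \<pi>" "f \<noteq> 0"
  proof -
    obtain a b where ab: "inverse (to_fract f) = to_fract a / to_fract b" "\<not> \<pi> dvd b"
      using inv(1) by (auto simp: finite_ring_def)
    have "b \<noteq> 0" using ab(2) by auto
    then have "to_fract b = to_fract (\<pi> * (g * a))" using ab(1) inv(2) by (auto simp: g field_simps)
    then show False using ab(2) by (simp del: to_fract_mult)
  qed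
  then show "to_fract f \<in> nonunits (finite_ring \<pi>)"
    using finite_ring_to_fract by (auto simp: nonunits_def)
qed

lemma finite_ring_unit: "ring_unit (finite_ring \<pi>) (to_fract f) \<longleftrightarrow> \<not> \<pi> dvd f"
  using finite_ring_valring finite_ring_nonunit finite_ring_to_fract
  by (auto simp: valring.ring_unit_iff)

lemma finite_ring_uniformizer:
  assumes "z \<noteq> 0" shows "\<exists>k. ring_unit (finite_ring \<pi>) (z / to_fract \<pi> powi k)"
proof -
  obtain f g where z: "z = to_fract f / to_fract g" "g \<noteq> 0" by (rule fract_cases)
  with assms have "f \<noteq> 0" by auto
  have \<pi>0: "\<pi> \<noteq> 0" using \<pi> by auto
  obtain k f' where f: "f = \<pi> ^ k * f'" "\<not> \<pi> dvd f'"
    using poly_eq_power_mult irreducible_poly_degree[OF \<pi>] \<open>f \<noteq> 0\<close> by blast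
  obtain l g' where g: "g = \<pi> ^ l * g'" "\<not> \<pi> dvd g'"
    using poly_eq_power_mult irreducible_poly_degree[OF \<pi>] \<open>g \<noteq> 0\<close> by blast
  have pw: "to_fract (p ^ n) = to_fract p ^ n" for p :: "'a poly" and n
    by (induction n) auto
  have "z / to_fract \<pi> powi (int k - int l) = to_fract f' / to_fract g'"
    using \<pi>0 g f \<open>g \<noteq> 0\<close> by (simp add: z f g pw power_int_diff field_simps)
  moreover have "ring_unit (finite_ring \<pi>) (to_fract f' / to_fract g')"
    using f g by (intro valring.unit_divide finite_ring_valring) (auto simp: finite_ring_unit)
  ultimately show ?thesis by metis
qed

end

lemma infinite_ring_mem:
  assumes "g \<noteq> 0"
  shows "to_fract f / to_fract g \<in> infinite_ring \<longleftrightarrow> f = 0 \<or> degree f \<le> degree g"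
proof
  assume "to_fract f / to_fract g \<in> infinite_ring"
  then obtain a b where ab: "to_fract f / to_fract g = to_fract a / to_fract b" "b \<noteq> 0" "degree a \<le> degree b"
    by (auto simp: infinite_ring_def)
  then have "to_fract (f * b) = to_fract (a * g)" using assms by (simp add: field_simps)
  then have eq: "f * b = a * g" by (simp only: to_fract_eq_iff)
  show "f = 0 \<or> degree f \<le> degree g"
  proof (cases "f = 0")
    case False
    then have "a \<noteq> 0" using eq ab by auto
    then have "degree f + degree b = degree a + degree g"
      using arg_cong[OF eq, of degree] False ab assms by (simp add: degree_mult_eq)
    then show ?thesis using ab by simp
  qed simp
next
  assume "f = 0 \<or> degree f \<le> degree g"
  then show "to_fract f / to_fract g \<in> infinite_ring"
    using assms unfolding infinite_ring_def by (intro CollectI exI[of _ f] exI[of _ g]) auto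
qed

lemma infinite_ring_valuation_ring: "valuation_ring const_fract infinite_ring"
proof -
  let ?R = "infinite_ring :: 'a::field poly fract set"
  have op: "a + b \<in> ?R \<and> a - b \<in> ?R \<and> a * b \<in> ?R" if "a \<in> ?R" "b \<in> ?R" for a b
  proof -
    obtain f g where a: "a = to_fract f / to_fract g" "g \<noteq> 0" "degree f \<le> degree g"
      using \<open>a \<in> ?R\<close> by (auto simp: infinite_ring_def)
    obtain f' g' where b: "b = to_fract f' / to_fract g'" "g' \<noteq> 0" "degree f' \<le> degree g'"
      using \<open>b \<in> ?R\<close> by (auto simp: infinite_ring_def)
    have *: "degree (f * g') \<le> degree (g * g')" "degree (f' * g) \<le> degree (g * g')"
       "degree (f * f') \<le> degree (g * g')"
      using degree_mult_le[of f g'] degree_mult_le[of f' g] degree_mult_le[of f f'] a b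
      by (auto simp: degree_mult_eq)
    have "a + b = to_fract (f * g' + f' * g) / to_fract (g * g')"
        "a - b = to_fract (f * g' - f' * g) / to_fract (g * g')"
        "a * b = to_fract (f * f') / to_fract (g * g')"
      using a(2) b(2) by (auto simp: a(1) b(1) field_simps)
    then show ?thesis using * a(2) b(2) unfolding infinite_ring_def
      by (metis (mono_tags, lifting) degree_add_le degree_diff_le mem_Collect_eq mult_eq_0_iff)
  qed
  have c: "const_fract c \<in> ?R" for c
    using infinite_ring_mem[of 1 "[:c:]"] by (simp add: const_fract_def)
  have tot: "z \<in> ?R \<or> inverse z \<in> ?R" for z
  proof -
    obtain f g where z: "z = to_fract f / to_fract g" "g \<noteq> 0" by (rule fract_cases)
    then have "inverse z = to_fract g / to_fract f" by simp
    then show ?thesis using z infinite_ring_mem[of g f] infinite_ring_mem[of f g]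
      by (cases "f = 0") auto
  qed
  have nt: "X_fract \<notin> ?R" using infinite_ring_mem[of 1 "[:0,1:]"] by simp
  have "range const_fract \<noteq> ?R"
  proof
    assume *: "range const_fract = ?R"
    have "to_fract 1 / X_fract \<in> ?R" by (subst infinite_ring_mem) auto
    then have "to_fract 1 / X_fract \<in> range (const_fract :: 'a \<Rightarrow> _)" unfolding * .
    then obtain c :: 'a where "to_fract 1 / X_fract = const_fract c" by (rule imageE)
    then have "to_fract 1 = to_fract ([:c:] * [:0,1:])"
      unfolding to_fract_mult const_fract_def by (simp add: field_simps)
    then have "1 = [:c:] * [:0, 1:]" by (simp only: to_fract_eq_iff)
    from arg_cong[OF this, of "\<lambda>p. poly p 0"] show False by simp
  qed
  then show ?thesis unfolding valuation_ring_def using op c nt tot by auto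
qed

lemma infinite_ring_valring: "valring infinite_ring"
  using valuation_ring_valring[OF infinite_ring_valuation_ring] by (simp add: const_fract_hom)

lemma infinite_ring_nonunit:
  assumes "g \<noteq> 0"
  shows "to_fract f / to_fract g \<in> nonunits infinite_ring \<longleftrightarrow> f = 0 \<or> degree f < degree g"
  using infinite_ring_mem[OF assms, of f] infinite_ring_mem[of f g] assms
  by (cases "f = 0") (auto simp: nonunits_def)

lemma infinite_ring_unit:
  assumes "g \<noteq> 0" "f \<noteq> 0"
  shows "ring_unit infinite_ring (to_fract f / to_fract g) \<longleftrightarrow> degree f = degree g"
  using infinite_ring_mem[OF assms(1), of f] infinite_ring_mem[OF assms(2), of g] assms
  by (auto simp: ring_unit_def)

lemma infinite_ring_uniformizer:
  assumes "f \<noteq> 0" "g \<noteq> 0"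
  shows "ring_unit infinite_ring ((to_fract f / to_fract g) / inverse X_fract powi (int (degree g) - int (degree f)))"
proof -
  let ?X = "[:0, 1:] :: 'a poly"
  have pw: "to_fract (p ^ n) = to_fract p ^ n" for p :: "'a poly" and n
    by (induction n) auto
  have "(to_fract f / to_fract g) / inverse X_fract powi (int (degree g) - int (degree f))
      = to_fract (f * ?X ^ degree g) / to_fract (g * ?X ^ degree f)"
    using assms by (simp add: power_int_diff power_int_inverse pw field_simps)
  moreover have "ring_unit infinite_ring \<dots>"
    using assms by (subst infinite_ring_unit) (auto simp: degree_mult_eq degree_power_eq)
  ultimately show ?thesis by simp
qed

text \<open>If \<open>x\<close> is integral at the place, then so are all polynomials, and the nonunits among them form
  a prime ideal, generated by a nonzero member \<open>\<pi>\<close> of least degree.  Otherwise \<open>1/x\<close> is a nonunit and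
  every polynomial \<open>f\<close> equals \<open>x\<close> to the power \<open>degree f\<close> up to a unit.\<close>

lemma valuation_ring_fract_cases:
  fixes R :: "'a::field poly fract set"
  assumes "valuation_ring const_fract R"
  obtains "R = infinite_ring" | \<pi> where "irreducible \<pi>" "R = finite_ring \<pi>"
proof -
  interpret valring R using valuation_ring_valring[OF assms] by (simp add: const_fract_hom)
  have c: "const_fract a \<in> R" for a
    using assms unfolding valuation_ring_def by (meson psubsetD rangeI)
  have cu: "ring_unit R (const_fract a)" if "a \<noteq> 0" for a
    using that c[of a] c[of "inverse a"] by (auto simp: ring_unit_def const_fract_hom const_fract_inverse)
  have co: "coeff (map_poly const_fract f) i \<in> R" for f i
    using c by (simp add: coeff_map_poly const_fract_hom)
  show ?thesis
  proof (cases "X_fract \<in> R")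
    case True
    have pol: "to_fract f \<in> R" for f
      unfolding to_fract_eq_poly[of f] using True co by (intro poly_mem)
    have "\<exists>f. f \<noteq> 0 \<and> to_fract f \<in> nonunits R"
    proof (rule ccontr)
      assume "\<not> ?thesis"
      then have "inverse (to_fract g) \<in> R" if "g \<noteq> 0" for g
        using that pol by (auto simp: nonunits_def)
      then have "to_fract f / to_fract g \<in> R" if "g \<noteq> 0" for f g :: "'a poly"
        unfolding divide_inverse using that by (intro mult pol)
      then have "z \<in> R" for z :: "'a poly fract" by (rule_tac fract_cases[of z]) simp
      then show False using assms by (auto simp: valuation_ring_def)
    qed
    then obtain f0 where "f0 \<noteq> 0 \<and> to_fract f0 \<in> nonunits R" ..
    from ex_has_least_nat[of "\<lambda>f. f \<noteq> 0 \<and> to_fract f \<in> nonunits R", OF this, of degree]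
    obtain \<pi> where \<pi>: "\<pi> \<noteq> 0" "to_fract \<pi> \<in> nonunits R"
      and least: "\<And>f. f \<noteq> 0 \<Longrightarrow> to_fract f \<in> nonunits R \<Longrightarrow> degree \<pi> \<le> degree f"
      by blast
    have dv: "\<pi> dvd f" if "to_fract f \<in> nonunits R" for f
    proof -
      have "f mod \<pi> = f + \<pi> * (- (f div \<pi>))" by (simp add: minus_mult_div_eq_mod[symmetric])
      then have "to_fract (f mod \<pi>) = to_fract f + to_fract \<pi> * to_fract (- (f div \<pi>))"
        by (simp only: to_fract_add to_fract_mult)
      then have "to_fract (f mod \<pi>) \<in> nonunits R"
        using nonunits_add[OF that nonunits_mult[OF \<pi>(2) pol]] by metis
      then have "f mod \<pi> = 0"
        using least degree_mod_less[OF \<pi>(1), of f] by (metis not_le)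
      then show ?thesis by auto
    qed
    have nu: "to_fract f \<in> nonunits R" if "\<pi> dvd f" for f
      using that nonunits_mult[OF \<pi>(2) pol] by auto
    have "irreducible \<pi>"
    proof (rule irreducibleI[OF \<pi>(1)])
      show "\<not> is_unit \<pi>"
      proof
        assume "is_unit \<pi>"
        then have "to_fract 1 \<in> nonunits R" by (rule nu)
        then show False using unit_one by (simp add: ring_unit_iff)
      qed
      show "is_unit a \<or> is_unit b" if ab: "\<pi> = a * b" for a b
      proof -
        have "to_fract a \<in> nonunits R \<or> to_fract b \<in> nonunits R"
          using \<pi>(2) unit_mult[of "to_fract a" "to_fract b"] pol by (auto simp: ab ring_unit_iff)
        then have "\<pi> dvd a \<or> \<pi> dvd b" using dv by auto
        then show ?thesis using ab \<pi>(1) dvd_times_left_cancel_iff[of a b 1] dvd_times_right_cancel_iff[of b a 1]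
          by auto
      qed
    qed
    moreover have "R = finite_ring \<pi>"
    proof (rule valuation_ring_eqI)
      show "valring (finite_ring \<pi>)" using calculation by (rule finite_ring_valring)
      show "valring R" by unfold_locales
      have q: "to_fract f / to_fract g \<in> R" if "\<not> \<pi> dvd g" for f g
      proof -
        have "to_fract g \<notin> nonunits R" using dv that by auto
        then have "ring_unit R (to_fract g)" using pol by (simp add: ring_unit_iff)
        then show ?thesis using mult[OF pol] by (simp add: divide_inverse ring_unit_def)
      qed
      then show "finite_ring \<pi> \<subseteq> R" by (auto simp: finite_ring_def)
      show "nonunits (finite_ring \<pi>) \<subseteq> nonunits R"
      proof
        fix z assume z: "z \<in> nonunits (finite_ring \<pi>)"
        then have "z \<in> finite_ring \<pi>" by (simp add: nonunits_def)
        then obtain f g where fg: "z = to_fract f / to_fract g" "\<not> \<pi> dvd g" by (auto simp: finite_ring_def)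
        have g0: "g \<noteq> 0" using fg by auto
        have "to_fract f = z * to_fract g" using fg g0 by simp
        then have "to_fract f \<in> nonunits (finite_ring \<pi>)"
          using valring.nonunits_mult[OF finite_ring_valring z finite_ring_to_fract, of g] calculation by simp
        then have "to_fract f \<in> nonunits R" using finite_ring_nonunit calculation nu by blast
        then show "z \<in> nonunits R" using nonunits_mult[OF _ q[OF fg(2), of 1], of "to_fract f"] fg(1)
          by (simp add: divide_inverse)
      qed
    qed
    ultimately show ?thesis by (rule that(2))
  next
    case False
    have X: "inverse X_fract \<in> nonunits R" using inverse_nonunit[OF False] .
    have u: "ring_unit R (to_fract f / X_fract ^ degree f)" if "f \<noteq> 0" for f
    proof -
      have "ring_unit R (poly (map_poly const_fract f) X_fract / X_fract ^ degree (map_poly const_fract f))"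
        using that co False
        by (intro poly_over_lead_power_unit) (auto simp: coeff_map_poly const_fract_hom degree_map_poly intro!: cu)
      then show ?thesis using to_fract_eq_poly[of f] by (simp add: degree_map_poly const_fract_hom)
    qed
    have q: "\<exists>w. ring_unit R w \<and> to_fract f / to_fract g = inverse X_fract ^ (degree g - degree f) * w"
      if "f \<noteq> 0" "g \<noteq> 0" "degree f \<le> degree g" for f g
    proof -
      let ?w = "(to_fract f / X_fract ^ degree f) / (to_fract g / X_fract ^ degree g)"
      have "X_fract ^ degree f * X_fract ^ (degree g - degree f) = X_fract ^ degree g"
        using that by (simp flip: power_add)
      then have "to_fract f / to_fract g = inverse X_fract ^ (degree g - degree f) * ?w"
        using that by (simp add: power_inverse field_simps)
      then show ?thesis using unit_divide[OF u u] that by blast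
    qed
    have "R = infinite_ring"
    proof (rule valuation_ring_eqI)
      show "valring infinite_ring" by (rule infinite_ring_valring)
      show "valring R" by unfold_locales
      show "infinite_ring \<subseteq> R"
      proof
        fix z :: "'a poly fract" assume "z \<in> infinite_ring"
        then obtain f g where fg: "z = to_fract f / to_fract g" "g \<noteq> 0" "degree f \<le> degree g"
          by (auto simp: infinite_ring_def)
        show "z \<in> R"
        proof (cases "f = 0")
          case True then show ?thesis using fg zero by simp
        next
          case f0: False
          show ?thesis using q[OF f0 fg(2,3)] fg(1) mult[OF power] nonunits_subset[OF X]
            by (metis ring_unit_def)
        qed
      qed
      show "nonunits infinite_ring \<subseteq> nonunits R"
      proof
        fix z :: "'a poly fract" assume z: "z \<in> nonunits infinite_ring"
        then have "z \<in> infinite_ring" by (simp add: nonunits_def)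
        then obtain f g where fg: "z = to_fract f / to_fract g" "g \<noteq> 0" by (auto simp: infinite_ring_def)
        show "z \<in> nonunits R"
        proof (cases "f = 0")
          case True then show ?thesis using fg zero_nonunit by simp
        next
          case f0: False
          then have d: "degree f < degree g" using z infinite_ring_nonunit[OF fg(2), of f] fg by simp
          then have n: "inverse X_fract ^ (degree g - degree f) \<in> nonunits R"
            using nonunit_power[OF X] by simp
          show ?thesis using q[OF f0 fg(2)] d fg(1) nonunits_mult[OF n] by (metis less_imp_le ring_unit_def)
        qed
      qed
    qed
    then show ?thesis by (rule that(1))
  qed
qed

subsection \<open>Degrees and principal divisors\<close>

abbreviation infinite_place :: "'a::field poly fract set" where
  "infinite_place \<equiv> nonunits infinite_ring"

abbreviation finite_place :: "'a::field poly \<Rightarrow> 'a poly fract set" where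
  "finite_place \<pi> \<equiv> nonunits (finite_ring \<pi>)"

lemma infinite_place: "place const_fract infinite_place"
  by (intro place_nonunits infinite_ring_valuation_ring) (simp add: const_fract_hom)

lemma finite_place: "irreducible \<pi> \<Longrightarrow> place const_fract (finite_place \<pi>)"
  by (intro place_nonunits finite_ring_valuation_ring) (simp_all add: const_fract_hom)

lemma place_ring_infinite: "place_ring infinite_place = infinite_ring"
  by (intro place_ring_nonunits infinite_ring_valring)

lemma place_ring_finite: "irreducible \<pi> \<Longrightarrow> place_ring (finite_place \<pi>) = finite_ring \<pi>"
  by (intro place_ring_nonunits finite_ring_valring)

lemma place_fract_cases:
  assumes "place const_fract P"
  obtains "P = infinite_place" | \<pi> where "irreducible \<pi>" "P = finite_place \<pi>"
  using assms valuation_ring_fract_cases unfolding place_eq by metis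

lemma infinite_disc_val:
  obtains v where "disc_val infinite_ring v"
    "\<And>f g. f \<noteq> 0 \<Longrightarrow> g \<noteq> 0 \<Longrightarrow> v (to_fract f / to_fract g) = int (degree g) - int (degree f)"
proof -
  have "to_fract 1 / X_fract \<in> (infinite_place :: 'a poly fract set)"
    by (subst infinite_ring_nonunit) auto
  then have X: "inverse X_fract \<in> (infinite_place :: 'a poly fract set)" by (simp add: divide_inverse)
  have ex: "\<exists>k. ring_unit infinite_ring (z / inverse X_fract powi k)" if "z \<noteq> 0" for z :: "'a poly fract"
  proof -
    obtain f g where fg: "z = to_fract f / to_fract g" "g \<noteq> 0" by (rule fract_cases)
    with that have "f \<noteq> 0" by auto
    then show ?thesis using infinite_ring_uniformizer[OF _ fg(2), of f] fg by blast
  qed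
  obtain v :: "'a poly fract \<Rightarrow> int" where v: "disc_val infinite_ring v"
    "\<And>z k. z \<noteq> 0 \<Longrightarrow> ring_unit infinite_ring (z / inverse X_fract powi k) \<Longrightarrow> v z = k"
    using disc_val_of_uniformizer[OF infinite_ring_valring X _ ex] by auto
  show ?thesis
    using v(2)[OF _ infinite_ring_uniformizer] by (intro that[OF v(1)]) simp
qed

lemma finite_disc_val:
  assumes "irreducible \<pi>"
  obtains v where "disc_val (finite_ring \<pi>) v" "v (to_fract \<pi>) = 1"
proof -
  have nz: "to_fract \<pi> \<noteq> 0" using assms by auto
  have \<pi>: "to_fract \<pi> \<in> nonunits (finite_ring \<pi>)" using finite_ring_nonunit[OF assms, of \<pi>] by simp
  obtain v where v: "disc_val (finite_ring \<pi>) v"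
    "\<And>z k. z \<noteq> 0 \<Longrightarrow> ring_unit (finite_ring \<pi>) (z / to_fract \<pi> powi k) \<Longrightarrow> v z = k"
    using disc_val_of_uniformizer[OF finite_ring_valring[OF assms] \<pi> nz finite_ring_uniformizer[OF assms]]
    by blast
  have "v (to_fract \<pi>) = 1"
    using v(2)[OF nz, of 1] nz valring.unit_one[OF finite_ring_valring[OF assms]] by simp
  with v(1) show ?thesis by (rule that)
qed

lemma disc_val_cong:
  assumes "disc_val R v" "\<And>z. z \<noteq> 0 \<Longrightarrow> w z = v z" shows "disc_val R w"
proof -
  have "a * b \<noteq> 0 \<Longrightarrow> w (a * b) = v (a * b)" for a b by (rule assms(2))
  then show ?thesis using assms unfolding disc_val_def by auto
qed

lemma place_val_fract_disc_val:
  assumes P: "place const_fract P" shows "disc_val (place_ring P) (place_val P)"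
proof -
  have "\<exists>v. disc_val (place_ring P) v"
    using place_fract_cases[OF P] infinite_disc_val finite_disc_val
    by (metis place_ring_infinite place_ring_finite)
  then obtain v where v: "disc_val (place_ring P) v" ..
  have "place_val P z = v z" if "z \<noteq> 0" for z
    using place_val_disc_val[OF _ P v that] by (simp add: const_fract_hom)
  with v show ?thesis by (rule disc_val_cong)
qed

lemma place_val_infinite:
  assumes "f \<noteq> 0" "g \<noteq> 0"
  shows "place_val infinite_place (to_fract f / to_fract g) = int (degree g) - int (degree f)"
proof -
  obtain v where v: "disc_val infinite_ring v"
    "\<And>f g :: 'a poly. f \<noteq> 0 \<Longrightarrow> g \<noteq> 0 \<Longrightarrow> v (to_fract f / to_fract g) = int (degree g) - int (degree f)"
    using infinite_disc_val by blast
  have "place_val infinite_place (to_fract f / to_fract g) = v (to_fract f / to_fract g)"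
    using place_val_disc_val[OF const_fract_hom(2) infinite_place, of v] v(1) assms
    by (simp add: place_ring_infinite)
  then show ?thesis using v(2)[OF assms] by simp
qed

lemma place_val_finite:
  assumes "irreducible \<pi>" "irreducible \<rho>"
  shows "place_val (finite_place \<rho>) (to_fract \<pi>) = (if finite_place \<rho> = finite_place \<pi> then 1 else 0)"
proof (cases "finite_place \<rho> = finite_place \<pi>")
  case True
  obtain v where v: "disc_val (finite_ring \<pi>) v" "v (to_fract \<pi>) = 1" using finite_disc_val[OF assms(1)] .
  have "place_val (finite_place \<pi>) (to_fract \<pi>) = v (to_fract \<pi>)"
    using place_val_disc_val[of const_fract "finite_place \<pi>" v] v(1) finite_place[OF assms(1)] assms
    by (auto simp: const_fract_hom place_ring_finite)
  then show ?thesis using True v by simp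
next
  case False
  have "\<not> \<rho> dvd \<pi>"
  proof
    assume d: "\<rho> dvd \<pi>"
    then have "\<pi> dvd \<rho>" by (rule irreducible_poly_dvd_irreducible[OF assms])
    then have "finite_ring \<pi> = finite_ring \<rho>" unfolding finite_ring_def using d by (meson dvd_trans)
    with False show False by simp
  qed
  then have "ring_unit (place_ring (finite_place \<rho>)) (to_fract \<pi>)"
    using finite_ring_unit[OF assms(2)] place_ring_finite[OF assms(2)] by simp
  then show ?thesis using False disc_val_unit[OF place_val_fract_disc_val[OF finite_place[OF assms(2)]]] by simp
qed

text \<open>The linear combinations of an independent family \<open>B\<close> represent \<open>|K|\<close> to the power \<open>card B\<close>
  residue classes, and a generating family \<open>B'\<close> represents at most \<open>|K|\<close> to the power \<open>card B'\<close>.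
  Counting replaces linear algebra because \<open>K\<close> is finite.\<close>

lemma residue_basis_card_le:
  fixes \<kappa> :: "'k::{finite,field} \<Rightarrow> 'f::field"
  assumes R: "valring R" "range \<kappa> \<subseteq> R" "\<And>a b. \<kappa> (a - b) = \<kappa> a - \<kappa> b"
    and B: "finite B" "B \<subseteq> R" "\<And>c. (\<Sum>b\<in>B. \<kappa> (c b) * b) \<in> nonunits R \<Longrightarrow> \<forall>b\<in>B. c b = 0"
    and B': "finite B'" "\<And>z. z \<in> R \<Longrightarrow> \<exists>c. z - (\<Sum>b\<in>B'. \<kappa> (c b) * b) \<in> nonunits R"
  shows "card B \<le> card B'"
proof -
  interpret valring R by fact
  let ?s = "\<lambda>B c. \<Sum>b\<in>B. \<kappa> (c b) * b"
  have mem: "?s B c \<in> R" for c using R(2) B(2) by (intro sum mult) auto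
  define g where "g c = restrict (SOME c'. ?s B c - ?s B' c' \<in> nonunits R) B'" for c
  have g: "?s B c - ?s B' (g c) \<in> nonunits R" for c
  proof -
    have "?s B c - ?s B' (SOME c'. ?s B c - ?s B' c' \<in> nonunits R) \<in> nonunits R"
      by (rule someI_ex[OF B'(2)[OF mem]])
    then show ?thesis by (simp add: g_def)
  qed
  have "inj_on g (B \<rightarrow>\<^sub>E UNIV)"
  proof (rule inj_onI)
    fix c d assume cd: "c \<in> B \<rightarrow>\<^sub>E UNIV" "d \<in> B \<rightarrow>\<^sub>E UNIV" "g c = g d"
    have "- (?s B d - ?s B' (g d)) \<in> nonunits R"
      using nonunits_mult[OF g[of d] uminus[OF one]] by simp
    then have "(?s B c - ?s B' (g c)) + - (?s B d - ?s B' (g d)) \<in> nonunits R"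
      by (rule nonunits_add[OF g])
    also have "(?s B c - ?s B' (g c)) + - (?s B d - ?s B' (g d)) = ?s B (\<lambda>b. c b - d b)"
      by (simp add: cd(3) R(3) left_diff_distrib sum_subtractf)
    finally have "\<forall>b\<in>B. c b - d b = 0" by (rule B(3))
    then show "c = d" using cd by (intro PiE_ext[of c B _ d]) auto
  qed
  moreover have "g ` (B \<rightarrow>\<^sub>E UNIV) \<subseteq> B' \<rightarrow>\<^sub>E UNIV" by (auto simp: g_def)
  ultimately have "card (B \<rightarrow>\<^sub>E (UNIV :: 'k set)) \<le> card (B' \<rightarrow>\<^sub>E (UNIV :: 'k set))"
    using B' by (intro card_inj_on_le) (auto intro: finite_PiE)
  then have "card (UNIV :: 'k set) ^ card B \<le> card (UNIV :: 'k set) ^ card B'" using B B' by (simp add: card_PiE)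
  moreover have "card (UNIV :: 'k set) > 1"
    using card_mono[of UNIV "{0, 1 :: 'k}"] by simp
  ultimately show ?thesis by simp
qed

definition residue_basis :: "('k::field \<Rightarrow> 'f::field) \<Rightarrow> 'f set \<Rightarrow> 'f set \<Rightarrow> bool" where
  "residue_basis \<kappa> P B \<longleftrightarrow> B \<subseteq> place_ring P \<and> finite B \<and>
     (\<forall>c. (\<Sum>b\<in>B. \<kappa> (c b) * b) \<in> P \<longrightarrow> (\<forall>b\<in>B. c b = 0)) \<and>
     (\<forall>z\<in>place_ring P. \<exists>c. z - (\<Sum>b\<in>B. \<kappa> (c b) * b) \<in> P)"

lemma place_degree_eq_card:
  fixes \<kappa> :: "'k::{finite,field} \<Rightarrow> 'f::field"
  assumes P: "place \<kappa> P" and \<kappa>: "\<kappa> 1 = 1" "\<And>a b. \<kappa> (a - b) = \<kappa> a - \<kappa> b"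
    and B: "residue_basis \<kappa> P B"
  shows "place_degree \<kappa> P = card B"
proof -
  have pr: "valring (place_ring P)" "nonunits (place_ring P) = P" "valuation_ring \<kappa> (place_ring P)"
    using place_ringD[of \<kappa> P] P \<kappa> by auto
  then have rg: "range \<kappa> \<subseteq> place_ring P" by (auto simp: valuation_ring_def)
  have le: "card B \<le> card B'" if "residue_basis \<kappa> P B" "residue_basis \<kappa> P B'" for B B'
    by (rule residue_basis_card_le[OF pr(1) rg \<kappa>(2)]) (use that pr(2) in \<open>auto simp: residue_basis_def\<close>)
  have "place_degree \<kappa> P = (THE d. \<exists>B. residue_basis \<kappa> P B \<and> card B = d)"
    unfolding place_degree_def residue_basis_def by (rule arg_cong[of _ _ The]) (auto simp: fun_eq_iff)
  also have "\<dots> = card B"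
    using B le by (intro the_equality) (auto intro: order_antisym)
  finally show ?thesis .
qed

lemma const_mult_to_fract: "const_fract c * to_fract f = to_fract (smult c f)"
  by (simp add: const_fract_def flip: to_fract_mult)

text \<open>At infinity, the residue of \<open>f/g\<close> is the quotient of the coefficients in degree
  \<open>degree g\<close>.\<close>

lemma residue_basis_infinite: "residue_basis const_fract (infinite_place :: 'a::field poly fract set) {1}"
proof -
  let ?P = "infinite_place :: 'a poly fract set"
  have unit: "ring_unit infinite_ring (const_fract c)" if "c \<noteq> 0" for c :: 'a
    using place_const_unit[OF _ infinite_place, of c] that
    by (simp add: const_fract_hom const_fract_inverse place_ring_infinite)
  show ?thesis unfolding residue_basis_def
  proof (intro conjI allI impI ballI[of "place_ring ?P"])
    show "{1} \<subseteq> place_ring ?P" using valring.one[OF infinite_ring_valring] by (simp add: place_ring_infinite)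
    show "\<forall>b\<in>{1 :: 'a poly fract}. c b = 0" if "(\<Sum>b\<in>{1}. const_fract (c b) * b) \<in> ?P" for c
      using that unit[of "c 1"] valring.ring_unit_iff[OF infinite_ring_valring] by auto
    fix z assume "z \<in> place_ring ?P"
    then have "z \<in> infinite_ring" by (simp only: place_ring_infinite)
    then obtain f g where fg: "z = to_fract f / to_fract g" "g \<noteq> 0" "degree f \<le> degree g"
      by (auto simp: infinite_ring_def)
    define c where "c = coeff f (degree g) / lead_coeff g"
    have "f - smult c g = 0 \<or> degree (f - smult c g) < degree g"
    proof (rule disjCI)
      assume nlt: "\<not> degree (f - smult c g) < degree g"
      have "degree (f - smult c g) \<le> degree g" using fg by (intro degree_diff_le) auto
      then have eq: "degree (f - smult c g) = degree g" using nlt by simp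
      have "coeff (f - smult c g) (degree g) = 0" using fg by (simp add: c_def)
      then show "f - smult c g = 0" using eq by (metis leading_coeff_0_iff)
    qed
    then have "to_fract (f - smult c g) / to_fract g \<in> ?P"
      using infinite_ring_nonunit[OF fg(2)] by blast
    moreover have "to_fract (f - smult c g) / to_fract g = z - const_fract c"
      using fg(2) by (simp add: fg(1) diff_divide_distrib flip: const_mult_to_fract)
    ultimately show "\<exists>c. z - (\<Sum>b\<in>{1}. const_fract (c b) * b) \<in> ?P"
      by (intro exI[of _ "\<lambda>_. c"]) simp
  qed simp
qed

text \<open>Modulo \<open>\<pi>\<close> a denominator prime to \<open>\<pi>\<close> has a polynomial inverse by the Bezout identity, so
  the residue field is \<open>K[x]/(\<pi>)\<close>, with basis the powers of \<open>x\<close> below \<open>degree \<pi>\<close>.\<close>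

lemma residue_basis_finite:
  fixes \<pi> :: "'a::field poly"
  assumes \<pi>: "irreducible \<pi>"
  obtains B where "residue_basis const_fract (finite_place \<pi>) B" "card B = degree \<pi>"
proof -
  let ?P = "finite_place \<pi>"
  let ?b = "\<lambda>i. to_fract (monom 1 i) :: 'a poly fract"
  define B where "B = ?b ` {..<degree \<pi>}"
  have inj: "inj_on ?b A" for A by (auto simp: inj_on_def monom_eq_iff')
  have sB: "(\<Sum>b\<in>B. const_fract (c b) * b) = to_fract (\<Sum>i<degree \<pi>. monom (c (?b i)) i)" for c
    unfolding B_def by (subst sum.reindex[OF inj]) (simp add: const_mult_to_fract smult_monom)
  interpret valring "finite_ring \<pi>" using finite_ring_valring[OF \<pi>] .
  have "residue_basis const_fract ?P B" unfolding residue_basis_def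
  proof (intro conjI allI impI ballI[of "place_ring ?P"])
    show "B \<subseteq> place_ring ?P" by (auto simp: B_def place_ring_finite[OF \<pi>] finite_ring_to_fract[OF \<pi>])
    show "finite B" by (simp add: B_def)
    fix c assume "(\<Sum>b\<in>B. const_fract (c b) * b) \<in> ?P"
    then have d: "\<pi> dvd (\<Sum>i<degree \<pi>. monom (c (?b i)) i)"
      unfolding sB finite_ring_nonunit[OF \<pi>] .
    have co: "coeff (\<Sum>i<degree \<pi>. monom (c (?b i)) i) j = (if j < degree \<pi> then c (?b j) else 0)" for j
      by (simp add: coeff_sum if_distrib cong: if_cong)
    have "(\<Sum>i<degree \<pi>. monom (c (?b i)) i) = 0"
    proof (rule ccontr)
      assume n0: "(\<Sum>i<degree \<pi>. monom (c (?b i)) i) \<noteq> 0"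
      then have "degree \<pi> \<le> degree (\<Sum>i<degree \<pi>. monom (c (?b i)) i)" by (rule dvd_imp_degree_le[OF d])
      then have "coeff (\<Sum>i<degree \<pi>. monom (c (?b i)) i) (degree (\<Sum>i<degree \<pi>. monom (c (?b i)) i)) = 0"
        unfolding co by simp
      then show False using n0 by simp
    qed
    then have "c (?b j) = 0" if "j < degree \<pi>" for j using co[of j] that by simp
    then show "\<forall>b\<in>B. c b = 0" by (auto simp: B_def)
  next
    fix z assume "z \<in> place_ring ?P"
    then have "z \<in> finite_ring \<pi>" by (simp only: place_ring_finite[OF \<pi>])
    then obtain f g where fg: "z = to_fract f / to_fract g" "\<not> \<pi> dvd g"
      by (auto simp: finite_ring_def)
    obtain u v where uv: "u * g + v * \<pi> = 1" using irreducible_poly_bezout[OF \<pi> fg(2)] .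
    define h where "h = (f * u) mod \<pi>"
    define c where "c b = coeff h (inv_into UNIV ?b b)" for b
    have ic: "c (?b i) = coeff h i" for i by (simp add: c_def inv_into_f_f[OF inj])
    have "\<pi> \<noteq> 0" using \<pi> by auto
    then have "degree h < degree \<pi>"
      using degree_mod_less[of \<pi> "f * u"] irreducible_poly_degree[OF \<pi>] by (auto simp: h_def)
    then have "(\<Sum>i<degree \<pi>. monom (c (?b i)) i) = h"
      unfolding ic by (intro poly_eqI) (auto simp: coeff_sum if_distrib coeff_eq_0 cong: if_cong)
    then have s: "(\<Sum>b\<in>B. const_fract (c b) * b) = to_fract h" unfolding sB by simp
    have "f - h * g = f * (u * g + v * \<pi>) - h * g" by (simp add: uv)
    also have "\<dots> = (f * u - h) * g + f * v * \<pi>" by (simp add: algebra_simps)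
    finally have "\<pi> dvd f - h * g" by (simp add: h_def minus_mod_eq_mult_div)
    then have n: "to_fract (f - h * g) \<in> ?P" using finite_ring_nonunit[OF \<pi>] by blast
    have "g \<noteq> 0" using fg by auto
    then have e: "z - to_fract h = to_fract (f - h * g) * inverse (to_fract g)"
      by (simp add: fg(1) field_simps)
    have "inverse (to_fract g) \<in> finite_ring \<pi>" using finite_ring_unit[OF \<pi>, of g] fg by (simp add: ring_unit_def)
    then have "z - to_fract h \<in> ?P" unfolding e by (rule nonunits_mult[OF n])
    then show "\<exists>c. z - (\<Sum>b\<in>B. const_fract (c b) * b) \<in> ?P" using s by metis
  qed
  moreover have "card B = degree \<pi>" by (simp add: B_def card_image[OF inj])
  ultimately show ?thesis by (rule that)
qed

lemma place_degree_infinite: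
  "place_degree const_fract (infinite_place :: 'a::{finite,field} poly fract set) = 1"
  using place_degree_eq_card[OF infinite_place _ _ residue_basis_infinite] by (simp add: const_fract_hom)

lemma place_degree_finite:
  fixes \<pi> :: "'a::{finite,field} poly"
  assumes \<pi>: "irreducible \<pi>" shows "place_degree const_fract (finite_place \<pi>) = degree \<pi>"
proof -
  obtain B where "residue_basis const_fract (finite_place \<pi>) B" "card B = degree \<pi>"
    using residue_basis_finite[OF \<pi>] .
  then show ?thesis using place_degree_eq_card[OF finite_place[OF \<pi>], of B] by (simp add: const_fract_hom)
qed

lemma place_degree_fract:
  fixes P :: "'a::{finite,field} poly fract set"
  assumes "place const_fract P"
  obtains B where "residue_basis const_fract P B" "place_degree const_fract P = card B"
proof -
  obtain B where B: "residue_basis const_fract P B"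
    using place_fract_cases[OF assms] residue_basis_infinite residue_basis_finite by metis
  then show ?thesis using place_degree_eq_card[OF assms _ _ B] by (intro that) (auto simp: const_fract_hom)
qed

text \<open>The support of the divisor is bounded by an arbitrary finite set \<open>S\<close> of places, which makes
  stability under products immediate: take the union of the two sets.\<close>

definition principal_of_degree_zero :: "'a::{finite,field} poly fract \<Rightarrow> bool" where
  "principal_of_degree_zero z \<longleftrightarrow> z \<noteq> 0 \<and> (\<exists>S. finite S \<and>
     (\<forall>P\<in>S. place const_fract P) \<and> (\<forall>P. place const_fract P \<longrightarrow> P \<notin> S \<longrightarrow> place_val P z = 0) \<and>
     (\<Sum>P\<in>S. place_val P z * int (place_degree const_fract P)) = 0)"

lemma principal_sum_zero:
  assumes z: "principal_of_degree_zero z"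
    and S: "finite S" "\<And>P. P \<in> S \<Longrightarrow> place const_fract P"
      "\<And>P. place const_fract P \<Longrightarrow> P \<notin> S \<Longrightarrow> place_val P z = 0"
  shows "(\<Sum>P\<in>S. place_val P z * int (place_degree const_fract P)) = 0"
proof -
  obtain T where T: "finite T" "\<And>P. P \<in> T \<Longrightarrow> place const_fract P"
    "\<And>P. place const_fract P \<Longrightarrow> P \<notin> T \<Longrightarrow> place_val P z = 0"
    "(\<Sum>P\<in>T. place_val P z * int (place_degree const_fract P)) = 0"
    using z by (auto simp: principal_of_degree_zero_def)
  have "(\<Sum>P\<in>S. place_val P z * int (place_degree const_fract P))
      = (\<Sum>P\<in>S \<union> T. place_val P z * int (place_degree const_fract P))"
    using S T by (intro sum.mono_neutral_left) auto
  also have "\<dots> = (\<Sum>P\<in>T. place_val P z * int (place_degree const_fract P))"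
    using S T by (intro sum.mono_neutral_right) auto
  finally show ?thesis using T(4) by simp
qed

lemma principal_of_degree_zero_mult:
  assumes a: "principal_of_degree_zero a" and b: "principal_of_degree_zero b"
  shows "principal_of_degree_zero (a * b)"
proof -
  have nz: "a \<noteq> 0" "b \<noteq> 0" using assms by (auto simp: principal_of_degree_zero_def)
  obtain S where S: "finite S" "\<And>P. P \<in> S \<Longrightarrow> place const_fract P"
    "\<And>P. place const_fract P \<Longrightarrow> P \<notin> S \<Longrightarrow> place_val P a = 0"
    using a by (auto simp: principal_of_degree_zero_def)
  obtain T where T: "finite T" "\<And>P. P \<in> T \<Longrightarrow> place const_fract P"
    "\<And>P. place const_fract P \<Longrightarrow> P \<notin> T \<Longrightarrow> place_val P b = 0"
    using b by (auto simp: principal_of_degree_zero_def)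
  have v: "place_val P (a * b) = place_val P a + place_val P b" if "place const_fract P" for P
    using disc_val_mult[OF place_val_fract_disc_val[OF that]] nz by simp
  have "(\<Sum>P\<in>S \<union> T. place_val P (a * b) * int (place_degree const_fract P))
    = (\<Sum>P\<in>S \<union> T. place_val P a * int (place_degree const_fract P))
      + (\<Sum>P\<in>S \<union> T. place_val P b * int (place_degree const_fract P))"
    unfolding sum.distrib[symmetric] using S T v by (intro sum.cong) (auto simp: algebra_simps)
  also have "(\<Sum>P\<in>S \<union> T. place_val P a * int (place_degree const_fract P)) = 0"
    by (rule principal_sum_zero[OF a]) (use S T in auto)
  also have "(\<Sum>P\<in>S \<union> T. place_val P b * int (place_degree const_fract P)) = 0"
    by (rule principal_sum_zero[OF b]) (use S T in auto)
  finally have "(\<Sum>P\<in>S \<union> T. place_val P (a * b) * int (place_degree const_fract P)) = 0" by simp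
  then show ?thesis unfolding principal_of_degree_zero_def
    using S T v nz by (intro conjI exI[of _ "S \<union> T"]) auto
qed

lemma principal_of_degree_zero_inverse:
  assumes a: "principal_of_degree_zero a" shows "principal_of_degree_zero (inverse a)"
proof -
  have nz: "a \<noteq> 0" using assms by (auto simp: principal_of_degree_zero_def)
  obtain S where S: "finite S" "\<And>P. P \<in> S \<Longrightarrow> place const_fract P"
    "\<And>P. place const_fract P \<Longrightarrow> P \<notin> S \<Longrightarrow> place_val P a = 0"
    using a by (auto simp: principal_of_degree_zero_def)
  have v: "place_val P (inverse a) = - place_val P a" if "place const_fract P" for P
    using disc_val_inverse[OF place_val_fract_disc_val[OF that] nz] .
  have "(\<Sum>P\<in>S. place_val P (inverse a) * int (place_degree const_fract P))
    = - (\<Sum>P\<in>S. place_val P a * int (place_degree const_fract P))"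
    unfolding sum_negf[symmetric] using S v by (intro sum.cong) auto
  also have "\<dots> = 0" using S by (subst principal_sum_zero[OF a]) auto
  finally show ?thesis unfolding principal_of_degree_zero_def
    using S v nz by (intro conjI exI[of _ S]) auto
qed

lemma principal_of_degree_zero_irreducible:
  assumes \<pi>: "irreducible \<pi>" shows "principal_of_degree_zero (to_fract \<pi>)"
proof -
  have nz: "\<pi> \<noteq> 0" using \<pi> by auto
  have i: "place_val infinite_place (to_fract \<pi>) = - int (degree \<pi>)"
    using place_val_infinite[OF nz, of 1] by simp
  have f: "place_val (finite_place \<pi>) (to_fract \<pi>) = 1" using place_val_finite[OF \<pi> \<pi>] by simp
  have ne: "finite_place \<pi> \<noteq> infinite_place" using i f by auto
  have "place_val P (to_fract \<pi>) = 0" if "place const_fract P" "P \<notin> {finite_place \<pi>, infinite_place}" for P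
    using that(1) by (rule place_fract_cases) (use that(2) place_val_finite[OF \<pi>] in auto)
  moreover have "(\<Sum>P\<in>{finite_place \<pi>, infinite_place}. place_val P (to_fract \<pi>) * int (place_degree const_fract P)) = 0"
    using ne i f by (simp add: place_degree_finite[OF \<pi>] place_degree_infinite)
  ultimately show ?thesis unfolding principal_of_degree_zero_def using nz finite_place[OF \<pi>] infinite_place
    by (intro conjI exI[of _ "{finite_place \<pi>, infinite_place}"]) auto
qed

lemma principal_of_degree_zero_const:
  assumes "c \<noteq> 0" shows "principal_of_degree_zero (const_fract c)"
proof -
  have "place_val P (const_fract c) = 0" if "place const_fract P" for P
    using place_const_unit[OF _ that, of c] assms disc_val_unit[OF place_val_fract_disc_val[OF that]]
    by (simp add: const_fract_hom const_fract_inverse)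
  then show ?thesis unfolding principal_of_degree_zero_def using assms
    by (intro conjI exI[of _ "{}"]) (auto simp: const_fract_hom)
qed

text \<open>Constants and irreducible polynomials generate the multiplicative group of \<open>K(x)\<close>, and the property
  is stable under products and inverses.\<close>

lemma principal_of_degree_zero:
  assumes "z \<noteq> 0" shows "principal_of_degree_zero z"
proof -
  have p: "principal_of_degree_zero (to_fract f)" if "f \<noteq> 0" for f :: "'a poly"
    using that
  proof (induction f rule: poly_factor_induct)
    case (const c) then show ?case using principal_of_degree_zero_const by (simp add: const_fract_def)
  qed (auto intro: principal_of_degree_zero_mult principal_of_degree_zero_irreducible)
  obtain f g where fg: "z = to_fract f / to_fract g" "g \<noteq> 0" by (rule fract_cases)
  with assms have "f \<noteq> 0" by auto
  then show ?thesis unfolding fg(1) divide_inverse using fg(2)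
    by (intro principal_of_degree_zero_mult principal_of_degree_zero_inverse p)
qed

text \<open>A product of powers of irreducible polynomials has the prescribed values at the finite places, and
  the value at infinity is then forced, as both divisors have degree zero.\<close>

lemma exists_fract_with_divisor:
  fixes S :: "'a::{finite,field} poly fract set set"
  assumes S: "finite S" "\<And>P. P \<in> S \<Longrightarrow> place const_fract P"
    and D: "(\<Sum>P\<in>S. D P * int (place_degree const_fract P)) = 0"
  obtains z where "z \<noteq> 0" "\<And>P. place const_fract P \<Longrightarrow> place_val P z = (if P \<in> S then D P else 0)"
proof -
  define T where "T = S - {infinite_place}"
  have "\<exists>\<pi>. irreducible \<pi> \<and> P = finite_place \<pi>" if "P \<in> T" for P
    using that S(2)[of P] place_fract_cases[of P] by (auto simp: T_def)
  then obtain \<pi> where \<pi>: "\<And>P. P \<in> T \<Longrightarrow> irreducible (\<pi> P) \<and> P = finite_place (\<pi> P)" by metis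
  have fT: "finite T" using S by (simp add: T_def)
  define z where "z = (\<Prod>P\<in>T. to_fract (\<pi> P) powi D P)"
  have nz: "to_fract (\<pi> P) powi D P \<noteq> 0" if "P \<in> T" for P
  proof -
    have "\<pi> P \<noteq> 0" using \<pi>[OF that] by (auto simp: irreducible_def)
    then show ?thesis by simp
  qed
  then have z0: "z \<noteq> 0" using fT by (simp add: z_def)
  have vfin: "place_val P z = (if P \<in> T then D P else 0)"
    if P: "place const_fract P" "P \<noteq> infinite_place" for P
  proof -
    have dv: "disc_val (place_ring P) (place_val P)" by (rule place_val_fract_disc_val[OF P(1)])
    obtain \<rho> where \<rho>: "irreducible \<rho>" "P = finite_place \<rho>" using place_fract_cases[OF P(1)] P(2) by blast
    have one: "place_val P (to_fract (\<pi> Q) powi D Q) = (if Q = P then D Q else 0)" if "Q \<in> T" for Q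
    proof -
      have "\<pi> Q \<noteq> 0" using \<pi>[OF that] by (auto simp: irreducible_def)
      then have "place_val P (to_fract (\<pi> Q) powi D Q) = D Q * place_val P (to_fract (\<pi> Q))"
        by (intro disc_val_powi[OF dv]) simp
      also have "place_val P (to_fract (\<pi> Q)) = (if Q = P then 1 else 0)"
        using \<pi>[OF that] place_val_finite[of "\<pi> Q" \<rho>] \<rho> by auto
      finally show ?thesis by simp
    qed
    have "place_val P z = (\<Sum>Q\<in>T. if Q = P then D Q else 0)"
      unfolding z_def using fT nz by (subst disc_val_prod[OF dv]) (auto simp: one)
    then show ?thesis using fT by simp
  qed
  let ?I = "infinite_place :: 'a poly fract set"
  have fI: "finite (insert ?I T)" and nT: "?I \<notin> T" using fT by (auto simp: T_def)
  have Tpl: "place const_fract P" if "P \<in> insert ?I T" for P using that S infinite_place by (auto simp: T_def)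
  have "(\<Sum>P\<in>insert ?I T. place_val P z * int (place_degree const_fract P)) = 0"
    using principal_of_degree_zero[OF z0] fI Tpl vfin by (intro principal_sum_zero) auto
  moreover have "(\<Sum>P\<in>T. place_val P z * int (place_degree const_fract P)) = (\<Sum>P\<in>T. D P * int (place_degree const_fract P))"
    using Tpl vfin by (intro sum.cong) (auto simp: T_def)
  ultimately have i: "place_val ?I z + (\<Sum>P\<in>T. D P * int (place_degree const_fract P)) = 0"
    using fT nT by (simp add: place_degree_infinite)
  have vI: "place_val ?I z = (if ?I \<in> S then D ?I else 0)"
  proof (cases "?I \<in> S")
    case True
    then have "(\<Sum>P\<in>S. D P * int (place_degree const_fract P)) = D ?I + (\<Sum>P\<in>T. D P * int (place_degree const_fract P))"
      using S(1) by (simp add: T_def sum.remove place_degree_infinite)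
    then show ?thesis using True i D by simp
  next
    case False
    then have "T = S" by (auto simp: T_def)
    then show ?thesis using False i D by simp
  qed
  show ?thesis
  proof (rule that[OF z0])
    fix P :: "'a poly fract set" assume "place const_fract P"
    then show "place_val P z = (if P \<in> S then D P else 0)"
      using vfin[of P] vI by (cases "P = ?I") (auto simp: T_def)
  qed
qed

text \<open>There are \<open>|K| + 1\<close> rational places: infinity and one for each linear polynomial.\<close>

lemma exists_new_rational_place:
  fixes A :: "'a::{finite,field} poly fract set set"
  assumes "finite A" "card A \<le> card (UNIV :: 'a set)"
  obtains P where "place const_fract P" "place_degree const_fract P = 1" "P \<notin> A"
proof -
  define F :: "'a option \<Rightarrow> 'a poly fract set" where
    "F = (\<lambda>c. case c of None \<Rightarrow> infinite_place | Some c \<Rightarrow> finite_place [:- c, 1:])"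
  have irr: "irreducible [:- c, 1:]" for c :: 'a by (rule irreducible_linear_field_poly) simp
  have v: "place_val (F x) (to_fract [:- c, 1:]) = (if x = Some c then 1 else if x = None then -1 else 0)" for x c
  proof (cases x)
    case None then show ?thesis using place_val_infinite[of "[:-c,1:]" 1] by (simp add: F_def)
  next
    case (Some d)
    have "\<not> [:- d, 1:] dvd [:- c, 1:]" if "d \<noteq> c"
      using that poly_eq_0_iff_dvd[of "[:- c, 1:]" d] by auto
    then have "finite_place [:- d, 1:] \<noteq> finite_place [:- c, 1:]" if "d \<noteq> c"
      using that finite_ring_nonunit[OF irr] by (metis dvd_refl)
    then show ?thesis using Some place_val_finite[OF irr irr, of d c] by (auto simp: F_def)
  qed
  have "inj F"
  proof (rule injI)
    fix x x' assume e: "F x = F x'"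
    show "x = x'"
    proof (cases x)
      case None then show ?thesis using v[of x' 0] v[of x 0] e by (auto split: if_splits)
    next
      case (Some c) then show ?thesis using v[of x' c] v[of x c] e by (auto split: if_splits)
    qed
  qed
  then have "card (range F) = card (UNIV :: 'a set) + 1" by (simp add: card_image UNIV_option_conv)
  then have "\<not> range F \<subseteq> A" using assms card_mono[OF assms(1), of "range F"] by linarith
  then obtain x where "F x \<notin> A" by auto
  moreover have "place const_fract (F x)" "place_degree const_fract (F x) = 1"
    using infinite_place finite_place[OF irr] place_degree_infinite place_degree_finite[OF irr]
    by (auto simp: F_def split: option.splits)
  ultimately show ?thesis using that by blast
qed

section \<open>Simple extensions of fields\<close>

text \<open>The extension of \<open>E\<close> generated by \<open>y\<close> is handled through the evaluation of polynomials over \<open>E\<close>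
  at \<open>y\<close>.\<close>

locale field_extension = field_hom \<iota> for \<iota> :: "'e::field \<Rightarrow> 'f::field" +
  fixes y :: 'f
begin

definition ev :: "'e poly \<Rightarrow> 'f" where "ev G = poly (map_poly \<iota> G) y"

interpretation map_poly_hom: map_poly_inj_idom_hom \<iota> ..

lemma ev_0 [simp]: "ev 0 = 0" by (simp add: ev_def)
lemma ev_const [simp]: "ev [:c:] = \<iota> c" by (simp add: ev_def poly_altdef)
lemma ev_1 [simp]: "ev 1 = 1" by (simp add: ev_def)
lemma ev_add: "ev (G + H) = ev G + ev H" by (simp add: ev_def map_poly_hom.hom_add)
lemma ev_diff: "ev (G - H) = ev G - ev H" by (simp add: ev_def map_poly_hom.hom_minus)
lemma ev_mult: "ev (G * H) = ev G * ev H" by (simp add: ev_def map_poly_hom.hom_mult)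
lemma ev_monom: "ev (monom c i) = \<iota> c * y ^ i" by (simp add: ev_def poly_monom)

lemma ev_eq_sum: "ev G = (\<Sum>i | coeff G i \<noteq> 0. \<iota> (coeff G i) * y ^ i)"
proof -
  have "ev G = (\<Sum>i\<le>degree G. \<iota> (coeff G i) * y ^ i)" by (simp add: ev_def poly_altdef)
  also have "\<dots> = (\<Sum>i | coeff G i \<noteq> 0. \<iota> (coeff G i) * y ^ i)"
    by (rule sum.mono_neutral_right) (auto simp: le_degree)
  finally show ?thesis .
qed

lemma finite_coeff_support: "finite {i. coeff (G :: 'e poly) i \<noteq> 0}"
  by (rule finite_subset[of _ "{..degree G}"]) (auto simp: le_degree)

text \<open>Let \<open>M\<^sub>0\<close> be a nonzero polynomial of least degree that vanishes at \<open>y\<close>.  If \<open>g(y)\<close> is nonzero,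
  then the greatest common divisor of \<open>g\<close> and \<open>M\<^sub>0\<close> is constant, and the Bezout identity yields the
  inverse of \<open>g(y)\<close> as a polynomial in \<open>y\<close>.\<close>

lemma subfield_range_ev:
  assumes "M \<noteq> 0" "ev M = 0" shows "subfield_set (range ev)"
proof -
  define S where "S = {D. D \<noteq> 0 \<and> ev D = 0}"
  have "M \<in> S" using assms by (simp add: S_def)
  from ex_has_least_nat[of "\<lambda>D. D \<in> S", OF this, of degree]
  obtain M0 where M0: "M0 \<noteq> 0" "ev M0 = 0" and least: "\<And>D. D \<noteq> 0 \<Longrightarrow> ev D = 0 \<Longrightarrow> degree M0 \<le> degree D"
    unfolding S_def by blast
  have inv: "inverse (ev g) \<in> range ev" for g
  proof (cases "ev g = 0")
    case True
    then show ?thesis by (metis ev_0 inverse_zero rangeI)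
  next
    case False
    obtain D u v where D: "D \<noteq> 0" "D = u * g + v * M0" "D dvd g" "D dvd M0"
      using poly_bezout[of g M0] M0(1) by blast
    have "ev D \<noteq> 0" using D(3) False by (auto simp: dvd_def ev_mult)
    obtain D' where D': "M0 = D * D'" using D(4) by (rule dvdE)
    then have "ev D' = 0" "D' \<noteq> 0" using M0 \<open>ev D \<noteq> 0\<close> by (auto simp: ev_mult)
    then have "degree M0 \<le> degree D'" by (intro least)
    then have "degree D = 0" using D' D(1) \<open>D' \<noteq> 0\<close> by (simp add: degree_mult_eq)
    then obtain c where c: "D = [:c:]" by (metis degree_eq_zeroE)
    then have "c \<noteq> 0" using D(1) by auto
    have "\<iota> c = ev u * ev g" using D(2) M0(2) c by (metis ev_add ev_const ev_mult mult_zero_right add_0_right)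
    moreover have "ev (u * [:inverse c:]) = ev u * inverse (\<iota> c)" by (simp only: ev_mult ev_const hom_inverse)
    moreover have "\<iota> c \<noteq> 0" using \<open>c \<noteq> 0\<close> by simp
    ultimately have "inverse (ev g) = ev (u * [:inverse c:])"
      using False by (auto simp: field_simps simp del: mult_pCons_right hom_0_iff)
    then show ?thesis by blast
  qed
  have "a + b \<in> range ev \<and> a - b \<in> range ev \<and> a * b \<in> range ev" if "a \<in> range ev" "b \<in> range ev" for a b
    using that by (auto simp flip: ev_add ev_diff ev_mult)
  moreover have "0 \<in> range ev" "1 \<in> range ev" by (metis ev_0 rangeI, metis ev_1 rangeI)
  ultimately show ?thesis using inv unfolding subfield_set_def by auto
qed

lemma ev_reduced:
  assumes M: "degree M > 0" "ev M = 0" and gen: "generated_subfield (insert y (range \<iota>)) = UNIV"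
  obtains G where "degree G < degree M" "z = ev G"
proof -
  have "M \<noteq> 0" using M by auto
  have "y = ev (monom 1 1)" by (simp add: ev_monom)
  moreover have "\<iota> c = ev [:c:]" for c by simp
  ultimately have "insert y (range \<iota>) \<subseteq> range ev" by blast
  then have "generated_subfield (insert y (range \<iota>)) \<subseteq> range ev"
    unfolding generated_subfield_def using subfield_range_ev[OF \<open>M \<noteq> 0\<close> M(2)] by blast
  then obtain G where G: "z = ev G" using gen by auto
  have "G = G div M * M + G mod M" by simp
  then have "ev G = ev (G mod M)" using M(2) by (metis add_0_left ev_add ev_mult mult_zero_right)
  moreover have "degree (G mod M) < degree M" using degree_mod_less[OF \<open>M \<noteq> 0\<close>, of G] M(1) by auto
  ultimately show ?thesis using that G by simp
qed

text \<open>Since the value \<open>-l\<close> of \<open>y\<^sup>N\<close> is prime to \<open>N\<close>, some monomial \<open>\<tau>\<close> in \<open>y\<close> and a prime element \<open>\<pi>\<close> of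
  \<open>E\<close> satisfies \<open>\<tau>\<^sup>N = \<pi>\<close> up to units.  Then \<open>y\<close> and the elements of \<open>E\<close> are powers of \<open>\<tau>\<close> up to
  units, which makes the extension totally ramified.  The terms of \<open>\<Sum>\<^sub>i z\<^sub>i y\<^sup>i\<close> with \<open>i < N\<close> then have pairwise
  incongruent values modulo \<open>N\<close>, so that none cancel.\<close>

lemma totally_ramified_disc_val:
  fixes N l :: nat
  assumes A: "valring A" and v: "disc_val {f. \<iota> f \<in> A} v"
    and N: "N > 0" "coprime N l" and h: "h \<noteq> 0" "v h = - int l" "ring_unit A (y ^ N / \<iota> h)"
    and surj: "\<And>z. \<exists>G. (\<forall>i. coeff G i \<noteq> 0 \<longrightarrow> i < N) \<and> z = ev G"
  obtains V where "disc_val A V"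
    "\<And>G. G \<noteq> 0 \<Longrightarrow> (\<And>i. coeff G i \<noteq> 0 \<Longrightarrow> i < N) \<Longrightarrow>
       ev G \<noteq> 0 \<and> V (ev G) = Min ((\<lambda>i. int N * v (coeff G i) - int i * int l) ` {i. coeff G i \<noteq> 0})"
proof -
  interpret A: valring A by fact
  have unit\<iota>: "ring_unit A (\<iota> f)" if "f \<noteq> 0" "v f = 0" for f
    using disc_val_unit[OF v, of f] that by (simp add: ring_unit_def hom_inverse)
  have y0: "y \<noteq> 0" using h N by (auto simp: ring_unit_def)
  obtain \<pi> where \<pi>: "\<pi> \<noteq> 0" "v \<pi> = 1" using v by (auto simp: disc_val_def)
  have \<pi>n: "\<iota> \<pi> \<in> nonunits A"
    using disc_val_nonunit[OF v, of \<pi>] \<pi> by (simp add: nonunits_def hom_inverse)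
  have "coprime (int l) (int N)" using N(2) by (simp add: coprime_commute)
  then obtain a b where ab: "a * int l + b * int N = 1"
    using bezout_int[of "int l" "int N"] by auto
  \<comment> \<open>\<open>\<tau>\<^sup>N\<close> has the value of \<open>h\<close> to the power \<open>- a\<close> times \<open>\<pi>\<close> to the power \<open>b * N\<close>, which is
    \<open>a * l + b * N = 1\<close>\<close>
  define \<tau> where "\<tau> = y powi (- a) * \<iota> \<pi> powi b"
  have \<tau>0: "\<tau> \<noteq> 0" using y0 \<pi> by (simp add: \<tau>_def)
  have \<iota>powi: "\<iota> (f powi k) = \<iota> f powi k" for f k
    by (simp add: power_int_def hom_power hom_inverse)
  have \<tau>N: "ring_unit A (\<tau> ^ N / \<iota> \<pi>)"
  proof -
    let ?c = "h powi (- a) * (\<pi> powi b) ^ N / \<pi>"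
    have "\<tau> ^ N = (y powi (- a)) ^ N * (\<iota> \<pi> powi b) ^ N" by (simp add: \<tau>_def power_mult_distrib)
    also have "(y powi (- a)) ^ N = (y ^ N) powi (- a)"
      by (metis mult.commute power_int_mult power_int_of_nat)
    also have "\<dots> = (y ^ N / \<iota> h) powi (- a) * \<iota> h powi (- a)"
      using h(1) by (simp flip: power_int_mult_distrib)
    finally have "\<tau> ^ N / \<iota> \<pi> = (y ^ N / \<iota> h) powi (- a) * \<iota> ?c"
      by (simp add: hom_mult hom_power \<iota>powi hom_div)
    moreover have "v ?c = 0"
      using h \<pi> ab by (simp add: disc_val_divide[OF v] disc_val_mult[OF v] disc_val_powi[OF v] disc_val_power[OF v] algebra_simps)
    moreover have "?c \<noteq> 0" using h \<pi> by simp
    ultimately show ?thesis using A.unit_mult[OF A.unit_powi[OF h(3)] unit\<iota>] by metis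
  qed
  have \<tau>Nn: "\<tau> ^ N \<in> nonunits A"
    using A.nonunits_mult[OF \<pi>n, of "\<tau> ^ N / \<iota> \<pi>"] \<tau>N \<pi> by (simp add: ring_unit_def)
  then have "\<tau> \<in> A" using A.root_mem N(1) A.nonunits_subset by blast
  moreover have "\<not> ring_unit A \<tau>" using \<tau>Nn A.unit_power[of \<tau> N] by (auto simp: A.ring_unit_iff)
  ultimately have \<tau>n: "\<tau> \<in> nonunits A" by (simp add: A.ring_unit_iff)
  have uf: "ring_unit A (\<iota> f / \<tau> powi (int N * v f))" if "f \<noteq> 0" for f
  proof -
    have "\<tau> powi (int N * v f) = (\<tau> ^ N) powi (v f)" by (simp add: power_int_mult)
    then have "\<iota> f / \<tau> powi (int N * v f) = \<iota> (f / \<pi> powi (v f)) / (\<tau> ^ N / \<iota> \<pi>) powi (v f)"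
      using \<pi> \<tau>0 by (simp add: power_int_divide_distrib hom_div \<iota>powi)
    moreover have "ring_unit A (\<iota> (f / \<pi> powi (v f)))"
      using that \<pi> by (intro unit\<iota>) (auto simp: disc_val_divide[OF v] disc_val_powi[OF v])
    ultimately show ?thesis using A.unit_divide[OF _ A.unit_powi[OF \<tau>N]] by simp
  qed
  have uy: "ring_unit A (y / \<tau> powi (- int l))"
  proof (rule A.root_unit[OF _ N(1)])
    have "\<tau> powi (int N * (- int l)) = (\<tau> powi (- int l)) ^ N"
      by (metis mult.commute power_int_mult power_int_of_nat)
    then have "(y / \<tau> powi (- int l)) ^ N = (y ^ N / \<iota> h) * (\<iota> h / \<tau> powi (int N * v h))"
      using h by (simp add: power_divide)
    then show "ring_unit A ((y / \<tau> powi (- int l)) ^ N)"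
      using A.unit_mult[OF h(3) uf[OF h(1)]] by simp
  qed
  define k where "k G i = int N * v (coeff G i) - int i * int l" for G i
  have mono_unit: "ring_unit A ((\<iota> (coeff G i) * y ^ i) / \<tau> powi k G i)" if "coeff G i \<noteq> 0" for G i
  proof -
    have "(\<tau> powi (- int l)) ^ i = \<tau> powi (- (int i * int l))"
      by (metis minus_mult_right mult.commute power_int_mult power_int_of_nat)
    then have "(\<iota> (coeff G i) * y ^ i) / \<tau> powi k G i
        = (\<iota> (coeff G i) / \<tau> powi (int N * v (coeff G i))) * (y / \<tau> powi (- int l)) ^ i"
      using \<tau>0 by (simp add: k_def power_divide power_int_diff power_int_minus field_simps)
    then show ?thesis using A.unit_mult[OF uf[OF that] A.unit_power[OF uy]] by simp
  qed
  have main: "ring_unit A (ev G / \<tau> powi (Min (k G ` {i. coeff G i \<noteq> 0})))"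
    if G: "G \<noteq> 0" "\<And>i. coeff G i \<noteq> 0 \<Longrightarrow> i < N" for G
  proof -
    let ?S = "{i. coeff G i \<noteq> 0}" and ?f = "\<lambda>i. \<iota> (coeff G i) * y ^ i"
    have fin: "finite ?S" by (rule finite_coeff_support)
    have "?S \<noteq> {}" using G(1) leading_coeff_0_iff by blast
    then have "Min (k G ` ?S) \<in> k G ` ?S" using fin by (intro Min_in) auto
    then obtain i where i: "i \<in> ?S" "Min (k G ` ?S) = k G i" by auto
    have "?f j / ?f i \<in> nonunits A" if "j \<in> ?S" "j \<noteq> i" for j
    proof -
      have "k G i \<noteq> k G j"
      proof
        assume eq: "k G i = k G j"
        then have "int N * (v (coeff G i) - v (coeff G j)) = (int i - int j) * int l"
          by (simp add: k_def algebra_simps)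
        then have "int N dvd (int i - int j) * int l" by (metis dvd_triv_left)
        then have "int N dvd int i - int j" using N(2) by (simp add: coprime_dvd_mult_left_iff)
        moreover have "\<bar>int i - int j\<bar> < int N" using G(2)[of i] G(2)[of j] i that by auto
        ultimately show False using that(2) dvd_imp_le_int[of "int i - int j" "int N"] by simp
      qed
      moreover have "k G i \<le> k G j" using i(2) that fin by (metis Min_le finite_imageI imageI)
      ultimately have lt: "k G j - k G i > 0" by simp
      have eq: "?f j / ?f i = \<tau> powi (k G j - k G i) * ((?f j / \<tau> powi k G j) / (?f i / \<tau> powi k G i))"
        using \<tau>0 by (simp add: power_int_diff)
      have "ring_unit A ((?f j / \<tau> powi k G j) / (?f i / \<tau> powi k G i))"
        using i that by (intro A.unit_divide mono_unit) auto
      then have "(?f j / \<tau> powi k G j) / (?f i / \<tau> powi k G i) \<in> A" unfolding ring_unit_def by blast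
      then show ?thesis unfolding eq by (rule A.nonunits_mult[OF A.powi_nonunit[OF \<tau>n lt]])
    qed
    then have "ring_unit A (sum ?f ?S / ?f i)"
      using i y0 fin by (intro A.sum_dominant) auto
    then have "ring_unit A (ev G / ?f i * (?f i / \<tau> powi k G i))"
      using mono_unit[of G i] i by (intro A.unit_mult) (auto simp: ev_eq_sum[of G])
    then show ?thesis using i y0 by simp
  qed
  have ex: "\<exists>k. ring_unit A (z / \<tau> powi k)" if "z \<noteq> 0" for z
    using surj[of z] main that by (metis ev_0)
  obtain V where V: "disc_val A V" "\<And>z k. z \<noteq> 0 \<Longrightarrow> ring_unit A (z / \<tau> powi k) \<Longrightarrow> V z = k"
    using disc_val_of_uniformizer[OF A \<tau>n \<tau>0 ex] by blast
  show ?thesis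
  proof (rule that[OF V(1)])
    fix G :: "'e poly" assume G: "G \<noteq> 0" "\<And>i. coeff G i \<noteq> 0 \<Longrightarrow> i < N"
    have "ev G \<noteq> 0" using main[OF G] by (auto simp: ring_unit_def)
    with V(2)[OF this main[OF G]]
    show "ev G \<noteq> 0 \<and> V (ev G) = Min ((\<lambda>i. int N * v (coeff G i) - int i * int l) ` {i. coeff G i \<noteq> 0})"
      by (simp add: k_def)
  qed
qed

end

subsection \<open>Existence of valuation rings above a given one\<close>

definition subring_set :: "'f::field set \<Rightarrow> bool" where
  "subring_set B \<longleftrightarrow> 1 \<in> B \<and> (\<forall>a\<in>B. \<forall>b\<in>B. a + b \<in> B \<and> a - b \<in> B \<and> a * b \<in> B)"

lemma subring_set_simps:
  assumes "subring_set B"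
  shows "1 \<in> B" "0 \<in> B" "a \<in> B \<Longrightarrow> b \<in> B \<Longrightarrow> a + b \<in> B" "a \<in> B \<Longrightarrow> b \<in> B \<Longrightarrow> a - b \<in> B"
    "a \<in> B \<Longrightarrow> b \<in> B \<Longrightarrow> a * b \<in> B" "a \<in> B \<Longrightarrow> a ^ n \<in> B" "a \<in> B \<Longrightarrow> - a \<in> B"
proof -
  show one: "1 \<in> B" using assms by (simp add: subring_set_def)
  show "a + b \<in> B" "a * b \<in> B" if "a \<in> B" "b \<in> B" using assms that by (auto simp: subring_set_def)
  show diff: "a - b \<in> B" if "a \<in> B" "b \<in> B" for a b using assms that by (auto simp: subring_set_def)
  show zero: "0 \<in> B" using diff[OF one one] by simp
  show "a ^ n \<in> B" if "a \<in> B" using assms that one by (induction n) (auto simp: subring_set_def)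
  show "- a \<in> B" if "a \<in> B" using diff[OF zero that] by simp
qed

lemma subring_set_sum:
  "subring_set B \<Longrightarrow> (\<And>i. i \<in> S \<Longrightarrow> f i \<in> B) \<Longrightarrow> sum f S \<in> B"
  by (induction S rule: infinite_finite_induct) (auto simp: subring_set_simps)

lemma subring_adjoin:
  assumes "subring_set B"
  shows "subring_set {poly g z | g. \<forall>i. coeff g i \<in> B}" "B \<subseteq> {poly g z | g. \<forall>i. coeff g i \<in> B}"
    "z \<in> {poly g z | g. \<forall>i. coeff g i \<in> B}"
proof -
  let ?C = "{poly g z | g. \<forall>i. coeff g i \<in> B}"
  have c: "b \<in> ?C" if "b \<in> B" for b
    using that assms by (intro CollectI exI[of _ "[:b:]"]) (auto simp: coeff_pCons subring_set_simps split: nat.splits)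
  then show "B \<subseteq> ?C" by blast
  show "z \<in> ?C"
    using assms by (intro CollectI exI[of _ "[:0, 1:]"]) (auto simp: coeff_pCons subring_set_simps split: nat.splits)
  have op: "poly g z + poly h z \<in> ?C \<and> poly g z - poly h z \<in> ?C \<and> poly g z * poly h z \<in> ?C"
    if "\<forall>i. coeff g i \<in> B" "\<forall>i. coeff h i \<in> B" for g h
  proof (intro conjI)
    show "poly g z + poly h z \<in> ?C"
      using that assms by (intro CollectI exI[of _ "g + h"]) (auto simp: subring_set_simps)
    show "poly g z - poly h z \<in> ?C"
      using that assms by (intro CollectI exI[of _ "g - h"]) (auto simp: subring_set_simps)
    show "poly g z * poly h z \<in> ?C"
      using that assms by (intro CollectI exI[of _ "g * h"])
        (auto simp: coeff_mult intro!: subring_set_sum subring_set_simps(5)[OF assms])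
  qed
  then have "a + b \<in> ?C \<and> a - b \<in> ?C \<and> a * b \<in> ?C" if "a \<in> ?C" "b \<in> ?C" for a b
    using that by (elim CollectE exE conjE) blast
  moreover have "1 \<in> ?C" using c[OF subring_set_simps(1)[OF assms]] .
  ultimately show "subring_set ?C" unfolding subring_set_def by blast
qed

text \<open>A subring that is maximal among those avoiding an element \<open>w\<close> is a valuation ring, provided
  that it contains \<open>1/w\<close>: all elements \<open>1 - c/w\<close> are then units, and with them a relation
  \<open>w = h(1/z)\<close> of degree \<open>m\<close> lowers the degree of any relation \<open>w = g(z)\<close> of degree at least
  \<open>m\<close>.\<close>

lemma exists_valring_avoiding:
  assumes A: "subring_set A" "w \<notin> A" "inverse w \<in> A"
  obtains B where "valring B" "A \<subseteq> B" "w \<notin> B"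
proof -
  define \<A> where "\<A> = {B. subring_set B \<and> A \<subseteq> B \<and> w \<notin> B}"
  have "A \<in> \<A>" using A by (simp add: \<A>_def)
  have "\<Union>\<C> \<in> \<A>" if "\<C> \<noteq> {}" "subset.chain \<A> \<C>" for \<C>
  proof -
    have C: "\<And>B. B \<in> \<C> \<Longrightarrow> subring_set B \<and> A \<subseteq> B \<and> w \<notin> B"
      and lin: "\<And>B C. B \<in> \<C> \<Longrightarrow> C \<in> \<C> \<Longrightarrow> B \<subseteq> C \<or> C \<subseteq> B"
      using that(2) unfolding subset_chain_def \<A>_def by auto
    from that(1) obtain B0 where B0: "B0 \<in> \<C>" by auto
    have "a + b \<in> \<Union>\<C> \<and> a - b \<in> \<Union>\<C> \<and> a * b \<in> \<Union>\<C>" if ab: "a \<in> \<Union>\<C>" "b \<in> \<Union>\<C>" for a b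
    proof -
      obtain B where B: "B \<in> \<C>" "a \<in> B" "b \<in> B" using ab lin by (meson UnionE subsetD)
      then have "a + b \<in> B \<and> a - b \<in> B \<and> a * b \<in> B" using C[OF B(1)] by (simp add: subring_set_simps)
      then show ?thesis using B(1) by blast
    qed
    moreover have "1 \<in> \<Union>\<C>" using B0 C[OF B0] by (auto dest: subring_set_simps(1))
    ultimately have "subring_set (\<Union>\<C>)" by (simp add: subring_set_def)
    then show ?thesis using C B0 unfolding \<A>_def by blast
  qed
  then obtain B where B: "B \<in> \<A>" and max: "\<And>C. C \<in> \<A> \<Longrightarrow> B \<subseteq> C \<Longrightarrow> C = B"
    using subset_Zorn_nonempty[of \<A>] \<open>A \<in> \<A>\<close> by (metis empty_iff)
  have sB: "subring_set B" and AB: "A \<subseteq> B" and wB: "w \<notin> B" using B by (auto simp: \<A>_def)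
  note Bs = subring_set_simps[OF sB]
  have w0: "w \<noteq> 0" using wB Bs(2) by auto
  define \<pi> where "\<pi> = inverse w"
  have \<pi>B: "\<pi> \<in> B" using A AB by (auto simp: \<pi>_def)
  have w\<pi>: "w * \<pi> = 1" using w0 by (simp add: \<pi>_def)
  have adj: "\<exists>g. w = poly g z \<and> (\<forall>i. coeff g i \<in> B)" if "z \<notin> B" for z
  proof (rule ccontr)
    assume "\<not> ?thesis"
    then have "w \<notin> {poly g z | g. \<forall>i. coeff g i \<in> B}" by blast
    then have "{poly g z | g. \<forall>i. coeff g i \<in> B} \<in> \<A>"
      using subring_adjoin[OF sB, of z] AB unfolding \<A>_def by blast
    from max[OF this subring_adjoin(2)[OF sB]] subring_adjoin(3)[OF sB, of z] that show False by simp
  qed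
  have u: "1 - \<pi> * c \<noteq> 0 \<and> inverse (1 - \<pi> * c) \<in> B" if c: "c \<in> B" for c
  proof -
    let ?u = "1 - \<pi> * c"
    have wu: "w * ?u = w - c" using w\<pi> by (simp add: algebra_simps)
    have uB: "?u \<in> B" using Bs \<pi>B c by simp
    have u0: "?u \<noteq> 0" using wu wB c by auto
    \<comment> \<open>as \<open>w * u = w - c\<close>, the factors \<open>u\<close> of a product \<open>w * u\<^sup>k\<close> in \<open>B\<close> can be removed one by one\<close>
    have desc: "w * ?u ^ k \<in> B \<Longrightarrow> w \<in> B" for k
    proof (induction k)
      case (Suc k)
      have "w * ?u ^ Suc k = (w * ?u) * ?u ^ k" by simp
      then have "w * ?u ^ k = w * ?u ^ Suc k + c * ?u ^ k"
        by (simp only: wu left_diff_distrib diff_add_cancel)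
      then have "w * ?u ^ k \<in> B" using Suc.prems Bs(3)[OF Suc.prems Bs(5)[OF c Bs(6)[OF uB, of k]]] by simp
      then show ?case by (rule Suc.IH)
    qed simp
    have "inverse ?u \<in> B"
    proof (rule ccontr)
      assume "inverse ?u \<notin> B"
      then obtain g where g: "w = poly g (inverse ?u)" "\<forall>i. coeff g i \<in> B" using adj by blast
      have "w * ?u ^ degree g = (\<Sum>i\<le>degree g. coeff g i * (inverse ?u ^ i * ?u ^ degree g))"
        unfolding g(1) poly_altdef sum_distrib_right by (simp only: mult.assoc)
      also have "\<dots> = (\<Sum>i\<le>degree g. coeff g i * ?u ^ (degree g - i))"
      proof (intro sum.cong refl)
        fix i assume "i \<in> {..degree g}"
        then have "?u ^ degree g = ?u ^ i * ?u ^ (degree g - i)" by (simp flip: power_add)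
        then show "coeff g i * (inverse ?u ^ i * ?u ^ degree g) = coeff g i * ?u ^ (degree g - i)"
          using u0 by (simp add: power_inverse)
      qed
      also have "\<dots> \<in> B" using g(2) Bs(5,6) uB by (intro subring_set_sum[OF sB]) auto
      finally show False using desc wB by blast
    qed
    with u0 show ?thesis by simp
  qed
  have False if "\<forall>i. coeff g i \<in> B" "\<forall>i. coeff h i \<in> B" "poly g z = w" "poly h (inverse z) = w" for g h z
    using that
  proof (induction "degree g + degree h" arbitrary: g h z rule: less_induct)
    case less
    have step: False if gh: "degree h \<le> degree g" "\<forall>i. coeff g i \<in> B" "\<forall>i. coeff h i \<in> B"
        "poly g z = w" "poly h (inverse z) = w" "degree g + degree h = d"
        and hyp: "\<And>g' . degree g' + degree h < d \<Longrightarrow> \<forall>i. coeff g' i \<in> B \<Longrightarrow> poly g' z = w \<Longrightarrow> False"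
      for g h z d
    proof -
      define m where "m = degree h"
      define n where "n = degree g"
      have m0: "m > 0"
      proof (rule ccontr)
        assume "\<not> m > 0"
        then obtain b where "h = [:b:]" unfolding m_def by (metis degree_eq_zeroE gr0I)
        then have "w \<in> B" using gh(3,5) by (auto simp: coeff_pCons split: nat.splits dest: spec[of _ 0])
        with wB show False by simp
      qed
      have nm: "m \<le> n" using gh(1) by (simp add: m_def n_def)
      have z0: "z \<noteq> 0"
      proof
        assume "z = 0"
        then have "w = coeff g 0" using gh(4) by (simp add: poly_0_coeff_0)
        with gh(2) wB show False by simp
      qed
      define e where "e = inverse (1 - \<pi> * coeff h 0)"
      have e: "e * (1 - \<pi> * coeff h 0) = 1" "e \<in> B" using u[of "coeff h 0"] gh(3) by (auto simp: e_def)
      \<comment> \<open>the relation \<open>w = h(1/z)\<close>, solved for 1 and multiplied by \<open>z\<^sup>m\<close>, reads \<open>z\<^sup>m = r(z)\<close> with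
        \<open>r\<close> of degree less than \<open>m\<close>\<close>
      define r where "r = (\<Sum>j\<in>{1..m}. monom (e * (\<pi> * coeff h j)) (m - j))"
      have rB: "coeff r i \<in> B" for i
        using gh(3) e(2) \<pi>B by (auto simp: r_def coeff_sum Bs intro!: subring_set_sum[OF sB])
      have rd: "degree r < m"
      proof -
        have "degree r \<le> m - 1" unfolding r_def
          by (rule degree_sum_le) (auto intro: order_trans[OF degree_monom_le])
        then show ?thesis using m0 by simp
      qed
      have "1 = \<pi> * poly h (inverse z)" using gh(5) w\<pi> by (simp add: mult.commute)
      also have "poly h (inverse z) = coeff h 0 + (\<Sum>j\<in>{1..m}. coeff h j * inverse z ^ j)"
        unfolding poly_altdef m_def by (simp add: sum.atMost_shift sum.shift_bounds_Suc_ivl atLeast0AtMost sum.atLeast1_atMost_eq lessThan_Suc_atMost)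
      finally have "1 - \<pi> * coeff h 0 = (\<Sum>j\<in>{1..m}. \<pi> * coeff h j * inverse z ^ j)"
        by (simp add: algebra_simps sum_distrib_left)
      then have "1 = (\<Sum>j\<in>{1..m}. e * (\<pi> * coeff h j) * inverse z ^ j)"
        using e(1) by (simp add: sum_distrib_left mult_ac)
      then have "z ^ m = (\<Sum>j\<in>{1..m}. e * (\<pi> * coeff h j) * inverse z ^ j) * z ^ m" by simp
      also have "\<dots> = poly r z"
        unfolding r_def poly_sum sum_distrib_right
      proof (intro sum.cong refl)
        fix j assume "j \<in> {1..m}"
        then have "z ^ m = z ^ j * z ^ (m - j)" by (simp flip: power_add)
        then show "e * (\<pi> * coeff h j) * inverse z ^ j * z ^ m = poly (monom (e * (\<pi> * coeff h j)) (m - j)) z"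
          using z0 by (simp add: poly_monom power_inverse)
      qed
      finally have zm: "z ^ m = poly r z" .
      define b where "b = lead_coeff g"
      define g' where "g' = (g - monom b n) + monom b (n - m) * r"
      have bB: "b \<in> B" using gh(2) by (simp add: b_def)
      have "poly g' z = poly g z - b * z ^ n + b * z ^ (n - m) * z ^ m"
        by (simp add: g'_def poly_monom zm)
      also have "z ^ n = z ^ (n - m) * z ^ m" using nm by (simp flip: power_add)
      finally have "poly g' z = w" using gh(4) by simp
      moreover have "degree g' < n"
      proof -
        have n0: "n > 0" using m0 nm by simp
        have "degree (monom b (n - m) * r) < n"
          using degree_mult_le[of "monom b (n - m)" r] degree_monom_le[of b "n - m"] rd nm by linarith
        moreover have "degree (g - monom b n) < n"
        proof -
          have "degree (g - monom b n) \<le> n" by (intro degree_diff_le) (auto simp: n_def degree_monom_le)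
          moreover have "coeff (g - monom b n) n = 0" by (simp add: b_def n_def)
          ultimately show ?thesis using n0 by (metis le_neq_implies_less leading_coeff_0_iff degree_0)
        qed
        ultimately show ?thesis unfolding g'_def by (rule degree_add_less[rotated])
      qed
      moreover have "coeff (monom b (n - m) * r) i \<in> B" for i
        using bB rB by (auto simp: coeff_monom_mult Bs)
      then have "coeff g' i \<in> B" for i using gh(2) bB by (auto simp: g'_def Bs)
      ultimately show False using hyp[of g'] gh(6) by (simp add: n_def)
    qed
    show False
    proof (cases "degree h \<le> degree g")
      case True
      show False
        by (rule step[OF True less.prems refl])
          (use less.hyps less.prems in blast)
    next
      case False
      show False
      proof (rule step[of g h "inverse z" "degree h + degree g"])
        fix g' assume "degree g' + degree g < degree h + degree g" "\<forall>i. coeff g' i \<in> B"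
          "poly g' (inverse z) = w"
        then show False using less.hyps[of g' g "inverse z"] less.prems by simp
      qed (use False less.prems in auto)
    qed
  qed
  then have "z \<in> B \<or> inverse z \<in> B" for z using adj[of z] adj[of "inverse z"] by metis
  then have "valring B" using Bs by unfold_locales auto
  then show ?thesis using that AB wB by blast
qed

subsection \<open>Integrality of coefficients\<close>

text \<open>Newton interpolation: the divided differences stay in the ring because the differences of the
  points are units.\<close>

lemma (in valring) coeffs_mem_of_values:
  assumes "finite S" "degree G < card S" "S \<subseteq> R" "\<And>x. x \<in> S \<Longrightarrow> poly G x \<in> R"
    "\<And>x x'. x \<in> S \<Longrightarrow> x' \<in> S \<Longrightarrow> x \<noteq> x' \<Longrightarrow> ring_unit R (x - x')"
  shows "coeff G i \<in> R"
  using assms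
proof (induction "card S" arbitrary: S G i)
  case (Suc n)
  then obtain x where x: "x \<in> S" by fastforce
  let ?H = "synthetic_div G x"
  have G: "G = [:- x, 1:] * ?H + [:poly G x:]" using synthetic_div_correct'[of x G] by simp
  show ?case
  proof (cases "degree G = 0")
    case True
    then obtain c where "G = [:c:]" by (metis degree_eq_zeroE)
    then show ?thesis using Suc.prems(4)[OF x] zero by (auto simp: coeff_pCons split: nat.splits)
  next
    case False
    have H: "coeff ?H j \<in> R" for j
    proof (rule Suc.hyps(1)[of "S - {x}"])
      show "n = card (S - {x})" "finite (S - {x})" "S - {x} \<subseteq> R" using Suc x by auto
      show "degree ?H < card (S - {x})"
        using Suc.prems(1,2) x False by (simp add: degree_synthetic_div)
      show "ring_unit R (a - b)" if "a \<in> S - {x}" "b \<in> S - {x}" "a \<noteq> b" for a b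
        using Suc.prems(5) that by auto
      fix a assume a: "a \<in> S - {x}"
      have "poly G a = (a - x) * poly ?H a + poly G x" by (subst G) (simp add: algebra_simps)
      then have "poly ?H a = (poly G a - poly G x) * inverse (a - x)" using a by (simp add: field_simps)
      also have "\<dots> \<in> R" using a x Suc.prems(4,5) by (intro mult diff) (auto simp: ring_unit_def)
      finally show "poly ?H a \<in> R" .
    qed
    have "coeff G i = coeff (pCons 0 ?H) i - x * coeff ?H i + coeff [:poly G x:] i"
      by (subst G) simp
    also have "\<dots> \<in> R"
      using H Suc.prems(3,4) x zero by (intro add diff mult) (auto simp: coeff_pCons split: nat.splits)
    finally show ?thesis .
  qed
qed simp

context field_extension
begin

text \<open>Suppose that \<open>y \<mapsto> y + \<omega>\<close> defines an endomorphism of the extension for \<open>N\<close> elements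
  \<open>\<omega>\<close> of \<open>E\<close> with pairwise unit differences.  Pulling one valuation ring above \<open>R\<close> back along these
  endomorphisms gives further ones, so if \<open>G(y)\<close> lies in all of them, then the \<open>N\<close> values
  \<open>G(y + \<omega>)\<close> lie in the first one, and interpolation recovers the coefficients of \<open>G\<close>.\<close>

lemma coeffs_integral:
  assumes R: "valring R" "disc_val R v"
    and W: "finite W" "W \<subseteq> R" "\<And>x x'. x \<in> W \<Longrightarrow> x' \<in> W \<Longrightarrow> x \<noteq> x' \<Longrightarrow> ring_unit R (x - x')"
    and shift: "\<And>x G. x \<in> W \<Longrightarrow> ev G = 0 \<Longrightarrow> poly (map_poly \<iota> G) (y + \<iota> x) = 0"
    and surj: "\<And>z. \<exists>G. z = ev G"
    and yint: "\<And>A. valring A \<Longrightarrow> {f. \<iota> f \<in> A} = R \<Longrightarrow> y \<in> A"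
    and G: "degree G < card W" "\<And>A. valring A \<Longrightarrow> {f. \<iota> f \<in> A} = R \<Longrightarrow> ev G \<in> A"
  shows "coeff G i \<in> R"
proof -
  interpret R: valring R by fact
  obtain \<pi> where \<pi>: "\<pi> \<noteq> 0" "v \<pi> = 1" using R(2) by (auto simp: disc_val_def)
  have "subring_set (\<iota> ` R)" unfolding subring_set_def
    using R.one R.add R.diff R.mult by (auto simp flip: hom_add hom_mult hom_minus)
  moreover have "inverse \<pi> \<notin> R" "\<pi> \<in> R"
    using \<pi> disc_val_mem[OF R(2)] by (auto simp: disc_val_inverse[OF R(2)])
  then have "\<iota> (inverse \<pi>) \<notin> \<iota> ` R" "inverse (\<iota> (inverse \<pi>)) \<in> \<iota> ` R"
    by (auto simp flip: hom_inverse)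
  ultimately obtain A where A: "valring A" "\<iota> ` R \<subseteq> A" "\<iota> (inverse \<pi>) \<notin> A"
    by (rule exists_valring_avoiding)
  interpret A: valring A by fact
  have AR: "{f. \<iota> f \<in> A} = R"
  proof (intro antisym subsetI)
    fix f assume f: "f \<in> {f. \<iota> f \<in> A}"
    show "f \<in> R"
    proof (rule ccontr)
      assume n: "f \<notin> R"
      then have neg: "f \<noteq> 0" "v f < 0" using disc_val_mem[OF R(2), of f] by auto
      have "inverse \<pi> / f \<in> R"
        using neg \<pi> disc_val_mem[OF R(2)] by (simp add: disc_val_divide[OF R(2)] disc_val_inverse[OF R(2)])
      then have "\<iota> (inverse \<pi> / f) * \<iota> f \<in> A" using f A(2) by (intro A.mult) auto
      then show False using A(3) neg(1) by (simp flip: hom_mult)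
    qed
  qed (use A in auto)
  interpret map_poly_hom: map_poly_inj_idom_hom \<iota> ..
  have val: "poly (map_poly \<iota> G) (y + \<iota> x) \<in> A" if x: "x \<in> W" for x
  proof -
    let ?s = "\<lambda>G. poly (map_poly \<iota> G) (y + \<iota> x)"
    \<comment> \<open>the preimage of \<open>A\<close> under the endomorphism \<open>y \<mapsto> y + x\<close>\<close>
    define A' where "A' = {ev G | G. ?s G \<in> A}"
    have wd: "?s G = ?s H" if "ev G = ev H" for G H
      using shift[OF x, of "G - H"] that by (simp add: ev_diff map_poly_hom.hom_minus)
    have mem: "ev H \<in> A' \<longleftrightarrow> ?s H \<in> A" for H
    proof
      assume "ev H \<in> A'"
      then obtain H' where "ev H = ev H'" "?s H' \<in> A" by (auto simp: A'_def)
      then show "?s H \<in> A" using wd[of H H'] by simp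
    qed (auto simp: A'_def)
    have "valring A'"
    proof
      fix a b assume "a \<in> A'" "b \<in> A'"
      then obtain G H where GH: "a = ev G" "b = ev H" "?s G \<in> A" "?s H \<in> A" by (auto simp: A'_def)
      show "a + b \<in> A'" "a - b \<in> A'" "a * b \<in> A'"
        using GH A.add A.diff A.mult
        by (auto simp: mem map_poly_hom.hom_add map_poly_hom.hom_minus map_poly_hom.hom_mult simp flip: ev_add ev_diff ev_mult)
    next
      show "1 \<in> A'" using mem[of 1] A.one by simp
    next
      fix z
      obtain G where G: "z = ev G" using surj by blast
      obtain H where H: "inverse z = ev H" using surj by blast
      show "z \<in> A' \<or> inverse z \<in> A'"
      proof (cases "z = 0")
        case True then show ?thesis using mem[of 0] A.zero by simp
      next
        case False
        then have "ev (G * H) = ev 1" by (simp add: ev_mult flip: G H)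
        then have "?s (G * H) = ?s 1" by (rule wd)
        then have "?s H = inverse (?s G)"
          by (simp add: map_poly_hom.hom_mult inverse_unique)
        moreover have "z \<in> A' \<longleftrightarrow> ?s G \<in> A" using mem[of G] by (simp add: G)
        moreover have "inverse z \<in> A' \<longleftrightarrow> ?s H \<in> A" using mem[of H] by (simp add: H)
        ultimately show ?thesis using A.total[of "?s G"] by simp
      qed
    qed
    moreover have "{f. \<iota> f \<in> A'} = R" proof -
      have "\<iota> f \<in> A' \<longleftrightarrow> \<iota> f \<in> A" for f using mem[of "[:f:]"] by (simp add: poly_altdef)
      then show ?thesis using AR by simp
    qed
    ultimately have "ev G \<in> A'" by (rule G(2))
    then show ?thesis by (simp add: mem)
  qed
  have inj: "inj_on (\<lambda>x. y + \<iota> x) W" by (auto simp: inj_on_def)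
  have "coeff (map_poly \<iota> G) i \<in> A"
  proof (rule A.coeffs_mem_of_values[of "(\<lambda>x. y + \<iota> x) ` W"])
    show "finite ((\<lambda>x. y + \<iota> x) ` W)" using W by simp
    show "degree (map_poly \<iota> G) < card ((\<lambda>x. y + \<iota> x) ` W)" using G(1) by (simp add: card_image[OF inj])
    show "(\<lambda>x. y + \<iota> x) ` W \<subseteq> A" using yint[OF A(1) AR] A W(2) by (auto intro!: A.add)
    show "poly (map_poly \<iota> G) x \<in> A" if "x \<in> (\<lambda>x. y + \<iota> x) ` W" for x using that val by auto
    fix a b assume "a \<in> (\<lambda>x. y + \<iota> x) ` W" "b \<in> (\<lambda>x. y + \<iota> x) ` W" "a \<noteq> b"
    then obtain x x' where xx: "x \<in> W" "x' \<in> W" "x \<noteq> x'" "a - b = \<iota> (x - x')" by (auto simp: hom_minus)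
    then have "x - x' \<in> R" "inverse (x - x') \<in> R" "x - x' \<noteq> 0" using W(3)[OF xx(1-3)] by (auto simp: ring_unit_def)
    then show "ring_unit A (a - b)" unfolding xx(4) using A(2) by (auto simp: ring_unit_def simp flip: hom_inverse)
  qed
  then show ?thesis using AR by auto
qed

end

section \<open>Linearized function fields\<close>

text \<open>The linearized polynomial enters through its degree \<open>N\<close> and through the set \<open>W0\<close> of its roots,
  as translations by roots do not change the values of \<open>L\<close>.\<close>

locale linearized_function_field = field_extension \<iota> y
  for \<iota> :: "'a::{finite,field} poly fract \<Rightarrow> 'f::field" and y :: 'f +
  fixes N r n :: nat and L :: "'a poly" and W0 :: "'a set" and h :: "'a poly fract"
    and P :: "nat \<Rightarrow> 'a poly fract set" and Q :: "nat \<Rightarrow> 'f set" and lam :: "nat \<Rightarrow> nat"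
  assumes N: "N > 1" "degree L = N"
    and roots: "card W0 = N" "\<And>w x. w \<in> W0 \<Longrightarrow>
        poly (map_poly (\<iota> \<circ> const_fract) L) (x + \<iota> (const_fract w)) = poly (map_poly (\<iota> \<circ> const_fract) L) x"
    and h0: "h \<noteq> 0"
    and P: "\<And>k. k \<in> {1..r} \<Longrightarrow> place const_fract (P k)" "inj_on P {1..r}"
    and lam: "\<And>k. k \<in> {1..r} \<Longrightarrow> coprime N (lam k) \<and> lam k > 0"
    and hP: "\<And>k. k \<in> {1..r} \<Longrightarrow> place_val (P k) h = - int (lam k)"
    and hR: "\<And>R. place const_fract R \<Longrightarrow> R \<notin> P ` {1..r} \<Longrightarrow> place_val R h \<ge> 0"
    and eq: "poly (map_poly (\<iota> \<circ> const_fract) L) y = \<iota> h"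
    and gen: "generated_subfield (insert y (range \<iota>)) = UNIV"
    and Q: "\<And>k. k \<in> {1..r} \<Longrightarrow> place (\<iota> \<circ> const_fract) (Q k) \<and> lies_over \<iota> (Q k) (P k)"
    and Qdeg: "\<And>k. k \<in> {1..n} \<Longrightarrow> place_degree (\<iota> \<circ> const_fract) (Q k) = 1"
    and n: "2 \<le> n" "n \<le> r" "n \<le> card (UNIV :: 'a set)"
begin

interpretation map_poly_hom: map_poly_inj_idom_hom \<iota> ..

abbreviation \<kappa> :: "'a \<Rightarrow> 'f" where "\<kappa> \<equiv> \<iota> \<circ> const_fract"

lemma \<kappa>_hom: "\<kappa> 0 = 0" "\<kappa> 1 = 1" "\<kappa> (a - b) = \<kappa> a - \<kappa> b" "\<kappa> (inverse a) = inverse (\<kappa> a)" "\<kappa> a = 0 \<longleftrightarrow> a = 0"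
  by (simp_all add: const_fract_hom const_fract_inverse hom_minus hom_inverse)

lemma coeff_map_\<kappa>: "coeff (map_poly \<kappa> p) i = \<kappa> (coeff p i)"
  by (rule coeff_map_poly) (simp add: const_fract_hom)

subsection \<open>The extension\<close>

definition defining_poly :: "'a poly fract poly" where "defining_poly = map_poly const_fract L - [:h:]"

lemma degree_defining_poly: "degree defining_poly = N"
proof -
  have "degree (map_poly const_fract L) = degree L"
    by (rule degree_map_poly) (simp add: const_fract_hom)
  then have "degree (map_poly const_fract L + [:- h:]) = N"
    using N by (subst degree_add_eq_left) auto
  moreover have "defining_poly = map_poly const_fract L + [:- h:]" by (simp add: defining_poly_def)
  ultimately show ?thesis by simp
qed

lemma map_poly_\<kappa>: "map_poly \<iota> (map_poly const_fract L) = map_poly \<kappa> L"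
  by (rule map_poly_map_poly) (simp_all add: const_fract_hom)

lemma poly_defining_poly: "poly (map_poly \<iota> defining_poly) x = poly (map_poly \<kappa> L) x - \<iota> h"
proof -
  have "map_poly \<iota> [:h:] = [:\<iota> h:]" by (rule poly_eqI) (simp add: coeff_pCons split: nat.splits)
  then show ?thesis by (simp add: defining_poly_def map_poly_hom.hom_minus map_poly_\<kappa>)
qed

lemma ev_defining_poly: "ev defining_poly = 0"
  unfolding ev_def poly_defining_poly using eq by simp

definition reduced :: "'a poly fract poly \<Rightarrow> bool" where
  "reduced G \<longleftrightarrow> (\<forall>i. coeff G i \<noteq> 0 \<longrightarrow> i < N)"

lemma reduced_degree: "reduced G \<longleftrightarrow> degree G < N"
proof
  assume "reduced G"
  then show "degree G < N" unfolding reduced_def using N by (metis degree_0 leading_coeff_0_iff neq0_conv not_one_less_zero)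
next
  assume "degree G < N"
  then show "reduced G" unfolding reduced_def by (meson le_degree le_less_trans)
qed

lemma ev_surj: "\<exists>G. reduced G \<and> z = ev G"
  using ev_reduced[OF _ ev_defining_poly gen, of z] degree_defining_poly N reduced_degree by auto

text \<open>At a pole of \<open>y\<close> the leading term of \<open>L(y)\<close> dominates, so that \<open>h\<close> has the value of \<open>y\<^sup>N\<close>.\<close>

lemma y_notin_unit:
  assumes A: "valring A" "range \<kappa> \<subseteq> A" and y: "y \<notin> A"
  shows "ring_unit A (\<iota> h / y ^ N)"
proof -
  interpret valring A by fact
  have "degree (map_poly \<kappa> L) = degree L"
    by (rule degree_map_poly) (simp add: const_fract_hom)
  then have "degree (map_poly \<kappa> L) = N" using N by simp
  moreover have "lead_coeff L \<noteq> 0" using N by auto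
  then have "ring_unit A (\<kappa> (lead_coeff L))"
    using A(2) \<kappa>_hom(4)[of "lead_coeff L"] unfolding ring_unit_def by (metis \<kappa>_hom(5) rangeI subsetD)
  moreover have "coeff (map_poly \<kappa> L) i \<in> A" for i
    using A(2) unfolding coeff_map_\<kappa> by blast
  ultimately show ?thesis
    using poly_over_lead_power_unit[of "map_poly \<kappa> L" y] y eq N by (simp add: coeff_map_\<kappa>)
qed

lemma y_integral:
  assumes A: "valring A" "range \<kappa> \<subseteq> A" and h: "\<iota> h \<in> A" shows "y \<in> A"
proof (rule ccontr)
  interpret valring A by fact
  assume y: "y \<notin> A"
  have "inverse y ^ N \<in> nonunits A" using N by (intro nonunit_power inverse_nonunit y) auto
  then have "inverse y ^ N * \<iota> h \<in> nonunits A" using h by (rule nonunits_mult)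
  then show False using y_notin_unit[OF A y]
    by (simp add: ring_unit_iff divide_inverse power_inverse mult.commute)
qed

text \<open>A valuation ring of \<open>F\<close> that contains \<open>K(x)\<close> would contain \<open>y\<close>, which is integral over \<open>K(x)\<close>,
  and thus be all of \<open>F\<close>.  Hence the places of \<open>F\<close> restrict to places of \<open>K(x)\<close>.\<close>

lemma below_valuation_ring:
  assumes A: "valring A" "range \<kappa> \<subseteq> A" "A \<noteq> UNIV"
  shows "valuation_ring const_fract {f. \<iota> f \<in> A}"
proof -
  interpret valring A by fact
  have "\<exists>f. \<iota> f \<notin> A"
  proof (rule ccontr)
    assume "\<not> ?thesis"
    then have all: "\<iota> f \<in> A" for f by auto
    then have "y \<in> A" using y_integral[OF A(1,2)] by simp
    then have "ev G \<in> A" for G unfolding ev_def using all by (intro poly_mem) auto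
    then show False using A(3) ev_surj by (metis UNIV_eq_I)
  qed
  moreover have "range const_fract \<subset> {f. \<iota> f \<in> A}"
  proof -
    have nX: "X_fract \<noteq> const_fract c" "inverse X_fract \<noteq> const_fract c" for c :: 'a
    proof -
      show *: "X_fract \<noteq> const_fract c" for c :: 'a by (simp add: const_fract_def)
      show "inverse X_fract \<noteq> const_fract c"
        using *[of "inverse c"] by (metis const_fract_inverse inverse_inverse_eq)
    qed
    have "range const_fract \<subseteq> {f. \<iota> f \<in> A}" using A(2) by auto
    moreover have "range const_fract \<noteq> {f. \<iota> f \<in> A}"
      using total[of "\<iota> X_fract"] nX unfolding set_eq_iff by (auto simp: hom_inverse image_iff) (metis hom_inverse)+
    ultimately show ?thesis by blast
  qed
  moreover have "f \<in> {f. \<iota> f \<in> A} \<or> inverse f \<in> {f. \<iota> f \<in> A}" for f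
    using total[of "\<iota> f"] by (simp add: hom_inverse)
  ultimately show ?thesis unfolding valuation_ring_def
    by (auto simp: hom_add hom_minus hom_mult intro: add diff mult)
qed

lemma place_F:
  assumes "place \<kappa> Q'"
  shows "valring (place_ring Q')" "range \<kappa> \<subseteq> place_ring Q'" "place_ring Q' \<noteq> UNIV" "nonunits (place_ring Q') = Q'"
  using place_ringD[OF _ assms] unfolding \<kappa>_hom valuation_ring_def by auto

definition place_below :: "'f set \<Rightarrow> 'a poly fract set" where
  "place_below Q' = nonunits {f. \<iota> f \<in> place_ring Q'}"

lemma below_place:
  assumes "place \<kappa> Q'"
  shows "place const_fract (place_below Q')" "place_ring (place_below Q') = {f. \<iota> f \<in> place_ring Q'}"
proof -
  have v: "valuation_ring const_fract {f. \<iota> f \<in> place_ring Q'}"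
    using below_valuation_ring place_F[OF assms] by blast
  then show "place const_fract (place_below Q')" unfolding place_below_def by (intro place_nonunits) (simp_all add: const_fract_hom)
  show "place_ring (place_below Q') = {f. \<iota> f \<in> place_ring Q'}"
    unfolding place_below_def using valuation_ring_valring[OF v] by (intro place_ring_nonunits) (simp add: const_fract_hom)
qed

lemma fract_valring: "place const_fract R \<Longrightarrow> valring (place_ring R) \<and> nonunits (place_ring R) = R"
  using place_ringD[of const_fract R] by (simp add: const_fract_hom)

text \<open>If some \<open>z\<close> in the ring of \<open>R\<close> had a pole at \<open>S\<close>, then for a prime element \<open>t\<close> at \<open>R\<close> and large
  \<open>m\<close> the product \<open>t z\<^sup>m\<close> would be in \<open>R\<close> without vanishing at \<open>S\<close>.\<close>

lemma place_subset_eq: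
  assumes R: "place const_fract R" and S: "place const_fract S" and sub: "R \<subseteq> S"
  shows "S = R"
proof -
  interpret R: valring "place_ring R" using fract_valring[OF R] by simp
  interpret S: valring "place_ring S" using fract_valring[OF S] by simp
  note nR = fract_valring[OF R, THEN conjunct2] and nS = fract_valring[OF S, THEN conjunct2]
  note dR = place_val_fract_disc_val[OF R] and dS = place_val_fract_disc_val[OF S]
  obtain t where t: "t \<noteq> 0" "place_val R t = 1" using dR by (auto simp: disc_val_def)
  have "place_ring R \<subseteq> place_ring S"
  proof
    fix z assume z: "z \<in> place_ring R"
    show "z \<in> place_ring S"
    proof (rule ccontr)
      assume "z \<notin> place_ring S"
      then have neg: "z \<noteq> 0" "place_val S z < 0" using disc_val_mem[OF dS, of z] by auto
      define m where "m = nat (place_val S t)"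
      have "t * z ^ m \<in> nonunits (place_ring R)"
        using t z by (intro R.nonunits_mult R.power) (auto simp: disc_val_nonunit[OF dR])
      then have "t * z ^ m \<in> nonunits (place_ring S)" using sub nR nS by auto
      then have "place_val S (t * z ^ m) > 0" using t neg by (simp add: disc_val_nonunit[OF dS])
      then have "place_val S t + int m * place_val S z > 0"
        using t neg by (simp add: disc_val_mult[OF dS] disc_val_power[OF dS])
      moreover have "int m * place_val S z \<le> int m * (-1)" using neg by (intro mult_left_mono) auto
      moreover have "int m \<ge> place_val S t" by (simp add: m_def)
      ultimately show False by simp
    qed
  qed
  moreover have "nonunits (place_ring R) \<subseteq> nonunits (place_ring S)" using sub by (simp only: nR nS)
  ultimately have "place_ring S = place_ring R"
    by (rule valuation_ring_eqI[OF R.valring_axioms S.valring_axioms])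
  then show ?thesis using nR nS by metis
qed

lemma below_eq_iff:
  assumes Q': "place \<kappa> Q'" and R: "place const_fract R"
  shows "place_below Q' = R \<longleftrightarrow> lies_over \<iota> Q' R"
proof
  assume "place_below Q' = R"
  then show "lies_over \<iota> Q' R" using place_F(4)[OF Q'] unfolding place_below_def lies_over_def
    by (auto simp: nonunits_def hom_inverse)
next
  assume l: "lies_over \<iota> Q' R"
  have "R \<subseteq> place_below Q'"
  proof
    fix f assume "f \<in> R"
    then have "\<iota> f \<in> nonunits (place_ring Q')" using l place_F(4)[OF Q'] by (auto simp: lies_over_def)
    then show "f \<in> place_below Q'" by (auto simp: place_below_def nonunits_def hom_inverse)
  qed
  then show "place_below Q' = R" by (rule place_subset_eq[OF R below_place(1)[OF Q']])
qed

text \<open>The value of \<open>f y\<^sup>i\<close> at the place above \<open>P k\<close>.\<close>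

definition term_val :: "nat \<Rightarrow> nat \<Rightarrow> 'a poly fract \<Rightarrow> int" where
  "term_val k i f = int N * place_val (P k) f - int i * int (lam k)"

lemma val_above_pole:
  assumes k: "k \<in> {1..r}" and Q': "place \<kappa> Q'" "place_below Q' = P k"
  shows "disc_val (place_ring Q') (place_val Q')"
    "\<And>G. reduced G \<Longrightarrow> G \<noteq> 0 \<Longrightarrow> ev G \<noteq> 0 \<and>
        place_val Q' (ev G) = Min ((\<lambda>i. term_val k i (coeff G i)) ` {i. coeff G i \<noteq> 0})"
proof -
  let ?A = "place_ring Q'" and ?v = "place_val (P k)"
  interpret A: valring ?A using place_F[OF Q'(1)] by simp
  have eqA: "{f. \<iota> f \<in> ?A} = place_ring (P k)" using below_place(2)[OF Q'(1)] Q'(2) by simp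
  have dv: "disc_val {f. \<iota> f \<in> ?A} ?v" unfolding eqA by (rule place_val_fract_disc_val[OF P(1)[OF k]])
  have "\<not> ?v h \<ge> 0" using hP[OF k] lam[OF k] by simp
  then have hn: "\<iota> h \<notin> ?A" using disc_val_mem[OF dv, of h] h0 by simp
  have "y \<notin> ?A"
  proof
    assume "y \<in> ?A"
    then have "poly (map_poly \<kappa> L) y \<in> ?A"
      using place_F(2)[OF Q'(1)] \<open>y \<in> ?A\<close> by (intro A.poly_mem) (auto simp only: coeff_map_\<kappa>)
    then show False using hn eq by simp
  qed
  then have "ring_unit ?A (\<iota> h / y ^ N)" using y_notin_unit A.valring_axioms place_F[OF Q'(1)] by blast
  then have u: "ring_unit ?A (y ^ N / \<iota> h)" using A.unit_inverse by fastforce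
  have s: "\<exists>G. (\<forall>i. coeff G i \<noteq> 0 \<longrightarrow> i < N) \<and> z = ev G" for z using ev_surj[of z] by (simp add: reduced_def)
  have N0: "N > 0" and cop: "coprime N (lam k)" using N lam[OF k] by auto
  obtain V where V: "disc_val ?A V"
    "\<And>G. G \<noteq> 0 \<Longrightarrow> (\<And>i. coeff G i \<noteq> 0 \<Longrightarrow> i < N) \<Longrightarrow>
       ev G \<noteq> 0 \<and> V (ev G) = Min ((\<lambda>i. int N * ?v (coeff G i) - int i * int (lam k)) ` {i. coeff G i \<noteq> 0})"
    by (rule totally_ramified_disc_val[OF A.valring_axioms dv N0 cop h0 hP[OF k] u s]) blast
  have pv: "place_val Q' z = V z" if "z \<noteq> 0" for z
    using place_val_disc_val[OF \<kappa>_hom(2) Q'(1) V(1) that] .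
  then show "disc_val ?A (place_val Q')" by (rule disc_val_cong[OF V(1)])
  fix G assume G: "reduced G" "G \<noteq> 0"
  then show "ev G \<noteq> 0 \<and> place_val Q' (ev G) = Min ((\<lambda>i. term_val k i (coeff G i)) ` {i. coeff G i \<noteq> 0})"
    using V(2)[of G] pv by (auto simp: reduced_def term_val_def)
qed

lemma Q_below: "k \<in> {1..r} \<Longrightarrow> place \<kappa> (Q k) \<and> place_below (Q k) = P k"
  using Q[of k] P(1)[of k] below_eq_iff by blast

lemma ev_mem_above_pole:
  assumes k: "k \<in> {1..r}" and Q': "place \<kappa> Q'" "place_below Q' = P k" and G: "reduced G"
  shows "ev G \<in> place_ring Q' \<longleftrightarrow> (\<forall>i. coeff G i \<noteq> 0 \<longrightarrow> term_val k i (coeff G i) \<ge> 0)"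
proof (cases "G = 0")
  case True
  then show ?thesis using disc_val_mem[OF val_above_pole(1)[OF k Q']] by simp
next
  case False
  have "{i. coeff G i \<noteq> 0} \<noteq> {}" using False leading_coeff_0_iff by blast
  then show ?thesis using disc_val_mem[OF val_above_pole(1)[OF k Q']] val_above_pole(2)[OF k Q' G False]
      finite_coeff_support[of G] by (auto simp: Min_ge_iff)
qed

text \<open>The values at a place above a pole are given by a formula in which the place does not occur.\<close>

lemma place_above_pole_unique:
  assumes k: "k \<in> {1..r}" and Q': "place \<kappa> Q'" "place_below Q' = P k"
  shows "Q' = Q k"
proof -
  have "z \<in> place_ring Q' \<longleftrightarrow> z \<in> place_ring (Q k)" for z
    using ev_surj[of z] ev_mem_above_pole[OF k Q'] ev_mem_above_pole[OF k, of "Q k"] Q_below[OF k] by metis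
  then have "place_ring Q' = place_ring (Q k)" by auto
  then show ?thesis using place_F(4) Q' Q_below[OF k] by metis
qed

lemma Q_eq_iff: "k \<in> {1..r} \<Longrightarrow> l \<in> {1..r} \<Longrightarrow> Q k = Q l \<longleftrightarrow> k = l"
  using Q_below P(2) by (metis inj_onD)

text \<open>The values at \<open>Q 1\<close> show that \<open>1, y, \<dots>, y\<^sup>N\<^sup>-\<^sup>1\<close> are independent over \<open>K(x)\<close>, so the defining
  polynomial is the minimal polynomial of \<open>y\<close>.\<close>

lemma ev_eq_0:
  assumes "ev G = 0" shows "defining_poly dvd G"
proof -
  have one: "1 \<in> {1..r}" using n by simp
  have "G = G div defining_poly * defining_poly + G mod defining_poly" by (rule div_mult_mod_eq[symmetric])
  then have "ev (G mod defining_poly) = 0" using assms ev_defining_poly by (metis add_0_left ev_add ev_mult mult_zero_right)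
  moreover have "defining_poly \<noteq> 0" using degree_defining_poly N by auto
  then have "reduced (G mod defining_poly)"
    using degree_mod_less[of defining_poly G] degree_defining_poly N unfolding reduced_degree by auto
  ultimately have "G mod defining_poly = 0" using val_above_pole(2)[OF one] Q_below[OF one] by blast
  then show ?thesis by auto
qed

lemma shift:
  assumes "w \<in> W0" "ev G = 0" shows "poly (map_poly \<iota> G) (y + \<iota> (const_fract w)) = 0"
proof -
  obtain H where "G = defining_poly * H" using ev_eq_0[OF assms(2)] by (rule dvdE)
  moreover have "poly (map_poly \<iota> defining_poly) (y + \<iota> (const_fract w)) = 0"
    unfolding poly_defining_poly using roots(2)[OF assms(1)] eq by simp
  ultimately show ?thesis by (simp add: map_poly_hom.hom_mult)
qed

text \<open>In \<open>\<Sum>\<^sub>i z\<^sub>i y\<^sup>i\<close> the terms with \<open>i > 0\<close> have values that \<open>N\<close> does not divide;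
  in an integral element they are therefore nonunits, and the residue field at \<open>Q k\<close> is that at
  \<open>P k\<close>.\<close>

lemma P_degree:
  assumes k: "k \<in> {1..n}" shows "place_degree const_fract (P k) = 1"
proof -
  have kr: "k \<in> {1..r}" using k n by auto
  note Qk = Q_below[OF kr]
  obtain B where B: "residue_basis const_fract (P k) B" "place_degree const_fract (P k) = card B"
    using place_degree_fract[OF P(1)[OF kr]] .
  interpret A: valring "place_ring (Q k)" using place_F Qk by blast
  have mem: "\<iota> f \<in> place_ring (Q k) \<longleftrightarrow> f \<in> place_ring (P k)" for f using below_place(2)[of "Q k"] Qk by auto
  have QA: "nonunits (place_ring (Q k)) = Q k" using place_F(4)[of "Q k"] Qk by blast
  have PA: "nonunits (place_ring (P k)) = P k" using fract_valring[OF P(1)[OF kr]] by blast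
  have "\<iota> f \<in> nonunits (place_ring (Q k)) \<longleftrightarrow> f \<in> nonunits (place_ring (P k))" for f
    by (simp add: nonunits_def mem flip: hom_inverse)
  then have nmem: "\<iota> f \<in> Q k \<longleftrightarrow> f \<in> P k" for f unfolding QA PA .
  have inj: "inj_on \<iota> B" by (auto simp: inj_on_def)
  have s: "(\<Sum>b\<in>\<iota> ` B. \<kappa> (c b) * b) = \<iota> (\<Sum>b\<in>B. const_fract (c (\<iota> b)) * b)" for c
    by (simp add: sum.reindex[OF inj] hom_sum hom_mult)
  have "residue_basis \<kappa> (Q k) (\<iota> ` B)"
    unfolding residue_basis_def s nmem
  proof (intro conjI allI impI ballI[of "place_ring (Q k)"])
    show "\<iota> ` B \<subseteq> place_ring (Q k)" "finite (\<iota> ` B)" using B(1) mem by (auto simp: residue_basis_def)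
    show "\<forall>b\<in>\<iota> ` B. c b = 0" if "(\<Sum>b\<in>B. const_fract (c (\<iota> b)) * b) \<in> P k" for c
    proof -
      have "\<forall>b\<in>B. c (\<iota> b) = 0" using B(1) that unfolding residue_basis_def by (auto dest!: spec[of _ "\<lambda>b. c (\<iota> b)"])
      then show ?thesis by auto
    qed
    fix z assume z: "z \<in> place_ring (Q k)"
    obtain G where G: "reduced G" "z = ev G" using ev_surj by blast
    have G': "reduced (G - [:coeff G 0:])" using G(1) N by (auto simp: reduced_def coeff_pCons split: nat.splits)
    have tv: "term_val k i (coeff G i) \<ge> 0" if "coeff G i \<noteq> 0" for i
      using ev_mem_above_pole[OF kr _ _ G(1)] Qk z G(2) that by blast
    have ne: "term_val k i (coeff G i) > 0" if i: "coeff G i \<noteq> 0" "i \<noteq> 0" for i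
    proof -
      have "term_val k i (coeff G i) \<noteq> 0"
      proof
        assume "term_val k i (coeff G i) = 0"
        then have "int N * place_val (P k) (coeff G i) = int i * int (lam k)" by (simp add: term_val_def)
        then have "int N dvd int i * int (lam k)" by (metis dvd_triv_left)
        then have "N dvd i * lam k" by (metis int_dvd_int_iff of_nat_mult)
        then have "N dvd i" using lam[OF kr] by (simp add: coprime_dvd_mult_left_iff)
        moreover have "i < N" using G(1) i by (auto simp: reduced_def)
        ultimately show False using i(2) by (auto dest: dvd_imp_le)
      qed
      then show ?thesis using tv[OF i(1)] by simp
    qed
    have tail: "ev (G - [:coeff G 0:]) \<in> Q k"
    proof (cases "G - [:coeff G 0:] = 0")
      case True
      then show ?thesis using A.zero_nonunit[unfolded QA] by simp
    next
      case False
      let ?G = "G - [:coeff G 0:]"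
      have "{i. coeff ?G i \<noteq> 0} \<noteq> {}" using False leading_coeff_0_iff by blast
      moreover have "term_val k i (coeff ?G i) > 0" if "coeff ?G i \<noteq> 0" for i
        using ne[of i] that by (cases i) (auto simp: coeff_pCons)
      ultimately have "place_val (Q k) (ev ?G) > 0"
        using val_above_pole(2)[OF kr _ _ G' False] Qk finite_coeff_support[of ?G] by simp
      then show ?thesis
        using disc_val_nonunit[OF val_above_pole(1)[OF kr]] QA Qk by metis
    qed
    have z0: "z = \<iota> (coeff G 0) + ev (G - [:coeff G 0:])" using G by (simp add: ev_diff)
    have "\<iota> (coeff G 0) \<in> place_ring (Q k)"
    proof -
      have "\<iota> (coeff G 0) = z - ev (G - [:coeff G 0:])" using z0 by simp
      then show ?thesis using A.diff[OF z] tail A.nonunits_subset[unfolded QA] by simp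
    qed
    then obtain c where c: "coeff G 0 - (\<Sum>b\<in>B. const_fract (c b) * b) \<in> P k"
      using B(1) mem by (auto simp: residue_basis_def)
    have "z - \<iota> (\<Sum>b\<in>B. const_fract (c b) * b) = \<iota> (coeff G 0 - (\<Sum>b\<in>B. const_fract (c b) * b)) + ev (G - [:coeff G 0:])"
      by (subst z0) (simp add: hom_minus)
    also have "\<dots> \<in> Q k" using c tail by (intro A.nonunits_add[unfolded QA]) (simp_all add: nmem)
    finally have "z - \<iota> (\<Sum>b\<in>B. const_fract (c b) * b) \<in> Q k" .
    then show "\<exists>c. z - \<iota> (\<Sum>b\<in>B. const_fract (c (\<iota> b)) * b) \<in> Q k"
      by (intro exI[of _ "\<lambda>x. c (inv_into UNIV \<iota> x)"]) (simp add: inj_f)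
  qed
  then have "place_degree \<kappa> (Q k) = card (\<iota> ` B)"
    using place_degree_eq_card[of \<kappa> "Q k"] Qk \<kappa>_hom by blast
  then show ?thesis using B(2) Qdeg[OF k] by (simp add: card_image[OF inj])
qed

subsection \<open>Regular functions\<close>

text \<open>The function \<open>f y\<^sup>i\<close> is regular outside \<open>Q 1, \<dots>, Q n\<close>.\<close>

definition admissible :: "nat \<Rightarrow> 'a poly fract \<Rightarrow> bool" where
  "admissible i f \<longleftrightarrow> (\<forall>R. place const_fract R \<longrightarrow> R \<notin> P ` {1..r} \<longrightarrow> place_val R f \<ge> 0) \<and>
     (\<forall>k\<in>{n+1..r}. term_val k i f \<ge> 0)"

text \<open>Above the poles of \<open>h\<close> the terms of \<open>G(y)\<close> have distinct values, so that none of them is less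
  regular than their sum.  Above any other place \<open>R\<close> the functions \<open>1, y, \<dots>, y\<^sup>N\<^sup>-\<^sup>1\<close> form an integral
  basis, by interpolation along the translations \<open>y \<mapsto> y + w\<close> by roots \<open>w\<close> of \<open>L\<close>.\<close>

lemma regular_iff:
  assumes G: "reduced G"
  shows "ev G \<in> regular_outside \<kappa> (Q ` {1..n}) \<longleftrightarrow> (\<forall>i. coeff G i \<noteq> 0 \<longrightarrow> admissible i (coeff G i))"
proof
  assume reg: "ev G \<in> regular_outside \<kappa> (Q ` {1..n})"
  show "\<forall>i. coeff G i \<noteq> 0 \<longrightarrow> admissible i (coeff G i)"
    unfolding admissible_def
  proof (intro allI impI conjI ballI)
    fix i k assume i: "coeff G i \<noteq> 0" and k: "k \<in> {n+1..r}"
    then have kr: "k \<in> {1..r}" by auto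
    have "Q k \<noteq> Q l" if "l \<in> {1..n}" for l
      using Q_eq_iff[OF kr, of l] that k n by auto
    then have "Q k \<notin> Q ` {1..n}" by blast
    then have "ev G \<in> place_ring (Q k)" using reg Q_below[OF kr] by (auto simp: regular_outside_def)
    then show "term_val k i (coeff G i) \<ge> 0" using ev_mem_above_pole[OF kr _ _ G] Q_below[OF kr] i by blast
  next
    fix i R assume i: "coeff G i \<noteq> 0" and R: "place const_fract R" "R \<notin> P ` {1..r}"
    have cR: "range const_fract \<subseteq> place_ring R"
      using place_ringD(1)[of const_fract R] R by (auto simp: const_fract_hom valuation_ring_def)
    have above: "range \<kappa> \<subseteq> A \<and> y \<in> A \<and> ev G \<in> A" if A: "valring A" "{f. \<iota> f \<in> A} = place_ring R" for A
    proof -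
      have c: "range \<kappa> \<subseteq> A" using A(2) cR by auto
      have "h \<in> place_ring R" using hR[OF R] disc_val_mem[OF place_val_fract_disc_val[OF R(1)]] by simp
      then have yA: "y \<in> A" using A(2) by (intro y_integral[OF A(1) c]) auto
      have "A \<noteq> UNIV" using A(2) place_ringD(1)[of const_fract R] R by (auto simp: const_fract_hom valuation_ring_def)
      moreover have "range \<kappa> \<noteq> A"
      proof
        assume "range \<kappa> = A"
        moreover have "{f. \<iota> f \<in> range \<kappa>} = range const_fract" by auto
        ultimately have "range const_fract = place_ring R" using A(2) by simp
        then show False using place_ringD(1)[of const_fract R] R by (auto simp: const_fract_hom valuation_ring_def)
      qed
      ultimately have vr: "valuation_ring \<kappa> A"
        using A(1) c by (auto simp: valuation_ring_def valring_def)
      have prA: "place_ring (nonunits A) = A" by (rule place_ring_nonunits[OF A(1)])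
      have "place_below (nonunits A) = nonunits (place_ring R)" unfolding place_below_def prA A(2) ..
      then have "place_below (nonunits A) = R" using fract_valring[OF R(1)] by simp
      then have "nonunits A \<noteq> Q l" if "l \<in> {1..n}" for l
        using Q_below[of l] R(2) that n by auto
      then have "nonunits A \<notin> Q ` {1..n}" by blast
      moreover have "place \<kappa> (nonunits A)" using place_nonunits[OF \<kappa>_hom(2) vr] .
      ultimately have "ev G \<in> place_ring (nonunits A)" using reg by (auto simp: regular_outside_def)
      then show ?thesis using prA c yA by simp
    qed
    have vR: "valring (place_ring R)" using fract_valring[OF R(1)] by simp
    have inj: "inj_on const_fract W0" by (rule inj_onI) (simp add: const_fract_def)
    have cu: "ring_unit (place_ring R) (const_fract c)" if "c \<noteq> 0" for c
      using place_const_unit[OF _ R(1), of c] that by (simp add: const_fract_hom const_fract_inverse)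
    have "coeff G i \<in> place_ring R"
    proof (rule coeffs_integral[OF vR place_val_fract_disc_val[OF R(1)], of "const_fract ` W0"])
      have "finite W0" by (rule finite)
      then show "finite (const_fract ` W0)" by simp
      show "const_fract ` W0 \<subseteq> place_ring R" using cR by blast
      show "ring_unit (place_ring R) (x - x')" if "x \<in> const_fract ` W0" "x' \<in> const_fract ` W0" "x \<noteq> x'" for x x'
      proof -
        from that(1,2) obtain c c' where "x = const_fract c" "x' = const_fract c'" by auto
        then show ?thesis using cu[of "c - c'"] that(3) by (auto simp: const_fract_hom)
      qed
      show "poly (map_poly \<iota> G) (y + \<iota> x) = 0" if "x \<in> const_fract ` W0" "ev G = 0" for x G
        using shift that by auto
      show "\<exists>G. z = ev G" for z using ev_surj by blast
      show "degree G < card (const_fract ` W0)" using G roots(1) card_image[OF inj] reduced_degree by simp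
    qed (use above in auto)
    then show "place_val R (coeff G i) \<ge> 0"
      using disc_val_mem[OF place_val_fract_disc_val[OF R(1)]] i by simp
  qed
next
  assume ok: "\<forall>i. coeff G i \<noteq> 0 \<longrightarrow> admissible i (coeff G i)"
  show "ev G \<in> regular_outside \<kappa> (Q ` {1..n})"
    unfolding regular_outside_def
  proof (intro CollectI allI impI)
    fix Q' assume Q': "place \<kappa> Q' \<and> Q' \<notin> Q ` {1..n}"
    show "ev G \<in> place_ring Q'"
    proof (cases "place_below Q' \<in> P ` {1..r}")
      case True
      then obtain k where k: "k \<in> {1..r}" "place_below Q' = P k" by auto
      then have "Q' = Q k" using place_above_pole_unique Q' by blast
      then have "k \<in> {n+1..r}" using Q' k by auto
      then show ?thesis using ev_mem_above_pole[OF k(1) _ k(2) G] Q' ok by (auto simp: admissible_def)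
    next
      case False
      have Q'': "place \<kappa> Q'" using Q' by simp
      interpret A: valring "place_ring Q'" using place_F[OF Q''] by simp
      note bp = below_place[OF Q'']
      have mem: "\<iota> f \<in> place_ring Q'" if "f \<noteq> 0 \<Longrightarrow> place_val (place_below Q') f \<ge> 0" for f
        using that disc_val_mem[OF place_val_fract_disc_val[OF bp(1)], of f] bp(2) by auto
      have "\<iota> h \<in> place_ring Q'" using hR[OF bp(1) False] by (intro mem) simp
      then have "y \<in> place_ring Q'" using y_integral place_F[OF Q''] by blast
      moreover have "\<iota> (coeff G i) \<in> place_ring Q'" for i
        using ok bp(1) False by (intro mem) (auto simp: admissible_def)
      ultimately show ?thesis unfolding ev_def by (intro A.poly_mem) auto
    qed
  qed
qed

end

section \<open>Maximal elements of a union of residue classes\<close>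

text \<open>For each residue class \<open>i < N\<close>, consider the integer vectors \<open>N j + t(i)\<close> whose coordinate sum of
  \<open>j\<close> is at least \<open>b i\<close>.  The set \<open>H\<close> below consists of the componentwise maxima of such
  vectors.  As the classes are disjoint in every coordinate, each coordinate of an element of \<open>H\<close>
  determines the class it comes from.\<close>

locale class_semigroup =
  fixes n N :: nat and t :: "nat \<Rightarrow> nat \<Rightarrow> int" and b :: "nat \<Rightarrow> int"
  assumes n: "n \<ge> 2" and N: "N > 0"
    and t_bounds: "\<And>k i. k \<in> {1..n} \<Longrightarrow> 0 \<le> t k i \<and> t k i < int N"
    and t_inj: "\<And>k. k \<in> {1..n} \<Longrightarrow> inj_on (t k) {..<N}"
begin

definition class_vec :: "nat \<Rightarrow> (nat \<Rightarrow> int) \<Rightarrow> nat \<Rightarrow> int" where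
  "class_vec i j = (\<lambda>k\<in>{1..n}. int N * j k + t k i)"

definition level_sum :: "(nat \<Rightarrow> int) \<Rightarrow> int" where "level_sum j = (\<Sum>k=1..n. j k)"

text \<open>An extensional \<open>\<alpha>\<close> is a componentwise maximum of class vectors iff the following condition
  holds at every \<open>k\<close>.\<close>

definition touched :: "(nat \<Rightarrow> int) \<Rightarrow> nat \<Rightarrow> bool" where
  "touched \<alpha> k \<longleftrightarrow> (\<exists>i<N. \<exists>j. level_sum j \<ge> b i \<and> (\<forall>l\<in>{1..n}. class_vec i j l \<le> \<alpha> l) \<and> class_vec i j k = \<alpha> k)"

end

locale class_semigroup_elements = class_semigroup +
  fixes H :: "(nat \<Rightarrow> int) set"
  assumes H: "\<And>\<alpha>. \<alpha> \<in> H \<longleftrightarrow> \<alpha> \<in> extensional {1..n} \<and> (\<forall>k\<in>{1..n}. touched \<alpha> k)"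
begin

lemma vec_in: "k \<in> {1..n} \<Longrightarrow> class_vec i j k = int N * j k + t k i" by (simp add: class_vec_def)

lemma vec_extensional: "class_vec i j \<in> extensional {1..n}" by (simp add: class_vec_def)

lemma vec_class:
  assumes "k \<in> {1..n}" "i < N" "i' < N" "class_vec i j k = class_vec i' j' k" shows "i = i' \<and> j k = j' k"
proof -
  have e: "int N * j k + t k i = int N * j' k + t k i'" using assms by (simp add: vec_in)
  have "t k i = (int N * j k + t k i) mod int N" using t_bounds[OF assms(1), of i] by simp
  also have "\<dots> = t k i'" unfolding e using t_bounds[OF assms(1), of i'] by simp
  finally have "t k i = t k i'" .
  then show ?thesis using t_inj[OF assms(1)] assms e N by (auto dest: inj_onD)
qed

lemma vec_le: "k \<in> {1..n} \<Longrightarrow> class_vec i j k \<le> class_vec i j' k \<longleftrightarrow> j k \<le> j' k"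
  using N by (simp add: vec_in)

lemma vec_less: "k \<in> {1..n} \<Longrightarrow> class_vec i j k < class_vec i j' k \<longleftrightarrow> j k < j' k"
  using N by (simp add: vec_in)

lemma vec_mem: "i < N \<Longrightarrow> level_sum j \<ge> b i \<Longrightarrow> class_vec i j \<in> H"
  unfolding H touched_def using vec_extensional by blast

text \<open>Elements of \<open>\<nabla>\<^sub>J(\<alpha>)\<close> are maxima of class vectors, so that emptiness of \<open>\<nabla>\<^sub>J(\<alpha>)\<close> can be tested
  on single class vectors.\<close>

lemma nabla_witness:
  assumes "\<beta> \<in> nabla n H J \<alpha>" "k \<in> J" "J \<subseteq> {1..n}"
  obtains i j where "i < N" "level_sum j \<ge> b i" "class_vec i j k = \<alpha> k"
    "\<And>l. l \<in> {1..n} \<Longrightarrow> class_vec i j l \<le> \<alpha> l" "\<And>l. l \<in> {1..n} - J \<Longrightarrow> class_vec i j l < \<alpha> l"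
proof -
  have k: "k \<in> {1..n}" using assms by auto
  have "\<beta> \<in> H" and eq: "\<And>l. l \<in> J \<Longrightarrow> \<beta> l = \<alpha> l" and lt: "\<And>l. l \<in> {1..n} - J \<Longrightarrow> \<beta> l < \<alpha> l"
    using assms(1) by (auto simp: nabla_def)
  then have "touched \<beta> k" using k by (auto simp: H)
  then obtain i j where ij: "i < N" "level_sum j \<ge> b i" "class_vec i j k = \<beta> k"
    "\<And>l. l \<in> {1..n} \<Longrightarrow> class_vec i j l \<le> \<beta> l" unfolding touched_def by blast
  have le: "\<beta> l \<le> \<alpha> l" if "l \<in> {1..n}" for l using eq[of l] lt[of l] that by fastforce
  show ?thesis
  proof (rule that[OF ij(1,2)])
    show "class_vec i j k = \<alpha> k" using ij(3) eq assms(2) by simp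
    show "class_vec i j l \<le> \<alpha> l" if "l \<in> {1..n}" for l using ij(4)[OF that] le[OF that] by simp
    show "class_vec i j l < \<alpha> l" if "l \<in> {1..n} - J" for l using ij(4)[of l] lt[OF that] that by force
  qed
qed

lemma nabla_vec_mem:
  assumes "i < N" "level_sum j \<ge> b i" "\<And>l. l \<in> {1..n} \<Longrightarrow> class_vec i j l \<le> \<alpha> l"
  shows "class_vec i j \<in> nabla n H {l\<in>{1..n}. class_vec i j l = \<alpha> l} \<alpha>"
  unfolding nabla_def using vec_mem[OF assms(1,2)] assms(3) by (auto simp: order_less_le)

lemma nabla_class_witness:
  assumes "\<beta> \<in> nabla n H J (class_vec i j)" "i < N" "k \<in> J" "J \<subseteq> {1..n}"
  obtains j' where "level_sum j' \<ge> b i" "j' k = j k"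
    "\<And>l. l \<in> {1..n} \<Longrightarrow> j' l \<le> j l" "\<And>l. l \<in> {1..n} - J \<Longrightarrow> j' l < j l"
proof -
  obtain i' j' where ij: "i' < N" "level_sum j' \<ge> b i'" "class_vec i' j' k = class_vec i j k"
    "\<And>l. l \<in> {1..n} \<Longrightarrow> class_vec i' j' l \<le> class_vec i j l" "\<And>l. l \<in> {1..n} - J \<Longrightarrow> class_vec i' j' l < class_vec i j l"
    using nabla_witness[OF assms(1,3,4)] by metis
  have "k \<in> {1..n}" using assms by auto
  then have e: "i' = i" "j' k = j k" using vec_class[of k i' i j' j] ij assms by auto
  show ?thesis using that[of j'] ij e vec_le vec_less by auto
qed

lemma nabla_singleton_empty:
  "\<alpha> \<in> maximal_elements n H \<Longrightarrow> k \<in> {1..n} \<Longrightarrow> nabla n H {k} \<alpha> = {}"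
  by (auto simp: maximal_elements_def)

lemma level_sum_diff:
  assumes "J \<subseteq> {1..n}"
  shows "level_sum (\<lambda>k. if k \<in> J then j k else j k - 1) = level_sum j - (int n - int (card J))"
proof -
  have "(\<Sum>k=1..n. if k \<in> J then j k else j k - 1) = (\<Sum>k=1..n. j k) - (\<Sum>k=1..n. if k \<in> J then 0 else 1)"
    unfolding sum_subtractf[symmetric] by (intro sum.cong) auto
  also have "(\<Sum>k=1..n. if k \<in> J then 0 else 1) = (\<Sum>k\<in>{1..n} - J. (1 :: int))"
    by (intro sum.mono_neutral_cong_right) auto
  also have "\<dots> = int n - int (card J)"
    using assms card_mono[OF _ assms] by (simp add: card_Diff_subset finite_subset of_nat_diff)
  finally show ?thesis by (simp add: level_sum_def)
qed

text \<open>Lowering the coordinates outside \<open>J\<close> by \<open>N\<close> stays within the class and costs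
  \<open>n - |J|\<close> in the coordinate sum.\<close>

lemma lowered_in_nabla:
  assumes "i < N" "J \<subseteq> {1..n}" "level_sum j \<ge> b i + (int n - int (card J))"
  shows "class_vec i (\<lambda>k. if k \<in> J then j k else j k - 1) \<in> nabla n H J (class_vec i j)"
  unfolding nabla_def using assms N
  by (auto intro!: vec_mem simp: level_sum_diff vec_in subset_iff)

text \<open>A class vector below an absolute maximal \<open>\<alpha>\<close> that agrees with it in a nonempty set of coordinates
  must agree with it everywhere, and no coordinate of it can be lowered.  Conversely, an element of
  \<open>\<nabla>\<^sub>J(\<alpha>)\<close> would dominate a vector in the class of \<open>\<alpha>\<close> with smaller coordinate sum.\<close>

theorem absolute_maximal_iff:
  "\<alpha> \<in> absolute_maximal_elements n H \<longleftrightarrow> (\<exists>i<N. \<exists>j. level_sum j = b i \<and> \<alpha> = class_vec i j)"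
proof
  assume \<alpha>: "\<alpha> \<in> absolute_maximal_elements n H"
  then have max: "\<alpha> \<in> maximal_elements n H" and abs: "\<And>J. J \<subset> {1..n} \<Longrightarrow> card J \<ge> 2 \<Longrightarrow> nabla n H J \<alpha> = {}"
    by (auto simp: absolute_maximal_elements_def)
  have empty: "nabla n H J \<alpha> = {}" if J: "J \<subset> {1..n}" "J \<noteq> {}" for J
  proof (cases "card J \<ge> 2")
    case False
    have "finite J" using J finite_subset[of J "{1..n}"] by auto
    then have "card J = 1" using False J card_gt_0_iff[of J] by linarith
    then obtain k where "J = {k}" by (metis card_1_singletonE)
    then show ?thesis using nabla_singleton_empty[OF max, of k] J by auto
  qed (use abs J in auto)
  have \<alpha>H: "\<alpha> \<in> H" using max by (simp add: maximal_elements_def)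
  have one: "1 \<in> {1..n}" using n by simp
  then obtain i j where ij: "i < N" "level_sum j \<ge> b i" "\<And>l. l \<in> {1..n} \<Longrightarrow> class_vec i j l \<le> \<alpha> l" "class_vec i j 1 = \<alpha> 1"
    using \<alpha>H unfolding H touched_def by metis
  let ?J = "{l\<in>{1..n}. class_vec i j l = \<alpha> l}"
  have "?J \<noteq> {}" using one ij(4) by auto
  then have "?J = {1..n}" using empty[of ?J] nabla_vec_mem[OF ij(1,2), of \<alpha>] ij(3) by blast
  then have "\<alpha> l = class_vec i j l" if "l \<in> {1..n}" for l using that by (metis (mono_tags, lifting) mem_Collect_eq)
  then have eq: "\<alpha> = class_vec i j"
    using \<alpha>H vec_extensional[of i j] unfolding H by (intro extensionalityI[of _ "{1..n}"]) auto
  moreover have "level_sum j = b i"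
  proof (rule ccontr)
    assume "level_sum j \<noteq> b i"
    then have s: "level_sum j \<ge> b i + 1" using ij(2) by simp
    let ?J = "{2..n}"
    have "class_vec i (\<lambda>k. if k \<in> ?J then j k else j k - 1) \<in> nabla n H ?J (class_vec i j)"
      using s n by (intro lowered_in_nabla[OF ij(1)]) (auto simp: of_nat_diff)
    moreover have "?J \<subset> {1..n}" "?J \<noteq> {}" using n by auto
    ultimately show False using empty eq by blast
  qed
  ultimately show "\<exists>i<N. \<exists>j. level_sum j = b i \<and> \<alpha> = class_vec i j" using ij(1) by blast
next
  assume "\<exists>i<N. \<exists>j. level_sum j = b i \<and> \<alpha> = class_vec i j"
  then obtain i j where ij: "i < N" "level_sum j = b i" "\<alpha> = class_vec i j" by blast
  have empty: "nabla n H J \<alpha> = {}" if J: "J \<subset> {1..n}" "J \<noteq> {}" for J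
  proof (rule ccontr)
    assume "nabla n H J \<alpha> \<noteq> {}"
    then obtain \<beta> k where "\<beta> \<in> nabla n H J (class_vec i j)" "k \<in> J" using ij J by auto
    then obtain j' where j': "level_sum j' \<ge> b i"
      "\<And>l. l \<in> {1..n} \<Longrightarrow> j' l \<le> j l" "\<And>l. l \<in> {1..n} - J \<Longrightarrow> j' l < j l"
      using nabla_class_witness[OF _ ij(1)] J by (metis psubset_imp_subset)
    obtain l where l: "l \<in> {1..n} - J" using J(1) by blast
    then have "level_sum j' < level_sum j"
      unfolding level_sum_def using j' by (intro sum_strict_mono_ex1) blast+
    then show False using j' ij by simp
  qed
  have "nabla n H {k} \<alpha> = {}" if "k \<in> {1..n}" for k
  proof (rule empty)
    have "card {k} \<noteq> card {1..n}" using n by simp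
    then have "{k} \<noteq> {1..n}" by metis
    then show "{k} \<subset> {1..n}" using that by auto
  qed simp
  moreover have "nabla n H J \<alpha> = {}" if "J \<subset> {1..n}" "card J \<ge> 2" for J
  proof (rule empty[OF that(1)])
    show "J \<noteq> {}" using that(2) by auto
  qed
  ultimately show "\<alpha> \<in> absolute_maximal_elements n H"
    using vec_mem[OF ij(1)] ij by (auto simp: absolute_maximal_elements_def maximal_elements_def)
qed

text \<open>For a relative maximal \<open>\<alpha>\<close>, a witness for \<open>J = {1, l}\<close> must agree with \<open>\<alpha>\<close> at \<open>l\<close> as well,
  since otherwise it would lie in \<open>\<nabla>\<^sub>1(\<alpha>)\<close>.  Hence all coordinates of \<open>\<alpha>\<close> belong to one class.
  Within the class, \<open>\<nabla>\<^sub>J(\<alpha>)\<close> is nonempty iff the coordinate sum exceeds \<open>b i\<close> by at least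
  \<open>n - |J|\<close>: this has to hold for \<open>|J| = 2\<close> and to fail for \<open>|J| = 1\<close>.\<close>

theorem relative_maximal_iff:
  "\<alpha> \<in> relative_maximal_elements n H \<longleftrightarrow> (\<exists>i<N. \<exists>j. level_sum j = b i + (int n - 2) \<and> \<alpha> = class_vec i j)"
proof
  assume \<alpha>: "\<alpha> \<in> relative_maximal_elements n H"
  then have max: "\<alpha> \<in> maximal_elements n H" and rel: "\<And>J. J \<subset> {1..n} \<Longrightarrow> card J \<ge> 2 \<Longrightarrow> nabla n H J \<alpha> \<noteq> {}"
    by (auto simp: relative_maximal_elements_def)
  have \<alpha>H: "\<alpha> \<in> H" using max by (simp add: maximal_elements_def)
  have one: "1 \<in> {1..n}" using n by simp
  have not1: False if "i < N" "level_sum j \<ge> b i" "\<And>l. l \<in> {1..n} \<Longrightarrow> class_vec i j l \<le> \<alpha> l" "class_vec i j 1 = \<alpha> 1"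
    "\<And>l. l \<in> {1..n} - {1} \<Longrightarrow> class_vec i j l < \<alpha> l" for i j
  proof -
    have "{l\<in>{1..n}. class_vec i j l = \<alpha> l} = {1}" using that(4,5) one by force
    then show False using nabla_vec_mem[OF that(1,2), of \<alpha>] that(3) nabla_singleton_empty[OF max one] by auto
  qed
  have pair: "\<exists>i j. i < N \<and> level_sum j \<ge> b i \<and> (\<forall>l\<in>{1..n}. class_vec i j l \<le> \<alpha> l) \<and>
      class_vec i j 1 = \<alpha> 1 \<and> class_vec i j k = \<alpha> k \<and> (\<forall>l\<in>{1..n} - {1, k}. class_vec i j l < \<alpha> l)"
    if k: "k \<in> {2..n}" for k
  proof -
    have "\<exists>i j. i < N \<and> level_sum j \<ge> b i \<and> (\<forall>l\<in>{1..n}. class_vec i j l \<le> \<alpha> l) \<and>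
        class_vec i j 1 = \<alpha> 1 \<and> (\<forall>l\<in>{1..n} - {1, k}. class_vec i j l < \<alpha> l)"
    proof (cases "n = 2")
      case True
      then have "{1..n} - {1, k} = {}" using k by auto
      then show ?thesis using \<alpha>H one unfolding H touched_def by (metis empty_iff)
    next
      case False
      have c: "card {1, k} = 2" using k by auto
      have "{1, k} \<subset> {1..n}"
      proof -
        have "card {1, k} \<noteq> card {1..n}" using False c by simp
        then have "{1, k} \<noteq> {1..n}" by metis
        then show ?thesis using k one by (intro psubsetI) auto
      qed
      then obtain \<beta> where "\<beta> \<in> nabla n H {1, k} \<alpha>" using rel[of "{1, k}"] c by auto
      moreover have "1 \<in> {1, k}" "{1, k} \<subseteq> {1..n}" using k by auto
      ultimately obtain i j where "i < N" "level_sum j \<ge> b i" "class_vec i j 1 = \<alpha> 1"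
          "\<And>l. l \<in> {1..n} \<Longrightarrow> class_vec i j l \<le> \<alpha> l" "\<And>l. l \<in> {1..n} - {1, k} \<Longrightarrow> class_vec i j l < \<alpha> l"
        by (rule nabla_witness) blast
      then show ?thesis by blast
    qed
    then obtain i j where ij: "i < N" "level_sum j \<ge> b i" "\<forall>l\<in>{1..n}. class_vec i j l \<le> \<alpha> l"
        "class_vec i j 1 = \<alpha> 1" "\<forall>l\<in>{1..n} - {1, k}. class_vec i j l < \<alpha> l" by blast
    have "class_vec i j k = \<alpha> k"
    proof (rule ccontr)
      assume "class_vec i j k \<noteq> \<alpha> k"
      moreover have "k \<in> {1..n}" using k by auto
      ultimately have "class_vec i j k < \<alpha> k" using ij(3) by (simp add: order_less_le)
      then have "class_vec i j l < \<alpha> l" if "l \<in> {1..n} - {1}" for l using ij(5) that by (cases "l = k") auto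
      then show False using not1[OF ij(1,2)] ij(3,4) by blast
    qed
    then show ?thesis using ij by blast
  qed
  have "2 \<in> {2..n}" using n by simp
  from pair[OF this] obtain i j2 where i: "i < N" "level_sum j2 \<ge> b i" "class_vec i j2 1 = \<alpha> 1" "class_vec i j2 2 = \<alpha> 2"
      "\<forall>l\<in>{1..n} - {1, 2}. class_vec i j2 l < \<alpha> l" by blast
  have same: "\<exists>x. \<alpha> k = int N * x + t k i" if k: "k \<in> {1..n}" for k
  proof (cases "k = 1")
    case True
    then show ?thesis using i(3) one vec_in[of 1 i j2] by metis
  next
    case False
    then have "k \<in> {2..n}" using k by auto
    from pair[OF this] obtain i' j' where ij': "i' < N" "class_vec i' j' 1 = \<alpha> 1" "class_vec i' j' k = \<alpha> k" by blast
    then have "i' = i" using vec_class[OF one ij'(1) i(1), of j' j2] i(3) by metis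
    then show ?thesis using ij'(3) vec_in[OF k] by metis
  qed
  then obtain j where j: "\<And>k. k \<in> {1..n} \<Longrightarrow> \<alpha> k = int N * j k + t k i" by metis
  then have eq: "\<alpha> = class_vec i j"
    using \<alpha>H vec_extensional[of i j] unfolding H by (intro extensionalityI[of _ "{1..n}"]) (auto simp: vec_in)
  have two: "2 \<in> {1..n}" using n by simp
  have "level_sum j2 \<le> level_sum (\<lambda>k. if k \<in> {1, 2} then j k else j k - 1)"
    unfolding level_sum_def
  proof (rule sum_mono)
    fix k assume k: "k \<in> {1..n}"
    show "j2 k \<le> (if k \<in> {1, 2} then j k else j k - 1)"
    proof (cases "k \<in> {1, 2}")
      case True
      then have "class_vec i j2 k = class_vec i j k" using i eq by auto
      then show ?thesis using vec_le[OF k, of i j2 j] True by auto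
    next
      case False
      then have "class_vec i j2 k < class_vec i j k" using i(5) k eq by auto
      then show ?thesis using vec_less[OF k] False by simp
    qed
  qed
  also have "\<dots> = level_sum j - (int n - 2)" using level_sum_diff[of "{1, 2}" j] one two by simp
  finally have lower: "level_sum j \<ge> b i + (int n - 2)" using i(2) by simp
  have "level_sum j < b i + (int n - 1)"
  proof (rule ccontr)
    assume "\<not> ?thesis"
    then have "class_vec i (\<lambda>k. if k \<in> {1} then j k else j k - 1) \<in> nabla n H {1} (class_vec i j)"
      using one by (intro lowered_in_nabla[OF i(1)]) auto
    then show False using nabla_singleton_empty[OF max one] eq by auto
  qed
  then have "level_sum j = b i + (int n - 2)" using lower by simp
  then show "\<exists>i<N. \<exists>j. level_sum j = b i + (int n - 2) \<and> \<alpha> = class_vec i j" using i(1) eq by blast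
next
  assume "\<exists>i<N. \<exists>j. level_sum j = b i + (int n - 2) \<and> \<alpha> = class_vec i j"
  then obtain i j where ij: "i < N" "level_sum j = b i + (int n - 2)" "\<alpha> = class_vec i j" by blast
  have "nabla n H {k} \<alpha> = {}" if k: "k \<in> {1..n}" for k
  proof (rule ccontr)
    assume "nabla n H {k} \<alpha> \<noteq> {}"
    then obtain \<beta> where "\<beta> \<in> nabla n H {k} (class_vec i j)" using ij by auto
    then obtain j' where j': "level_sum j' \<ge> b i" "j' k = j k" "\<And>l. l \<in> {1..n} - {k} \<Longrightarrow> j' l < j l"
      using nabla_class_witness[OF _ ij(1), of \<beta> "{k}" j k] k by (metis empty_subsetI insertI1 insert_subset)
    have "level_sum j' \<le> level_sum (\<lambda>l. if l \<in> {k} then j l else j l - 1)"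
      unfolding level_sum_def using j' by (intro sum_mono) force
    also have "\<dots> = level_sum j - (int n - 1)" using level_sum_diff[of "{k}" j] k by simp
    finally show False using j' ij by simp
  qed
  moreover have "nabla n H J \<alpha> \<noteq> {}" if "J \<subset> {1..n}" "card J \<ge> 2" for J
    using lowered_in_nabla[OF ij(1), of J j] that ij by auto
  moreover have "\<alpha> \<in> H" unfolding ij(3) using ij n by (intro vec_mem) auto
  ultimately show "\<alpha> \<in> relative_maximal_elements n H"
    by (auto simp: relative_maximal_elements_def maximal_elements_def)
qed

end

section \<open>The generalized Weierstrass semigroup\<close>

context linearized_function_field
begin

definition floor_part :: "nat \<Rightarrow> nat \<Rightarrow> int" where "floor_part k i = int ((i * lam k) div N)"

text \<open>The ceiling \<open>\<lceil>i \<lambda>\<^sub>k / N\<rceil>\<close> in integer arithmetic.\<close>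

definition ceil_part :: "nat \<Rightarrow> nat \<Rightarrow> int" where "ceil_part k i = - ((- int (i * lam k)) div int N)"

definition rem_part :: "nat \<Rightarrow> nat \<Rightarrow> int" where "rem_part k i = int ((i * lam k) mod N)"

text \<open>If \<open>f y\<^sup>i\<close> has pole orders \<open>N j\<^sub>k + t\<^sub>k(i)\<close> at \<open>Q 1, \<dots>, Q n\<close>, then \<open>f\<close> has the values
  \<open>\<lfloor>i \<lambda>\<^sub>k / N\<rfloor> - j\<^sub>k\<close> at \<open>P k\<close> for \<open>k \<le> n\<close>, and regularity of \<open>f y\<^sup>i\<close> asks for values at least
  \<open>\<lceil>i \<lambda>\<^sub>k / N\<rceil>\<close> for \<open>k > n\<close>.  As the divisor of \<open>f\<close> has degree zero, the sum of the \<open>j\<^sub>k\<close> is at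
  least the following number.\<close>

definition bound :: "nat \<Rightarrow> int" where
  "bound i = (\<Sum>k=1..n. floor_part k i) + (\<Sum>k=n+1..r. ceil_part k i * int (place_degree const_fract (P k)))"

lemma floor_rem: "int (i * lam k) = int N * floor_part k i + rem_part k i"
  unfolding floor_part_def rem_part_def by (metis mult_div_mod_eq of_nat_add of_nat_mult)

lemma ceil_le_iff: "ceil_part k i \<le> x \<longleftrightarrow> int (i * lam k) \<le> int N * x"
proof -
  let ?a = "int (i * lam k)" and ?N = "int N"
  define d where "d = (- ?a) div ?N"
  have N0: "?N > 0" using N by simp
  have "?N * d + (- ?a) mod ?N = - ?a" unfolding d_def by (rule mult_div_mod_eq)
  moreover have "0 \<le> (- ?a) mod ?N" "(- ?a) mod ?N < ?N" using N0 by auto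
  ultimately have d: "?N * d \<le> - ?a" "- ?a < ?N * (d + 1)" by (auto simp: algebra_simps)
  have "- d \<le> x \<longleftrightarrow> ?a \<le> ?N * x"
  proof
    assume "- d \<le> x"
    then have "?N * (- d) \<le> ?N * x" using N0 by (intro mult_left_mono) auto
    then show "?a \<le> ?N * x" using d(1) by simp
  next
    assume "?a \<le> ?N * x"
    then have "?N * (- x) < ?N * (d + 1)" using d(2) by simp
    then have "- x < d + 1" by (rule mult_less_cancel_left_pos[OF N0, THEN iffD1])
    then show "- d \<le> x" by simp
  qed
  then show ?thesis by (simp add: ceil_part_def d_def)
qed

lemma sum_split: "(\<Sum>k=1..r. g k) = (\<Sum>k=1..n. g k) + (\<Sum>k=n+1..r. g k)"
  using sum.ub_add_nat[of 1 n g "r - n"] n(2) by simp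

lemma term_val_eq: "- term_val k i f = int N * (floor_part k i - place_val (P k) f) + rem_part k i"
  using floor_rem[of i k] by (simp add: term_val_def algebra_simps)

sublocale cs: class_semigroup n N rem_part bound
proof
  show "2 \<le> n" "0 < N" using n N by auto
  show "0 \<le> rem_part k i \<and> rem_part k i < int N" for k i using N by (simp add: rem_part_def)
  show "inj_on (rem_part k) {..<N}" if k: "k \<in> {1..n}" for k
  proof (rule inj_onI)
    fix i i' assume i: "i \<in> {..<N}" "i' \<in> {..<N}" "rem_part k i = rem_part k i'"
    have kr: "k \<in> {1..r}" using k n by auto
    have "int (i * lam k) mod int N = int (i' * lam k) mod int N" using i(3) by (simp add: rem_part_def zmod_int)
    then have "int N dvd (int i - int i') * int (lam k)" by (simp add: mod_eq_dvd_iff left_diff_distrib)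
    then have "int N dvd int i - int i'" using lam[OF kr] by (simp add: coprime_dvd_mult_left_iff)
    moreover have "\<bar>int i - int i'\<bar> < int N" using i by auto
    ultimately show "i = i'" using dvd_imp_le_int[of "int i - int i'" "int N"] by force
  qed
qed

abbreviation "H \<equiv> weierstrass_semigroup \<kappa> n Q"

lemma sum_le_bound:
  assumes "f \<noteq> 0" "admissible i f"
  shows "(\<Sum>k=1..n. floor_part k i - place_val (P k) f) \<ge> bound i"
proof -
  let ?d = "\<lambda>R. int (place_degree const_fract R)"
  obtain S where S: "finite S" "\<And>R. R \<in> S \<Longrightarrow> place const_fract R"
    "\<And>R. place const_fract R \<Longrightarrow> R \<notin> S \<Longrightarrow> place_val R f = 0"
    using principal_of_degree_zero[OF assms(1)] by (auto simp: principal_of_degree_zero_def)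
  let ?T = "S \<union> P ` {1..r}"
  have "0 = (\<Sum>R\<in>?T. place_val R f * ?d R)"
    using S P(1) by (intro principal_sum_zero[OF principal_of_degree_zero[OF assms(1)], symmetric]) auto
  also have "?T = (S - P ` {1..r}) \<union> P ` {1..r}" by auto
  also have "(\<Sum>R\<in>(S - P ` {1..r}) \<union> P ` {1..r}. place_val R f * ?d R)
      = (\<Sum>R\<in>S - P ` {1..r}. place_val R f * ?d R) + (\<Sum>R\<in>P ` {1..r}. place_val R f * ?d R)"
    using S(1) by (intro sum.union_disjoint) auto
  also have "\<dots> \<ge> (\<Sum>R\<in>P ` {1..r}. place_val R f * ?d R)"
    using assms(2) S(2) by (auto simp: admissible_def intro!: sum_nonneg mult_nonneg_nonneg)
  also have "(\<Sum>R\<in>P ` {1..r}. place_val R f * ?d R) = (\<Sum>k=1..r. place_val (P k) f * ?d (P k))"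
    using P(2) by (simp add: sum.reindex)
  also have "\<dots> = (\<Sum>k=1..n. place_val (P k) f * ?d (P k)) + (\<Sum>k=n+1..r. place_val (P k) f * ?d (P k))"
    by (rule sum_split)
  also have "(\<Sum>k=1..n. place_val (P k) f * ?d (P k)) = (\<Sum>k=1..n. place_val (P k) f)"
    using P_degree by (intro sum.cong) auto
  finally have "(\<Sum>k=1..n. place_val (P k) f) + (\<Sum>k=n+1..r. place_val (P k) f * ?d (P k)) \<le> 0" .
  moreover have "(\<Sum>k=n+1..r. ceil_part k i * ?d (P k)) \<le> (\<Sum>k=n+1..r. place_val (P k) f * ?d (P k))"
    using assms(2) by (intro sum_mono mult_right_mono) (auto simp: admissible_def term_val_def ceil_le_iff)
  ultimately show ?thesis by (simp add: bound_def sum_subtractf)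
qed

text \<open>The surplus \<open>\<Sum>\<^sub>k j\<^sub>k - b(i)\<close> is compensated by a zero of that order at a rational place other than
  \<open>P 1, \<dots>, P n\<close>.  That place may be a \<open>P k\<close> with \<open>k > n\<close>, where a larger value does no harm.\<close>

lemma exists_coeff:
  assumes "cs.level_sum j \<ge> bound i"
  obtains f where "f \<noteq> 0" "admissible i f" "\<And>k. k \<in> {1..n} \<Longrightarrow> - term_val k i f = int N * j k + rem_part k i"
proof -
  let ?d = "\<lambda>R. int (place_degree const_fract R)"
  have "finite (P ` {1..n})" "card (P ` {1..n}) \<le> card (UNIV :: 'a set)"
    using n card_image_le[of "{1..n}" P] by auto
  then obtain R1 where R1: "place const_fract R1" "place_degree const_fract R1 = 1" "R1 \<notin> P ` {1..n}"
    by (rule exists_new_rational_place)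
  define D0 where "D0 k = (if k \<le> n then floor_part k i - j k else ceil_part k i)" for k
  define s where "s = cs.level_sum j - bound i"
  define D where "D R = (\<Sum>k=1..r. if R = P k then D0 k else 0) + (if R = R1 then s else 0)" for R
  let ?S = "insert R1 (P ` {1..r})"
  have DP: "(\<Sum>l=1..r. if P k = P l then D0 l else 0) = D0 k" if "k \<in> {1..r}" for k
  proof -
    have "(\<Sum>l=1..r. if P k = P l then D0 l else 0) = (\<Sum>l=1..r. if k = l then D0 l else 0)"
      using P(2) that by (intro sum.cong) (auto dest: inj_onD)
    then show ?thesis using that by simp
  qed
  have "(\<Sum>R\<in>?S. D R * ?d R)
      = (\<Sum>R\<in>?S. (\<Sum>k=1..r. if R = P k then D0 k else 0) * ?d R) + (\<Sum>R\<in>?S. (if R = R1 then s else 0) * ?d R)"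
    by (simp only: D_def distrib_right sum.distrib)
  also have "(\<Sum>R\<in>?S. (if R = R1 then s else 0) * ?d R) = (\<Sum>R\<in>?S. if R = R1 then s * ?d R else 0)"
    by (intro sum.cong) auto
  also have "\<dots> = s" using R1(2) by (subst sum.delta) auto
  also have "(\<Sum>R\<in>?S. (\<Sum>k=1..r. if R = P k then D0 k else 0) * ?d R)
      = (\<Sum>R\<in>P ` {1..r}. (\<Sum>k=1..r. if R = P k then D0 k else 0) * ?d R)"
    by (intro sum.mono_neutral_right) (auto intro!: sum.neutral)
  also have "\<dots> = (\<Sum>k=1..r. D0 k * ?d (P k))"
    using P(2) DP by (simp add: sum.reindex)
  also have "\<dots> = (\<Sum>k=1..n. D0 k * ?d (P k)) + (\<Sum>k=n+1..r. D0 k * ?d (P k))"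
    by (rule sum_split)
  also have "(\<Sum>k=1..n. D0 k * ?d (P k)) = (\<Sum>k=1..n. floor_part k i - j k)"
    using P_degree by (intro sum.cong) (auto simp: D0_def)
  also have "(\<Sum>k=n+1..r. D0 k * ?d (P k)) = (\<Sum>k=n+1..r. ceil_part k i * ?d (P k))"
    by (intro sum.cong) (auto simp: D0_def)
  finally have "(\<Sum>R\<in>?S. D R * ?d R) = 0"
    by (simp add: s_def bound_def cs.level_sum_def sum_subtractf)
  moreover have "finite ?S" "\<And>R. R \<in> ?S \<Longrightarrow> place const_fract R" using R1 P by auto
  ultimately obtain f where f: "f \<noteq> 0"
    "\<And>R. place const_fract R \<Longrightarrow> place_val R f = (if R \<in> ?S then D R else 0)"
    using exists_fract_with_divisor[of ?S D] by blast
  have s: "s \<ge> 0" using assms by (simp add: s_def)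
  have vP: "place_val (P k) f = D0 k + (if P k = R1 then s else 0)" if "k \<in> {1..r}" for k
    using f(2)[OF P(1)[OF that]] that DP[OF that] by (simp add: D_def)
  show ?thesis
  proof (rule that[OF f(1)])
    show "admissible i f" unfolding admissible_def
    proof (intro conjI allI impI ballI)
      fix R assume R: "place const_fract R" "R \<notin> P ` {1..r}"
      then have "D R \<ge> 0" using s unfolding D_def by (intro add_nonneg_nonneg sum_nonneg) auto
      then show "place_val R f \<ge> 0" using f(2)[OF R(1)] by simp
    next
      fix k assume k: "k \<in> {n+1..r}"
      then have "place_val (P k) f \<ge> ceil_part k i" using vP[of k] s by (auto simp: D0_def)
      then show "term_val k i f \<ge> 0" by (simp add: ceil_le_iff term_val_def)
    qed
    fix k assume k: "k \<in> {1..n}"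
    then have "place_val (P k) f = floor_part k i - j k" using vP[of k] R1(3) n by (auto simp: D0_def)
    then show "- term_val k i f = int N * j k + rem_part k i" unfolding term_val_eq by simp
  qed
qed

lemma pole_order_Max:
  assumes k: "k \<in> {1..n}" and G: "reduced G" "G \<noteq> 0"
  shows "- place_val (Q k) (ev G) = Max ((\<lambda>i. - term_val k i (coeff G i)) ` {i. coeff G i \<noteq> 0})"
proof -
  have kr: "k \<in> {1..r}" using k n by auto
  have ne: "{i. coeff G i \<noteq> 0} \<noteq> {}" using G(2) leading_coeff_0_iff by blast
  have "place_val (Q k) (ev G) = Min ((\<lambda>i. term_val k i (coeff G i)) ` {i. coeff G i \<noteq> 0})"
    using val_above_pole(2)[OF kr _ _ G] Q_below[OF kr] by blast
  also have "- \<dots> = Max (uminus ` ((\<lambda>i. term_val k i (coeff G i)) ` {i. coeff G i \<noteq> 0}))"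
    using ne finite_coeff_support[of G] by (intro minus_Min_eq_Max) auto
  finally show ?thesis by (simp add: image_image)
qed

text \<open>The pole orders of \<open>\<Sum>\<^sub>i z\<^sub>i y\<^sup>i\<close> are the componentwise maxima of those of its terms.  For the
  converse, take for each class the largest vector below \<open>\<alpha>\<close>; the classes for which its coordinate
  sum is large enough contribute a term each, and together these terms reach \<open>\<alpha>\<close> in every
  coordinate.\<close>

lemma semigroup_iff: "\<alpha> \<in> H \<longleftrightarrow> \<alpha> \<in> extensional {1..n} \<and> (\<forall>k\<in>{1..n}. cs.touched \<alpha> k)"
proof
  assume "\<alpha> \<in> H"
  then obtain z where z: "\<alpha> = (\<lambda>k\<in>{1..n}. - place_val (Q k) z)" "z \<in> regular_outside \<kappa> (Q ` {1..n})" "z \<noteq> 0"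
    by (auto simp: weierstrass_semigroup_def)
  obtain G where G: "reduced G" "z = ev G" using ev_surj by blast
  have G0: "G \<noteq> 0" using z(3) G(2) by auto
  have ok: "admissible i (coeff G i)" if "coeff G i \<noteq> 0" for i using regular_iff[OF G(1)] z(2) G(2) that by blast
  let ?S = "{i. coeff G i \<noteq> 0}"
  have ne: "?S \<noteq> {}" using G0 leading_coeff_0_iff by blast
  define j where "j i k = floor_part k i - place_val (P k) (coeff G i)" for i k
  have vj: "cs.class_vec i (j i) k = - term_val k i (coeff G i)" if "k \<in> {1..n}" for i k
    using that by (simp add: cs.class_vec_def j_def term_val_eq)
  have "cs.touched \<alpha> k" if k: "k \<in> {1..n}" for k
  proof -
    let ?m = "\<lambda>l. Max ((\<lambda>i. - term_val l i (coeff G i)) ` ?S)"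
    have \<alpha>: "\<alpha> l = ?m l" if "l \<in> {1..n}" for l
      using that pole_order_Max[OF that G(1) G0] z(1) G(2) by simp
    have "?m k \<in> (\<lambda>i. - term_val k i (coeff G i)) ` ?S" using ne finite_coeff_support by (intro Max_in) auto
    then obtain i where i: "coeff G i \<noteq> 0" "?m k = - term_val k i (coeff G i)" by auto
    show ?thesis unfolding cs.touched_def
    proof (intro exI conjI ballI)
      show "i < N" using G(1) i by (auto simp: reduced_def)
      show "cs.level_sum (j i) \<ge> bound i" using sum_le_bound[OF i(1) ok[OF i(1)]] by (simp add: cs.level_sum_def j_def)
      show "cs.class_vec i (j i) k = \<alpha> k" using vj[OF k] i(2) \<alpha>[OF k] by simp
      fix l assume l: "l \<in> {1..n}"
      have "- term_val l i (coeff G i) \<le> ?m l" using i(1) finite_coeff_support by (intro Max_ge) auto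
      then show "cs.class_vec i (j i) l \<le> \<alpha> l" using vj[OF l] \<alpha>[OF l] by simp
    qed
  qed
  then show "\<alpha> \<in> extensional {1..n} \<and> (\<forall>k\<in>{1..n}. cs.touched \<alpha> k)" using z(1) by auto
next
  assume \<alpha>: "\<alpha> \<in> extensional {1..n} \<and> (\<forall>k\<in>{1..n}. cs.touched \<alpha> k)"
  \<comment> \<open>the largest vector of class \<open>i\<close> below \<open>\<alpha>\<close>\<close>
  define J where "J i k = (\<alpha> k - rem_part k i) div int N" for i k
  define S where "S = {i. i < N \<and> cs.level_sum (J i) \<ge> bound i}"
  have Jle: "int N * J i k + rem_part k i \<le> \<alpha> k" for i k
  proof -
    have "int N * J i k + (\<alpha> k - rem_part k i) mod int N = \<alpha> k - rem_part k i"
      unfolding J_def by (rule mult_div_mod_eq)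
    moreover have "(\<alpha> k - rem_part k i) mod int N \<ge> 0" using N by simp
    ultimately show ?thesis by linarith
  qed
  have Jmax: "j k \<le> J i k" if "cs.class_vec i j k \<le> \<alpha> k" "k \<in> {1..n}" for i j k
  proof -
    have "int N * j k \<le> \<alpha> k - rem_part k i" using that by (simp add: cs.class_vec_def)
    then have "(int N * j k) div int N \<le> J i k" unfolding J_def using N by (intro zdiv_mono1) auto
    then show ?thesis using N by simp
  qed
  have touch: "\<exists>i\<in>S. int N * J i k + rem_part k i = \<alpha> k" if k: "k \<in> {1..n}" for k
  proof -
    obtain i j where ij: "i < N" "cs.level_sum j \<ge> bound i" "\<forall>l\<in>{1..n}. cs.class_vec i j l \<le> \<alpha> l" "cs.class_vec i j k = \<alpha> k"
      using \<alpha> k unfolding cs.touched_def by blast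
    have le: "j l \<le> J i l" if "l \<in> {1..n}" for l using Jmax ij(3) that by blast
    then have "cs.level_sum j \<le> cs.level_sum (J i)" unfolding cs.level_sum_def by (intro sum_mono) auto
    then have "i \<in> S" using ij by (simp add: S_def)
    moreover have "int N * j k \<le> int N * J i k" using le[OF k] by (simp add: mult_left_mono)
    then have "int N * J i k + rem_part k i = \<alpha> k" using ij(4) k Jle[of i k] by (simp add: cs.class_vec_def)
    ultimately show ?thesis by blast
  qed
  have "\<exists>f. f \<noteq> 0 \<and> admissible i f \<and> (\<forall>k\<in>{1..n}. - term_val k i f = int N * J i k + rem_part k i)" if "i \<in> S" for i
    using exists_coeff[of i "J i"] that by (metis (mono_tags, lifting) S_def mem_Collect_eq)
  then obtain f where f: "\<And>i. i \<in> S \<Longrightarrow> f i \<noteq> 0 \<and> admissible i (f i) \<and>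
      (\<forall>k\<in>{1..n}. - term_val k i (f i) = int N * J i k + rem_part k i)" by metis
  have finS: "finite S" by (simp add: S_def)
  define G where "G = (\<Sum>i\<in>S. monom (f i) i)"
  have cG: "coeff G i = (if i \<in> S then f i else 0)" for i
    using finS by (simp add: G_def coeff_sum if_distrib cong: if_cong)
  have supp: "{i. coeff G i \<noteq> 0} = S" using f by (auto simp: cG)
  have one: "1 \<in> {1..n}" using n by simp
  then have "S \<noteq> {}" using touch by blast
  then have G0: "G \<noteq> 0" using supp by auto
  have red: "reduced G" unfolding reduced_def using supp by (auto simp: S_def)
  have kr: "1 \<in> {1..r}" using n by simp
  have z0: "ev G \<noteq> 0" using val_above_pole(2)[OF kr _ _ red G0] Q_below[OF kr] by blast
  have "admissible i (coeff G i)" if "coeff G i \<noteq> 0" for i using that f by (auto simp: cG split: if_splits)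
  then have reg: "ev G \<in> regular_outside \<kappa> (Q ` {1..n})" using regular_iff[OF red] by blast
  have val: "- place_val (Q k) (ev G) = \<alpha> k" if k: "k \<in> {1..n}" for k
  proof -
    have t: "- term_val k i (coeff G i) = int N * J i k + rem_part k i" if "i \<in> S" for i
      using f[OF that] k that by (simp add: cG)
    obtain i where i: "i \<in> S" "int N * J i k + rem_part k i = \<alpha> k" using touch[OF k] by blast
    have "Max ((\<lambda>i. - term_val k i (coeff G i)) ` S) = \<alpha> k"
    proof (rule Max_eqI)
      show "finite ((\<lambda>i. - term_val k i (coeff G i)) ` S)" using finS by simp
      show "x \<le> \<alpha> k" if "x \<in> (\<lambda>i. - term_val k i (coeff G i)) ` S" for x
        using that t Jle by (metis (no_types, lifting) imageE)
      show "\<alpha> k \<in> (\<lambda>i. - term_val k i (coeff G i)) ` S" using i t[OF i(1)] by (metis (no_types, lifting) image_eqI)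
    qed
    then show ?thesis using pole_order_Max[OF k red G0] supp by simp
  qed
  then have "\<alpha> = (\<lambda>k\<in>{1..n}. - place_val (Q k) (ev G))"
    using \<alpha> by (intro extensionalityI[of _ "{1..n}"]) auto
  then show "\<alpha> \<in> H" unfolding weierstrass_semigroup_def using reg z0 by blast
qed

sublocale cs: class_semigroup_elements n N rem_part bound H
  by unfold_locales (rule semigroup_iff)

end

section \<open>Linearized polynomials\<close>

text \<open>By induction on the degree: a root of the cofactor \<open>g\<close> in \<open>p = (x - a) g\<close> is again simple, and
  differs from \<open>a\<close>.\<close>

lemma card_roots_separable:
  fixes p :: "'c::alg_closed_field poly"
  assumes "p \<noteq> 0" "\<And>z. poly p z = 0 \<Longrightarrow> poly (pderiv p) z \<noteq> 0"
  shows "card {z. poly p z = 0} = degree p"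
  using assms
proof (induction "degree p" arbitrary: p)
  case 0
  then obtain c where "p = [:c:]" by (metis degree_eq_zeroE)
  then show ?case using 0 by simp
next
  case (Suc d)
  obtain a where a: "poly p a = 0" using alg_closed_imp_poly_has_root[of p] Suc.hyps(2) by auto
  then obtain g where g: "p = [:- a, 1:] * g" by (metis dvdE poly_eq_0_iff_dvd)
  have g0: "g \<noteq> 0" using Suc.prems(1) g by auto
  have deriv: "poly (pderiv p) z = poly g z + (z - a) * poly (pderiv g) z" for z
  proof -
    have "pderiv p = [:- a, 1:] * pderiv g + g * pderiv [:- a, 1:]" unfolding g by (rule pderiv_mult)
    then show ?thesis
      by (simp only: poly_add poly_mult) (simp add: pderiv_pCons algebra_simps)
  qed
  have "degree p = degree [:- a, 1:] + degree g" unfolding g using g0 by (intro degree_mult_eq) auto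
  then have d: "degree p = Suc (degree g)" by simp
  have ga: "poly g a \<noteq> 0" using Suc.prems(2)[OF a] deriv[of a] by simp
  have "poly (pderiv g) z \<noteq> 0" if "poly g z = 0" for z
    using Suc.prems(2)[of z] deriv[of z] that by (auto simp: g)
  then have "card {z. poly g z = 0} = degree g" using Suc.hyps d g0 by simp
  moreover have "{z. poly p z = 0} = insert a {z. poly g z = 0}" by (auto simp: g)
  ultimately show ?case using ga poly_roots_finite[OF g0] d by simp
qed

text \<open>Translation by 1 permutes the field, so the sum of all elements does not change when \<open>|K|\<close> times 1
  is added.\<close>

lemma CHAR_finite_field:
  assumes "prime p" "card (UNIV :: 'a::{finite,field} set) = p ^ k"
  shows "of_nat p = (0 :: 'a)"
proof -
  have "(\<Sum>x\<in>(UNIV :: 'a set). x) = (\<Sum>x\<in>UNIV. x + 1)"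
    by (rule sum.reindex_bij_witness[of _ "\<lambda>x. x + 1" "\<lambda>x. x - 1"]) auto
  then have "of_nat (p ^ k) = (0 :: 'a)" using assms(2) by (simp add: sum.distrib)
  then show ?thesis by simp
qed

lemma CHAR_eq_prime:
  assumes "prime p" "of_nat p = (0 :: 'f::field)" shows "CHAR('f) = p"
proof -
  have "CHAR('f) dvd p" using assms(2) by (simp add: of_nat_eq_0_iff_char_dvd)
  then show ?thesis using assms(1) CHAR_not_1[where 'a='f] by (auto simp: prime_nat_iff)
qed

context
  fixes q m :: nat and a :: "nat \<Rightarrow> 'a::field" and L :: "'a poly"
  assumes q: "q > 1" and L: "L = (\<Sum>k\<le>m. Polynomial.monom (a k) (q ^ k))" and am: "a m \<noteq> 0" "a 0 \<noteq> 0"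
begin

lemma degree_linearized: "degree L = q ^ m"
proof (rule antisym)
  show "degree L \<le> q ^ m" unfolding L using q
    by (intro degree_sum_le) (auto intro: order_trans[OF degree_monom_le] power_increasing)
  have "coeff L (q ^ m) = (\<Sum>k\<le>m. if k = m then a k else 0)"
    unfolding L coeff_sum using q by (intro sum.cong) auto
  then show "q ^ m \<le> degree L" using am by (intro le_degree) simp
qed

lemma pderiv_linearized:
  assumes "of_nat q = (0 :: 'a)" shows "pderiv L = [:a 0:]"
proof -
  have pd: "pderiv (sum g S) = (\<Sum>k\<in>S. pderiv (g k))" for g :: "nat \<Rightarrow> 'a poly" and S
    by (induction S rule: infinite_finite_induct) (auto simp: pderiv_add)
  have "pderiv L = (\<Sum>k\<le>m. if k = 0 then [:a 0:] else 0)"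
    unfolding L pd using assms by (intro sum.cong) (auto simp: pderiv_monom monom_0)
  then show ?thesis by simp
qed

lemma poly_linearized:
  assumes "\<kappa> 0 = 0" "\<And>a b. \<kappa> (a + b) = \<kappa> a + \<kappa> b"
  shows "poly (map_poly \<kappa> L) (x :: 'f::field) = (\<Sum>k\<le>m. \<kappa> (a k) * x ^ (q ^ k))"
proof -
  have \<kappa>_sum: "\<kappa> (sum g S) = (\<Sum>k\<in>S. \<kappa> (g k))" for g :: "nat \<Rightarrow> 'a" and S
    by (induction S rule: infinite_finite_induct) (simp_all add: assms)
  have "map_poly \<kappa> L = (\<Sum>k\<le>m. Polynomial.monom (\<kappa> (a k)) (q ^ k))"
    unfolding L by (rule poly_eqI) (simp add: coeff_map_poly coeff_sum \<kappa>_sum assms(1) if_distrib cong: if_cong)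
  then show ?thesis by (simp add: poly_sum poly_monom)
qed

lemma linearized_additive:
  assumes \<kappa>: "\<kappa> 0 = 0" "\<And>a b. \<kappa> (a + b) = \<kappa> a + \<kappa> b"
    and "prime p" "q = p ^ e" "of_nat p = (0 :: 'f::field)"
  shows "poly (map_poly \<kappa> L) (x + z :: 'f) = poly (map_poly \<kappa> L) x + poly (map_poly \<kappa> L) z"
proof -
  have "CHAR('f) = p" using CHAR_eq_prime assms by blast
  then have "(x + z) ^ (q ^ k) = x ^ (q ^ k) + z ^ (q ^ k)" for k
    using assms by (intro freshmans_dream'[of _ "e * k"]) (auto simp: power_mult)
  then show ?thesis by (simp add: poly_linearized[of \<kappa>, OF \<kappa>] sum.distrib distrib_left)
qed

lemma card_roots_linearized:
  assumes "of_nat q = (0 :: 'a)" and rts: "\<forall>z :: 'a alg_closure. poly (map_poly to_ac L) z = 0 \<longrightarrow> z \<in> range to_ac"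
  shows "card {w. poly L w = 0} = q ^ m"
proof -
  let ?L = "map_poly to_ac L"
  have hom: "poly (map_poly to_ac f) (to_ac w) = to_ac (poly f w)" for f :: "'a poly" and w
    by (induction f) (auto simp: map_poly_pCons)
  have "?L = (\<Sum>k\<le>m. Polynomial.monom (to_ac (a k)) (q ^ k))"
    unfolding L by (rule poly_eqI) (simp add: coeff_map_poly coeff_sum to_ac_sum if_distrib cong: if_cong)
  have L0: "L \<noteq> 0" using degree_linearized q by auto
  have "degree ?L = degree L" by (rule degree_map_poly) simp
  then have d: "degree ?L = q ^ m" using degree_linearized by simp
  then have "?L \<noteq> 0" using q by auto
  have "pderiv ?L = map_poly to_ac (pderiv L)"
    by (rule poly_eqI) (simp add: coeff_pderiv coeff_map_poly)
  also have "\<dots> = [:to_ac (a 0):]"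
    unfolding pderiv_linearized[OF assms(1)]
    by (rule poly_eqI) (simp add: coeff_map_poly coeff_pCons split: nat.splits)
  finally have "pderiv ?L = [:to_ac (a 0):]" .
  then have "card {z. poly ?L z = 0} = degree ?L" using am \<open>?L \<noteq> 0\<close> by (intro card_roots_separable) auto
  moreover have "{z. poly ?L z = 0} = to_ac ` {w. poly L w = 0}"
    using rts hom by force
  moreover have "inj_on to_ac {w. poly L w = 0}" by (auto simp: inj_on_def)
  ultimately show ?thesis using d by (simp add: card_image)
qed

end

section \<open>Absolute and relative maximal elements\<close>

theorem theorem4p2:
  fixes p e q s m r u n :: nat
    and a :: "nat \<Rightarrow> 'a::{finite,field}"
    and L :: "'a poly"
    and h :: "'a poly fract"
    and T P :: "nat \<Rightarrow> 'a poly fract set"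
    and gam lam :: "nat \<Rightarrow> nat"
    and \<iota> :: "'a poly fract \<Rightarrow> 'f::field"
    and y :: 'f
    and Q :: "nat \<Rightarrow> 'f set"
    and t :: "nat \<Rightarrow> nat \<Rightarrow> nat"
    and \<beta> :: "nat \<Rightarrow> int"
  assumes "prime p" and "e \<ge> 1" and "q = p ^ e"
    and "1 \<le> m" and "m \<le> s"
    and "card (UNIV :: 'a set) = q ^ s"
    \<comment> \<open>the linearized polynomial\<close>
    and "L = (\<Sum>k\<le>m. Polynomial.monom (a k) (q ^ k))" and "a m \<noteq> 0" and "a 0 \<noteq> 0"
    and "\<forall>z :: 'a alg_closure. poly (map_poly to_ac L) z = 0 \<longrightarrow> z \<in> range to_ac"
    \<comment> \<open>the rational function and its divisor\<close>
    and "h \<noteq> 0"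
    and "\<forall>k\<in>{1..u}. place const_fract (T k) \<and> gam k > 0"
    and "\<forall>k\<in>{1..r}. place const_fract (P k) \<and> lam k > 0 \<and> \<not> p dvd lam k"
    and "inj_on T {1..u}" and "inj_on P {1..r}" and "T ` {1..u} \<inter> P ` {1..r} = {}"
    and "principal_divisor const_fract h =
           (\<lambda>R. (\<Sum>k=1..u. if R = T k then int (gam k) else 0)
              - (\<Sum>k=1..r. if R = P k then int (lam k) else 0))"
    \<comment> \<open>the function field \<open>K(x,y)\<close> with \<open>L(y) = h(x)\<close>\<close>
    and "field_hom \<iota>"
    and "poly (map_poly (\<iota> \<circ> const_fract) L) y = \<iota> h"
    and "generated_subfield (insert y (range \<iota>)) = UNIV"
    \<comment> \<open>the places above the poles of \<open>h\<close>\<close>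
    and "\<forall>k\<in>{1..r}. place (\<iota> \<circ> const_fract) (Q k) \<and> lies_over \<iota> (Q k) (P k)"
    and "\<forall>k\<in>{1..n}. place_degree (\<iota> \<circ> const_fract) (Q k) = 1"
    and "2 \<le> n" and "n \<le> q ^ s" and "n \<le> r"
    and "\<forall>l\<in>{1..r}. \<forall>i\<in>{1..q ^ m - 1}. t l i = (i * lam l) mod q ^ m"
    and "\<forall>i\<in>{1..q ^ m - 1}. \<beta> i =
           (\<Sum>k=1..r. \<lceil>real (i * lam k) / real (q ^ m)\<rceil> * int (place_degree const_fract (P k))) - 1"
  shows "\<forall>(Upsilon, \<rho>) \<in>
           {(absolute_maximal_elements n (weierstrass_semigroup (\<iota> \<circ> const_fract) n Q), 0),
            (relative_maximal_elements n (weierstrass_semigroup (\<iota> \<circ> const_fract) n Q), int n - 2)}.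
         Upsilon =
           {(\<lambda>k\<in>{1..n}. int (q ^ m) * j k + int (t k i)) | i j.
              i \<in> {1..q ^ m - 1} \<and> (\<Sum>k=1..n. j k) = \<beta> i + 1 - int n + \<rho>}
         \<union> {(\<lambda>k\<in>{1..n}. int (q ^ m) * j k) | j. (\<Sum>k=1..n. j k) = \<rho>}"
proof -
  let ?N = "q ^ m" and ?\<kappa> = "\<iota> \<circ> const_fract"
  have p1: "p > 1" using assms(1) by (rule prime_gt_1_nat)
  then have q1: "q > 1" unfolding assms(3) using assms(2) by (intro one_less_power) auto
  then have N1: "?N > 1" using assms(4) by (intro one_less_power) auto
  have "card (UNIV :: 'a set) = p ^ (e * s)" using assms(3,6) by (simp add: power_mult)
  then have pa: "of_nat p = (0 :: 'a)" by (rule CHAR_finite_field[OF assms(1)])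
  then have qa: "of_nat q = (0 :: 'a)" using assms(2,3) by simp
  interpret field_hom \<iota> by fact
  have \<kappa>_nat: "?\<kappa> (of_nat k) = of_nat k" for k
    by (induction k) (simp_all add: const_fract_hom hom_add)
  have pf: "of_nat p = (0 :: 'f)" using \<kappa>_nat[of p] pa by (simp add: const_fract_hom)
  have \<kappa>0: "?\<kappa> 0 = 0" by (simp add: const_fract_hom)
  note lin = degree_linearized[OF q1 assms(7-9)] card_roots_linearized[OF q1 assms(7-9) qa assms(10)]
  have shift: "poly (map_poly ?\<kappa> L) (x + \<iota> (const_fract w)) = poly (map_poly ?\<kappa> L) x"
    if "w \<in> {w. poly L w = 0}" for w x
  proof -
    have "poly (map_poly ?\<kappa> L) (?\<kappa> w) = ?\<kappa> (poly L w)"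
      by (induction L) (simp_all add: map_poly_pCons const_fract_hom hom_add hom_mult)
    then have "poly (map_poly ?\<kappa> L) (?\<kappa> w) = 0" using that by (simp add: const_fract_hom)
    then show ?thesis
      using linearized_additive[where \<kappa> = ?\<kappa>, OF q1 assms(7-9) \<kappa>0 _ assms(1,3) pf, of x "?\<kappa> w"] by (simp add: const_fract_hom hom_add)
  qed
  have div: "place_val R h = (\<Sum>k=1..u. if R = T k then int (gam k) else 0) - (\<Sum>k=1..r. if R = P k then int (lam k) else 0)"
    if "place const_fract R" for R
    using fun_cong[OF assms(17), of R] that by (simp add: principal_divisor_def)
  have hP: "place_val (P k) h = - int (lam k)" if k: "k \<in> {1..r}" for k
  proof -
    have "P k \<noteq> T l" if "l \<in> {1..u}" for l using assms(16) k that by blast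
    then have "(\<Sum>l=1..u. if P k = T l then int (gam l) else 0) = 0"
      by (intro sum.neutral ballI if_not_P)
    moreover have "(\<Sum>l=1..r. if P k = P l then int (lam l) else 0) = (\<Sum>l=1..r. if k = l then int (lam l) else 0)"
      using assms(15) k by (intro sum.cong) (auto dest: inj_onD)
    ultimately show ?thesis using div[of "P k"] assms(13) k by simp
  qed
  have hR: "place_val R h \<ge> 0" if "place const_fract R" "R \<notin> P ` {1..r}" for R
  proof -
    have "(\<Sum>k=1..r. if R = P k then int (lam k) else 0) = 0" using that(2) by (intro sum.neutral) auto
    moreover have "(\<Sum>k=1..u. if R = T k then int (gam k) else 0) \<ge> 0" by (intro sum_nonneg) auto
    ultimately show ?thesis using div[OF that(1)] by simp
  qed
  have cop: "coprime ?N (lam k)" if "k \<in> {1..r}" for k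
    using assms(1,3,13) that prime_imp_coprime[of p "lam k"] by simp
  interpret lff: linearized_function_field \<iota> y ?N r n L "{w. poly L w = 0}" h P Q lam
  proof unfold_locales
    show "?N > 1" "degree L = ?N" "card {w. poly L w = 0} = ?N" by (fact N1 lin)+
    show "poly (map_poly ?\<kappa> L) (x + \<iota> (const_fract w)) = poly (map_poly ?\<kappa> L) x"
      if "w \<in> {w. poly L w = 0}" for w x using that by (rule shift)
    show "h \<noteq> 0" "inj_on P {1..r}" "generated_subfield (insert y (range \<iota>)) = UNIV"
      "poly (map_poly ?\<kappa> L) y = \<iota> h" "2 \<le> n" "n \<le> r" "n \<le> card (UNIV :: 'a set)"
      using assms by simp_all
    show "place const_fract (P k)" "coprime ?N (lam k) \<and> lam k > 0" "place_val (P k) h = - int (lam k)"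
      "place ?\<kappa> (Q k) \<and> lies_over \<iota> (Q k) (P k)" if "k \<in> {1..r}" for k
      using that assms(13,21) cop hP by blast+
    show "place_degree ?\<kappa> (Q k) = 1" if "k \<in> {1..n}" for k using that assms(22) by blast
    show "place_val R h \<ge> 0" if "place const_fract R" "R \<notin> P ` {1..r}" for R using that by (rule hR)
  qed
  have rem0: "lff.rem_part k 0 = 0" and bound0: "lff.bound 0 = 0" for k
    by (simp_all add: lff.rem_part_def lff.bound_def lff.floor_part_def lff.ceil_part_def)
  have rem: "lff.rem_part k i = int (t k i)" if "k \<in> {1..n}" "i \<in> {1..?N - 1}" for k i
    using that assms(25,26) by (simp add: lff.rem_part_def)
  have bound: "lff.bound i = \<beta> i + 1 - int n" if i: "i \<in> {1..?N - 1}" for i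
  proof -
    let ?d = "\<lambda>k. int (place_degree const_fract (P k))"
    have ceil: "\<lceil>real (i * lam k) / real ?N\<rceil> = lff.ceil_part k i" for k
      using ceiling_divide_eq_div[of "int (i * lam k)" "int ?N"] by (simp add: lff.ceil_part_def)
    \<comment> \<open>for \<open>0 < i < N\<close> the number \<open>N\<close> does not divide \<open>i \<lambda>\<^sub>k\<close>, so the ceiling exceeds the floor by 1\<close>
    have step: "lff.ceil_part k i * ?d k = lff.floor_part k i + 1" if k: "k \<in> {1..n}" for k
    proof -
      have kr: "k \<in> {1..r}" using k assms(25) by auto
      have "\<not> ?N dvd i * lam k"
      proof
        assume "?N dvd i * lam k"
        then have "?N dvd i" using cop[OF kr] by (simp add: coprime_dvd_mult_left_iff)
        then show False using i N1 by (auto dest!: dvd_imp_le)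
      qed
      then have "lff.rem_part k i > 0" by (simp add: lff.rem_part_def dvd_eq_mod_eq_0)
      moreover have "lff.rem_part k i < int ?N" using lff.cs.t_bounds[OF k] by blast
      ultimately have "lff.ceil_part k i \<le> lff.floor_part k i + 1" "\<not> lff.ceil_part k i \<le> lff.floor_part k i"
        unfolding lff.ceil_le_iff lff.floor_rem by (simp_all add: algebra_simps)
      then show ?thesis using lff.P_degree[OF k] by simp
    qed
    have "\<beta> i = (\<Sum>k=1..r. lff.ceil_part k i * ?d k) - 1" using bspec[OF assms(27) i] unfolding ceil .
    also have "(\<Sum>k=1..r. lff.ceil_part k i * ?d k) = (\<Sum>k=1..n. lff.ceil_part k i * ?d k) + (\<Sum>k=n+1..r. lff.ceil_part k i * ?d k)"
      by (rule lff.sum_split)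
    also have "(\<Sum>k=1..n. lff.ceil_part k i * ?d k) = (\<Sum>k=1..n. lff.floor_part k i + 1)"
      using step by (rule sum.cong[OF refl])
    finally show ?thesis by (simp add: lff.bound_def sum.distrib)
  qed
  have set_eq: "{\<alpha>. \<exists>i<?N. \<exists>j. lff.cs.level_sum j = lff.bound i + \<rho> \<and> \<alpha> = lff.cs.class_vec i j}
      = {(\<lambda>k\<in>{1..n}. int ?N * j k + int (t k i)) | i j. i \<in> {1..?N - 1} \<and> (\<Sum>k=1..n. j k) = \<beta> i + 1 - int n + \<rho>}
         \<union> {(\<lambda>k\<in>{1..n}. int ?N * j k) | j. (\<Sum>k=1..n. j k) = \<rho>}" (is "?A = ?B \<union> ?C") for \<rho>
  proof -
    have vec: "lff.cs.class_vec i j = (\<lambda>k\<in>{1..n}. int ?N * j k + int (t k i))" if "i \<in> {1..?N - 1}" for i j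
      unfolding lff.cs.class_vec_def using rem that by (intro restrict_ext) simp
    have vec0: "lff.cs.class_vec 0 j = (\<lambda>k\<in>{1..n}. int ?N * j k)" for j
      unfolding lff.cs.class_vec_def by (simp add: rem0)
    have split: "(i < ?N) = (i = 0 \<or> i \<in> {1..?N - 1})" for i using N1 q1 by auto
    have "?A = {lff.cs.class_vec i j | i j. i \<in> {1..?N - 1} \<and> lff.cs.level_sum j = lff.bound i + \<rho>}
        \<union> {lff.cs.class_vec 0 j | j. lff.cs.level_sum j = lff.bound 0 + \<rho>}"
      unfolding split by blast
    also have "{lff.cs.class_vec i j | i j. i \<in> {1..?N - 1} \<and> lff.cs.level_sum j = lff.bound i + \<rho>} = ?B"
      unfolding lff.cs.level_sum_def using vec bound by (intro Collect_cong) (metis (no_types, lifting))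
    also have "{lff.cs.class_vec 0 j | j. lff.cs.level_sum j = lff.bound 0 + \<rho>} = ?C"
      by (simp add: lff.cs.level_sum_def vec0 bound0)
    finally show ?thesis .
  qed
  have "absolute_maximal_elements n (weierstrass_semigroup ?\<kappa> n Q)
      = {\<alpha>. \<exists>i<?N. \<exists>j. lff.cs.level_sum j = lff.bound i + 0 \<and> \<alpha> = lff.cs.class_vec i j}"
    using lff.cs.absolute_maximal_iff by auto
  moreover have "relative_maximal_elements n (weierstrass_semigroup ?\<kappa> n Q)
      = {\<alpha>. \<exists>i<?N. \<exists>j. lff.cs.level_sum j = lff.bound i + (int n - 2) \<and> \<alpha> = lff.cs.class_vec i j}"
    using lff.cs.relative_maximal_iff by auto
  ultimately show ?thesis unfolding set_eq by simp
qed

end
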